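(* Let $\Phi$ be a generalized Young function that is admissible on $\mathbb{R}^d$ (see context) with exponents $m,\ell$. Assume that there are $\kappa,\delta\in C_+(\mathbb{R}^d)$ with $\ell^+<\kappa^-$ and $\kappa(x)\le\delta(x)$ for a.a. $x\in\mathbb{R}^d$ such that $$\min\{\lambda^{\kappa(x)},\lambda^{\delta(x)}\}\,\Phi_d(x,t)\le\Phi_d(x,\lambda t)\le\max\{\lambda^{\kappa(x)},\lambda^{\delta(x)}\}\,\Phi_d(x,t)\quad\text{for a.a. }x\in\mathbb{R}^d\text{ and all }\lambda,t\ge0.$$ Let $V\in L^1_{\mathrm{loc}}(\mathbb{R}^d)$ with $\operatorname{ess\,inf}_{\mathbb{R}^d}V>0$. Let $\{u_n\}_{n\in\mathbb{N}}$ be a bounded sequence in $W^{1,\Phi}_V(\mathbb{R}^d)$ such that $$u_n\rightharpoonup u\ \text{ in }W^{1,\Phi}_V(\mathbb{R}^d),$$ $$\big(\Phi(\cdot,|\nabla u_n|)+V\Phi(\cdot,|u_n|)\big)dx\overset{\ast}{\rightharpoonup}\mu\ \text{ in }\mathbb{M}(\mathbb{R}^d),\qquad \Phi_d(\cdot,|u_n|)\,dx\overset{\ast}{\rightharpoonup}\nu\ \text{ in }\mathbb{M}(\mathbb{R}^d).$$ Set $$\mu_\infty:=\lim_{R\to\infty}\limsup_{n\to\infty}\int_{B_R^c}\big[\Phi(x,|\nabla u_n|)+V(x)\Phi(x,|u_n|)\big]dx,\qquad \nu_\infty:=\lim_{R\to\infty}\limsup_{n\to\infty}\int_{B_R^c}\Phi_d(x,|u_n|)\,dx,$$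 where $B_R^c=\{x\in\mathbb{R}^d:|x|\ge R\}$. Then $$\limsup_{n\to\infty}\int_{\mathbb{R}^d}\big[\Phi(x,|\nabla u_n|)+V(x)\Phi(x,|u_n|)\big]dx=\mu(\mathbb{R}^d)+\mu_\infty,$$ $$\limsup_{n\to\infty}\int_{\mathbb{R}^d}\Phi_d(x,|u_n|)\,dx=\nu(\mathbb{R}^d)+\nu_\infty.$$ Furthermore, if for every $r\in\{m,\kappa,\ell,\delta\}$ there is a constant $r_\infty\in(0,\infty)$ with $\lim_{|x|\to\infty}r(x)=r_\infty$ and $r^-\le r_\infty\le r^+$, then $$S_2\min\Big\{\nu_\infty^{1/\kappa_\infty},\nu_\infty^{1/\delta_\infty}\Big\}\le\max\Big\{\mu_\infty^{1/m_\infty},\mu_\infty^{1/\ell_\infty}\Big\}.$$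
   Context: Generalized Young functions. A Young function is a convex, continuous, non-constant function $[0,\infty)\to[0,\infty)$ vanishing at $0$. A generalized Young function is $\Phi:\mathbb{R}^d\times[0,\infty)\to[0,\infty)$ such that $\Phi(x,\cdot)$ is a Young function for a.e. $x$ and $\Phi(\cdot,t)$ is measurable for every $t\ge0$. Write $\phi(x,t)=\partial\Phi(x,t)/\partial t$. All inverses are taken in the second variable. $C_+(\mathbb{R}^d)$ is the set of $g\in C(\mathbb{R}^d)$ with $1<g^-:=\inf g\le g^+:=\sup g<\infty$. Admissible. $\Phi$ is admissible on $\mathbb{R}^d$ if: (A1) there is $\beta\in(0,1]$ with $\beta\Phi^{-1}(x,t)\le\Phi^{-1}(y,t)$ for every ball $B\subset\mathbb{R}^d$ with $|B|\le1$, every $t\in[1,1/|B|]$ and a.a. $x,y\in B$; (A2) for every $s>0$ there are $\beta\in(0,1]$ and $h\in L^1(\mathbb{R}^d)\cap L^\infty(\mathbb{R}^d)$ with $\beta\Phi^{-1}(x,t)\le\Phi^{-1}(y,t)$ for a.a. $x,y\in\mathbb{R}^d$ and all $t\in[h(x)+h(y),s]$; (B0) there are $c_1,c_2>0$ with $c_1<\Phi(x,1)<c_2$ for a.a. $x\in\mathbb{R}^d$; the integral $\int_0\big(t/\lim_{|x|\to\infty}\Phi(x,t)\big)^{1/(d-1)}dt$ converges near $0$; $t\mapsto\Phi(x,t)$ is increasing on $[0,\infty)$ for a.a. $x$; and there are exponents $m,\ell\in C_+(\mathbb{R}^d)$ with $$m(x)\le\frac{\phi(x,t)t}{\Phi(x,t)}\le\ell(x)<\min\{d,m_*^-\}\quad\text{for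 all }x\in\mathbb{R}^d,\ t>0,\qquad m_*^-=\frac{m^-d}{d-m^-}.$$ Sobolev conjugate on $\mathbb{R}^d$. Put $\Phi_0(x,t)=\max\{\Phi(x,\Phi^{-1}(x,1)t),2t-1\}$, let $\overline\Phi(x,t)=2\Phi_0(x,t)-1$ for $t\ge1$ and $\overline\Phi(x,t)=\limsup_{|y|\to\infty}\Phi_0(y,t)$ for $0\le t<1$; then $\Phi_d(x,t)=\overline\Phi(x,G_1^{-1}(x,t))$ with $G_1(x,t)=\Big(\int_0^t\big(\tfrac{\tau}{\overline\Phi(x,\tau)}\big)^{\frac1{d-1}}d\tau\Big)^{\frac{d-1}{d}}$. Spaces. $L^\Phi(\mathbb{R}^d)$ is the set of measurable $u$ with $\int\Phi(x,\lambda|u|)dx<\infty$ for some $\lambda>0$, with Luxemburg norm $\|u\|_{L^\Phi}=\inf\{\lambda>0:\int\Phi(x,|u|/\lambda)dx\le1\}$. $W^{1,\Phi}_V(\mathbb{R}^d)=\{u\in L^\Phi(\mathbb{R}^d):\rho_V(u)<\infty\}$, where $\rho_V(u)=\int_{\mathbb{R}^d}\Phi(x,|\nabla u|)dx+\int_{\mathbb{R}^d}V(x)\Phi(x,|u|)dx$, with norm $\|u\|_{W^{1,\Phi}_V}=\inf\{\tau>0:\rho_V(u/\tau)\le1\}$. Under the assumptions $W^{1,\Phi}_V(\mathbb{R}^d)\hookrightarrow L^{\Phi_d}(\mathbb{R}^d)$ and $$S_2:=\inf_{0\ne v\in W^{1,\Phi}_V(\mathbb{R}^d)}\frac{\|v\|_{W^{1,\Phi}_V(\mathbb{R}^d)}}{\|v\|_{L^{\Phi_d}(\mathbb{R}^d)}}>0.$$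 Measures. $\mathbb{M}(\mathbb{R}^d)$ is the set of finite non-negative Borel measures on $\mathbb{R}^d$; $\mu_n\overset{\ast}{\rightharpoonup}\mu$ means $\int\varphi\,d\mu_n\to\int\varphi\,d\mu$ for all $\varphi\in C_0(\mathbb{R}^d)$ (the sup-norm closure of $C_c(\mathbb{R}^d)$). *)

theory Defs
  imports "HOL-Analysis.Analysis"
begin

section \<open>Generalized Young functions\<close>

definition young_function :: "(real \<Rightarrow> real) \<Rightarrow> bool" where
  "young_function f \<longleftrightarrow>
     convex_on {0..} f \<and> continuous_on {0..} f \<and> (\<forall>t\<ge>0. 0 \<le> f t) \<and>
     \<not> f constant_on {0..} \<and> f 0 = 0"

text \<open>A function of (x, t) with t \<ge> 0 is curried and total; its values at t < 0 are irrelevant.\<close>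

definition generalized_young :: "(real^'n \<Rightarrow> real \<Rightarrow> real) \<Rightarrow> bool" where
  "generalized_young \<Phi> \<longleftrightarrow>
     (\<forall>x. \<forall>t\<ge>0. 0 \<le> \<Phi> x t) \<and>
     (AE x in lebesgue. young_function (\<Phi> x)) \<and>
     (\<forall>t\<ge>0. (\<lambda>x. \<Phi> x t) \<in> borel_measurable lebesgue)"

text \<open>Inverse in the second variable, as a map on the half-line.\<close>

definition inv2 :: "('x \<Rightarrow> real \<Rightarrow> real) \<Rightarrow> 'x \<Rightarrow> real \<Rightarrow> real" where
  "inv2 F x t = inv_into {0..} (F x) t"

definition exp_minus :: "('x \<Rightarrow> real) \<Rightarrow> real" where
  "exp_minus g = (INF x. g x)"

definition exp_plus :: "('x \<Rightarrow> real) \<Rightarrow> real" where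
  "exp_plus g = (SUP x. g x)"

definition C_plus :: "(real^'n \<Rightarrow> real) set" where
  "C_plus = {g. continuous_on UNIV g \<and> bdd_below (range g) \<and> bdd_above (range g) \<and>
                1 < exp_minus g}"

section \<open>Admissibility\<close>

definition cond_A1 :: "(real^'n \<Rightarrow> real \<Rightarrow> real) \<Rightarrow> bool" where
  "cond_A1 \<Phi> \<longleftrightarrow>
     (\<exists>\<beta>. 0 < \<beta> \<and> \<beta> \<le> 1 \<and>
        (\<forall>c r. 0 < r \<longrightarrow> measure lebesgue (ball c r) \<le> 1 \<longrightarrow>
          (\<forall>t\<in>{1..1 / measure lebesgue (ball c r)}.
             AE x in lebesgue. x \<in> ball c r \<longrightarrow>
               (AE y in lebesgue. y \<in> ball c r \<longrightarrow> \<beta> * inv2 \<Phi> x t \<le> inv2 \<Phi> y t))))"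

text \<open>As \<open>h\<close> may be negative, \<open>t \<ge> 0\<close> is imposed explicitly: the inverse is defined there only.\<close>

definition cond_A2 :: "(real^'n \<Rightarrow> real \<Rightarrow> real) \<Rightarrow> bool" where
  "cond_A2 \<Phi> \<longleftrightarrow>
     (\<forall>s>0. \<exists>\<beta> h. 0 < \<beta> \<and> \<beta> \<le> 1 \<and>
        integrable lebesgue h \<and> (\<exists>C. AE x in lebesgue. \<bar>h x\<bar> \<le> C) \<and>
        (AE x in lebesgue. AE y in lebesgue.
           \<forall>t\<ge>0. t \<in> {h x + h y..s} \<longrightarrow> \<beta> * inv2 \<Phi> x t \<le> inv2 \<Phi> y t))"

definition cond_B0 :: "(real^'n \<Rightarrow> real \<Rightarrow> real) \<Rightarrow> bool" where
  "cond_B0 \<Phi> \<longleftrightarrow> (\<exists>c1>0. \<exists>c2>0. AE x in lebesgue. c1 < \<Phi> x 1 \<and> \<Phi> x 1 < c2)"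

text \<open>Convergence near 0 of the integral of \<open>(t / \<Phi>inf t) powr (1/(d-1))\<close>, where \<open>\<Phi>inf t\<close> is the
  limit of \<open>\<Phi> x t\<close> as \<open>x\<close> tends to infinity.\<close>

definition cond_infinity :: "(real^'n \<Rightarrow> real \<Rightarrow> real) \<Rightarrow> bool" where
  "cond_infinity \<Phi> \<longleftrightarrow>
     (\<exists>\<epsilon>>0. \<exists>\<Phi>inf.
        (\<forall>t\<in>{0<..<\<epsilon>}. ((\<lambda>x. \<Phi> x t) \<longlongrightarrow> \<Phi>inf t) at_infinity) \<and>
        (\<integral>\<^sup>+t\<in>{0<..<\<epsilon>}. ennreal ((t / \<Phi>inf t) powr (1 / (real CARD('n) - 1))) \<partial>lborel) < \<infinity>)"

definition cond_exponents ::
    "(real^'n \<Rightarrow> real \<Rightarrow> real) \<Rightarrow> (real^'n \<Rightarrow> real) \<Rightarrow> (real^'n \<Rightarrow> real) \<Rightarrow> bool" where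
  "cond_exponents \<Phi> m l \<longleftrightarrow>
     m \<in> C_plus \<and> l \<in> C_plus \<and>
     (\<forall>x. \<forall>t>0. \<Phi> x differentiable at t \<and>
        m x \<le> deriv (\<Phi> x) t * t / \<Phi> x t \<and> deriv (\<Phi> x) t * t / \<Phi> x t \<le> l x) \<and>
     (\<forall>x. l x < min (real CARD('n))
                    (exp_minus m * real CARD('n) / (real CARD('n) - exp_minus m)))"

definition admissible ::
    "(real^'n \<Rightarrow> real \<Rightarrow> real) \<Rightarrow> (real^'n \<Rightarrow> real) \<Rightarrow> (real^'n \<Rightarrow> real) \<Rightarrow> bool" where
  "admissible \<Phi> m l \<longleftrightarrow>
     cond_A1 \<Phi> \<and> cond_A2 \<Phi> \<and> cond_B0 \<Phi> \<and> cond_infinity \<Phi> \<and>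
     (AE x in lebesgue. strict_mono_on {0..} (\<Phi> x)) \<and>
     cond_exponents \<Phi> m l"

section \<open>The Sobolev conjugate\<close>

definition Phi0 :: "(real^'n \<Rightarrow> real \<Rightarrow> real) \<Rightarrow> real^'n \<Rightarrow> real \<Rightarrow> real" where
  "Phi0 \<Phi> x t = max (\<Phi> x (inv2 \<Phi> x 1 * t)) (2 * t - 1)"

definition Phi_bar :: "(real^'n \<Rightarrow> real \<Rightarrow> real) \<Rightarrow> real^'n \<Rightarrow> real \<Rightarrow> real" where
  "Phi_bar \<Phi> x t =
     (if 1 \<le> t then 2 * Phi0 \<Phi> x t - 1
      else real_of_ereal (Limsup at_infinity (\<lambda>y. ereal (Phi0 \<Phi> y t))))"

definition G1 :: "(real^'n \<Rightarrow> real \<Rightarrow> real) \<Rightarrow> real^'n \<Rightarrow> real \<Rightarrow> real" where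
  "G1 \<Phi> x t =
     (LINT \<tau>:{0..t}|lborel. (\<tau> / Phi_bar \<Phi> x \<tau>) powr (1 / (real CARD('n) - 1)))
       powr ((real CARD('n) - 1) / real CARD('n))"

definition sobolev_conj :: "(real^'n \<Rightarrow> real \<Rightarrow> real) \<Rightarrow> real^'n \<Rightarrow> real \<Rightarrow> real" where
  "sobolev_conj \<Phi> x t = Phi_bar \<Phi> x (inv2 (G1 \<Phi>) x t)"

section \<open>Weak gradients\<close>

definition locally_integrable :: "(real^'n \<Rightarrow> 'b::{banach, second_countable_topology}) \<Rightarrow> bool" where
  "locally_integrable f \<longleftrightarrow> (\<forall>K. compact K \<longrightarrow> set_integrable lebesgue K f)"

definition partial_deriv :: "'n \<Rightarrow> (real^'n \<Rightarrow> real) \<Rightarrow> real^'n \<Rightarrow> real" where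
  "partial_deriv i f x = frechet_derivative f (at x) (axis i 1)"

primrec Ck :: "nat \<Rightarrow> (real^'n \<Rightarrow> real) \<Rightarrow> bool" where
  "Ck 0 f \<longleftrightarrow> continuous_on UNIV f"
| "Ck (Suc k) f \<longleftrightarrow> (\<forall>x. f differentiable at x) \<and> (\<forall>i. Ck k (partial_deriv i f))"

definition test_function :: "(real^'n \<Rightarrow> real) \<Rightarrow> bool" where
  "test_function f \<longleftrightarrow> (\<forall>k. Ck k f) \<and> compact (closure {x. f x \<noteq> 0})"

definition has_weak_gradient :: "(real^'n \<Rightarrow> real) \<Rightarrow> (real^'n \<Rightarrow> real^'n) \<Rightarrow> bool" where
  "has_weak_gradient u g \<longleftrightarrow>
     locally_integrable u \<and> locally_integrable g \<and>
     (\<forall>f i. test_function f \<longrightarrow>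
        (LINT x|lebesgue. u x * partial_deriv i f x) = - (LINT x|lebesgue. g x $ i * f x))"

text \<open>The weak gradient is unique only up to null sets; an arbitrary representative is chosen.\<close>

definition weak_grad :: "(real^'n \<Rightarrow> real) \<Rightarrow> real^'n \<Rightarrow> real^'n" where
  "weak_grad u = (SOME g. has_weak_gradient u g)"

section \<open>Function spaces\<close>

text \<open>Elements of the spaces are functions rather than classes modulo null sets. Modulars and norms
  are extended nonnegative; a norm is finite exactly when its defining set is nonempty.\<close>

definition L_space :: "(real^'n \<Rightarrow> real \<Rightarrow> real) \<Rightarrow> (real^'n \<Rightarrow> real) set" where
  "L_space \<Phi> = {u \<in> borel_measurable lebesgue.
     \<exists>c>0. (\<integral>\<^sup>+x. ennreal (\<Phi> x (c * \<bar>u x\<bar>)) \<partial>lebesgue) < \<infinity>}"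

definition L_norm :: "(real^'n \<Rightarrow> real \<Rightarrow> real) \<Rightarrow> (real^'n \<Rightarrow> real) \<Rightarrow> ennreal" where
  "L_norm \<Phi> u =
     Inf {ennreal c | c. 0 < c \<and> (\<integral>\<^sup>+x. ennreal (\<Phi> x (\<bar>u x\<bar> / c)) \<partial>lebesgue) \<le> 1}"

definition energy ::
    "(real^'n \<Rightarrow> real \<Rightarrow> real) \<Rightarrow> (real^'n \<Rightarrow> real) \<Rightarrow> (real^'n \<Rightarrow> real) \<Rightarrow> real^'n \<Rightarrow> ennreal" where
  "energy \<Phi> V u x = ennreal (\<Phi> x (norm (weak_grad u x))) + ennreal (V x * \<Phi> x \<bar>u x\<bar>)"

definition W_modular ::
    "(real^'n \<Rightarrow> real \<Rightarrow> real) \<Rightarrow> (real^'n \<Rightarrow> real) \<Rightarrow> (real^'n \<Rightarrow> real) \<Rightarrow> ennreal" where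
  "W_modular \<Phi> V u =
     (\<integral>\<^sup>+x. ennreal (\<Phi> x (norm (weak_grad u x))) \<partial>lebesgue) +
     (\<integral>\<^sup>+x. ennreal (V x * \<Phi> x \<bar>u x\<bar>) \<partial>lebesgue)"

definition W_space ::
    "(real^'n \<Rightarrow> real \<Rightarrow> real) \<Rightarrow> (real^'n \<Rightarrow> real) \<Rightarrow> (real^'n \<Rightarrow> real) set" where
  "W_space \<Phi> V = {u \<in> L_space \<Phi>. (\<exists>g. has_weak_gradient u g) \<and> W_modular \<Phi> V u < \<infinity>}"

definition W_norm ::
    "(real^'n \<Rightarrow> real \<Rightarrow> real) \<Rightarrow> (real^'n \<Rightarrow> real) \<Rightarrow> (real^'n \<Rightarrow> real) \<Rightarrow> ennreal" where
  "W_norm \<Phi> V u = Inf {ennreal c | c. 0 < c \<and> W_modular \<Phi> V (\<lambda>x. u x / c) \<le> 1}"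

definition W_bounded ::
    "(real^'n \<Rightarrow> real \<Rightarrow> real) \<Rightarrow> (real^'n \<Rightarrow> real) \<Rightarrow> (nat \<Rightarrow> real^'n \<Rightarrow> real) \<Rightarrow> bool" where
  "W_bounded \<Phi> V us \<longleftrightarrow>
     (\<forall>n. us n \<in> W_space \<Phi> V) \<and> (\<exists>C::real. \<forall>n. W_norm \<Phi> V (us n) \<le> ennreal C)"

text \<open>Continuous linear functionals; the norm bound makes them invariant under changes on null sets.\<close>

definition W_dual ::
    "(real^'n \<Rightarrow> real \<Rightarrow> real) \<Rightarrow> (real^'n \<Rightarrow> real) \<Rightarrow> ((real^'n \<Rightarrow> real) \<Rightarrow> real) set" where
  "W_dual \<Phi> V = {F.
     (\<forall>u\<in>W_space \<Phi> V. \<forall>v\<in>W_space \<Phi> V. F (\<lambda>x. u x + v x) = F u + F v) \<and>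
     (\<forall>u\<in>W_space \<Phi> V. \<forall>c. F (\<lambda>x. c * u x) = c * F u) \<and>
     (\<exists>C::real. \<forall>u\<in>W_space \<Phi> V. ennreal \<bar>F u\<bar> \<le> ennreal C * W_norm \<Phi> V u)}"

definition W_weak_conv ::
    "(real^'n \<Rightarrow> real \<Rightarrow> real) \<Rightarrow> (real^'n \<Rightarrow> real) \<Rightarrow> (nat \<Rightarrow> real^'n \<Rightarrow> real) \<Rightarrow>
     (real^'n \<Rightarrow> real) \<Rightarrow> bool" where
  "W_weak_conv \<Phi> V us u \<longleftrightarrow>
     (\<forall>n. us n \<in> W_space \<Phi> V) \<and> u \<in> W_space \<Phi> V \<and>
     (\<forall>F\<in>W_dual \<Phi> V. (\<lambda>n. F (us n)) \<longlonglongrightarrow> F u)"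

definition S2 :: "(real^'n \<Rightarrow> real \<Rightarrow> real) \<Rightarrow> (real^'n \<Rightarrow> real) \<Rightarrow> ennreal" where
  "S2 \<Phi> V = (INF v\<in>{v \<in> W_space \<Phi> V. \<not> (AE x in lebesgue. v x = 0)}.
                W_norm \<Phi> V v / L_norm (sobolev_conj \<Phi>) v)"

definition essinf :: "(real^'n \<Rightarrow> real) \<Rightarrow> ereal" where
  "essinf V = Sup {c. AE x in lebesgue. c \<le> ereal (V x)}"

section \<open>Measures\<close>

definition finite_borel :: "(real^'n) measure set" where
  "finite_borel = {\<mu>. sets \<mu> = sets borel \<and> finite_measure \<mu>}"

definition C0 :: "((real^'n) \<Rightarrow>\<^sub>C real) set" where
  "C0 = closure {f. compact (closure {x. apply_bcontfun f x \<noteq> 0})}"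

definition weak_star_conv :: "(nat \<Rightarrow> (real^'n) measure) \<Rightarrow> (real^'n) measure \<Rightarrow> bool" where
  "weak_star_conv \<mu>s \<mu> \<longleftrightarrow>
     (\<forall>n. \<mu>s n \<in> finite_borel) \<and> \<mu> \<in> finite_borel \<and>
     (\<forall>f\<in>C0. (\<lambda>n. LINT x|\<mu>s n. apply_bcontfun f x) \<longlonglongrightarrow> (LINT x|\<mu>. apply_bcontfun f x))"

text \<open>The measure \<open>f dx\<close>; the density is only Lebesgue measurable, so \<open>distr\<close> serves to restrict the
  measure to the Borel sets.\<close>

definition borel_density :: "(real^'n \<Rightarrow> ennreal) \<Rightarrow> (real^'n) measure" where
  "borel_density f = distr (density lebesgue f) borel (\<lambda>x. x)"

definition mass_at_infinity :: "(nat \<Rightarrow> real^'n \<Rightarrow> ennreal) \<Rightarrow> ennreal" where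
  "mass_at_infinity f =
     Lim at_top (\<lambda>R::real. limsup (\<lambda>n. \<integral>\<^sup>+x\<in>{x. R \<le> norm x}. f n x \<partial>lebesgue))"

text \<open>Real powers on \<open>[0, \<infinity>]\<close>, for positive exponents.\<close>

definition epowr :: "ennreal \<Rightarrow> real \<Rightarrow> ennreal" where
  "epowr z a = (if z = \<infinity> then \<infinity> else ennreal (enn2real z powr a))"

definition limit_exponent :: "(real^'n \<Rightarrow> real) \<Rightarrow> real \<Rightarrow> bool" where
  "limit_exponent r rinf \<longleftrightarrow>
     0 < rinf \<and> (r \<longlongrightarrow> rinf) at_infinity \<and> exp_minus r \<le> rinf \<and> rinf \<le> exp_plus r"

end

theory Submission
  imports Defs
begin

text \<open>Splitting \<open>f\<^sub>n\<close> with compactly supported cutoffs turns weak-star convergence of \<open>f\<^sub>n dx\<close> into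
  \<open>limsup \<integral> f\<^sub>n = \<integral> \<chi>\<^sub>R d\<mu> + limsup \<integral> (1 - \<chi>\<^sub>R) f\<^sub>n\<close>, and \<open>R \<rightarrow> \<infinity>\<close> gives the two equalities. They rest on
  the measurability of the densities, that is, on \<open>\<Phi>\<^sub>d\<close> being a Caratheodory function.

  For the inequality, apply the definition of \<open>S\<^sub>2\<close> to \<open>\<eta> u\<^sub>n\<close>, where the smooth cutoff \<open>\<eta>\<close> vanishes on the
  ball of radius \<open>R\<close> and \<open>|\<nabla>\<eta>| \<le> 4 / R\<close>. Since \<open>V\<close> is bounded below by a positive constant, the
  integrals of \<open>\<Phi>(x, |u\<^sub>n|)\<close> are bounded, so the term with \<open>u\<^sub>n \<nabla>\<eta>\<close> is \<open>O(R powr (- m\<^sup>-))\<close> uniformly in \<open>n\<close>,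
  without a compact embedding. Outside a large ball the exponents are close to their limits,
  and there the modulars control the Luxemburg norms by powers.\<close>

section \<open>Smooth functions\<close>

text \<open>The inequality carries no multiplicative constant, so every error of the cutoff has to
  disappear in a limit. Hence the gradient of the product is split by convexity with unequal weights
  \<open>1 - r\<close> and \<open>r\<close>: the factor on the main term tends to 1 with
  \<open>r\<close>, while the factor on the remainder blows up and is beaten by a large
  \<open>R\<close> chosen afterwards. Likewise the loss of the cutoff at radius \<open>k * R\<close>
  is a factor that tends to 1 as \<open>k\<close> grows. The estimates run with real numbers
  strictly above the energy at infinity and strictly below the conjugate mass at infinity, and with
  exponents widened by a margin; these gaps are closed last. Measurability is shaped by null sets.
  The growth exponents are available at every point, but vanishing and continuity at 0 only almost
  everywhere, whereas the limit superior inside the conjugate runs over all points. It is bounded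
  above by the growth exponents alone, and below by almost-everywhere information, which is met at
  points arbitrarily far out.\<close>

lemma partial_deriv_eq:
  "(f has_derivative f') (at x) \<Longrightarrow> partial_deriv i f x = f' (axis i 1)"
  unfolding partial_deriv_def by (metis frechet_derivative_at)

lemma Ck_differentiable: "Ck (Suc k) f \<Longrightarrow> f differentiable at x"
  by simp

lemma Ck_Suc_imp_Ck: "Ck (Suc k) f \<Longrightarrow> Ck k f"
proof (induction k arbitrary: f)
  case 0
  then show ?case
    by (auto simp: continuous_on_eq_continuous_at intro: differentiable_imp_continuous_within)
qed auto

lemma Ck_const [simp]: "Ck k (\<lambda>x::real^'n. c)"
proof (induction k arbitrary: c)
  case (Suc k)
  have "partial_deriv i (\<lambda>x::real^'n. c) = (\<lambda>x. 0)" for i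
    by (rule ext) (rule partial_deriv_eq[OF has_derivative_const])
  with Suc show ?case by simp
qed simp

lemma Ck_add:
  assumes "Ck k f" "Ck k g"
  shows "Ck k (\<lambda>x. f x + g x)"
  using assms
proof (induction k arbitrary: f g)
  case (Suc k)
  then have d: "f differentiable at x" "g differentiable at x" for x
    by auto
  have "partial_deriv i (\<lambda>x. f x + g x) = (\<lambda>x. partial_deriv i f x + partial_deriv i g x)" for i
    by (rule ext, rule partial_deriv_eq[THEN trans])
      (auto intro!: has_derivative_add d[THEN frechet_derivative_works[THEN iffD1]] simp: partial_deriv_def)
  with Suc d show ?case by simp
qed (auto intro: continuous_intros)

lemma partial_deriv_mult:
  assumes "f differentiable at x" "g differentiable at x"
  shows "partial_deriv i (\<lambda>x. f x * g x) x = f x * partial_deriv i g x + partial_deriv i f x * g x"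
  by (rule partial_deriv_eq[THEN trans])
    (auto intro!: has_derivative_mult assms[THEN frechet_derivative_works[THEN iffD1]] simp: partial_deriv_def)

lemma Ck_mult:
  assumes "Ck k f" "Ck k g"
  shows "Ck k (\<lambda>x. f x * g x)"
  using assms
proof (induction k arbitrary: f g)
  case (Suc k)
  then have d: "f differentiable at x" "g differentiable at x" for x
    by auto
  have "partial_deriv i (\<lambda>x. f x * g x) = (\<lambda>x. f x * partial_deriv i g x + partial_deriv i f x * g x)" for i
    using partial_deriv_mult[OF d] by blast
  moreover have "Ck k (\<lambda>x. f x * partial_deriv i g x + partial_deriv i f x * g x)" for i
    using Suc.prems Ck_Suc_imp_Ck[OF Suc.prems(1)] Ck_Suc_imp_Ck[OF Suc.prems(2)]
    by (intro Ck_add Suc.IH) auto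
  ultimately show ?case using d by simp
qed (auto intro: continuous_intros)

lemma Ck_prod:
  assumes "finite A" "\<And>a. a \<in> A \<Longrightarrow> Ck k (f a)"
  shows "Ck k (\<lambda>x. \<Prod>a\<in>A. f a x)"
  using assms by (induction A rule: finite_induct) (auto intro: Ck_mult)

lemma Ck_sum:
  assumes "finite A" "\<And>a. a \<in> A \<Longrightarrow> Ck k (f a)"
  shows "Ck k (\<lambda>x. \<Sum>a\<in>A. f a x)"
  using assms by (induction A rule: finite_induct) (auto intro: Ck_add)

lemma has_derivative_component: "((\<lambda>x::real^'n. x $ j) has_derivative (\<lambda>h. h $ j)) (at x)"
  by (rule bounded_linear_imp_has_derivative[OF bounded_linear_vec_nth])

lemma Ck_component [simp]: "Ck k (\<lambda>x. x $ j)"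
proof (cases k)
  case 0
  then show ?thesis by (auto intro: continuous_intros)
next
  case (Suc k)
  have "partial_deriv i (\<lambda>x. x $ j) = (\<lambda>x. axis i 1 $ j)" for i
    by (rule ext) (rule partial_deriv_eq[OF has_derivative_component])
  moreover have "(\<lambda>x::real^'a. x $ j) differentiable at x" for x
    using has_derivative_component differentiable_def by blast
  ultimately show ?thesis by (simp add: Suc)
qed

text \<open>The derivative of a member of this family is a linear combination of two others, so that
  smoothness follows by induction on the order.\<close>

definition bump :: "nat \<Rightarrow> real \<Rightarrow> real" where
  "bump n s = (if 0 < s then (1 / s) ^ n * exp (- (1 / s)) else 0)"

lemma bump_nonneg: "0 \<le> bump n s"
  by (simp add: bump_def)

lemma tendsto_bump_0: "((\<lambda>s. bump n s) \<longlongrightarrow> 0) (at_right 0)"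
proof -
  have "((\<lambda>s. (inverse s) ^ n / exp (inverse s :: real)) \<longlongrightarrow> 0) (at_right 0)"
    by (rule filterlim_compose[OF tendsto_power_div_exp_0 filterlim_inverse_at_top_right])
  then show ?thesis
    by (rule Lim_transform_eventually)
      (auto simp: eventually_at_right_field bump_def exp_minus field_simps intro!: exI[of _ 1])
qed

text \<open>One formula serves on the whole line because every member of the family vanishes for
  \<open>s \<le> 0\<close>; the chain rule then applies without case distinctions.\<close>

lemma bump_deriv:
  "(bump n has_real_derivative (bump (n + 2) s - n * bump (n + 1) s)) (at s)"
proof (cases "s = 0")
  case True
  have "((\<lambda>h. (bump n (0 + h) - bump n 0) / h) \<longlongrightarrow> 0) (at 0)"
  proof (rule filterlim_split_at)
    show "((\<lambda>h. (bump n (0 + h) - bump n 0) / h) \<longlongrightarrow> 0) (at_right 0)"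
      \<comment> \<open>To the right of 0 the difference quotient of \<open>bump n\<close> is
        exactly \<open>bump (Suc n)\<close>.\<close>
      by (rule Lim_transform_eventually[OF tendsto_bump_0[of "Suc n"]])
        (auto simp: eventually_at_right_field bump_def field_simps intro!: exI[of _ 1])
    show "((\<lambda>h. (bump n (0 + h) - bump n 0) / h) \<longlongrightarrow> 0) (at_left 0)"
      by (rule Lim_transform_eventually[OF tendsto_const])
        (auto simp: eventually_at_left_field bump_def intro!: exI[of _ "-1"])
  qed
  with True show ?thesis by (simp add: DERIV_def bump_def)
next
  case False
  then consider "s < 0" | "0 < s" by linarith
  then show ?thesis
  proof cases
    case 1
    have "((\<lambda>s. 0) has_real_derivative 0) (at s)" by simp
    moreover have "eventually (\<lambda>s. bump n s = 0) (nhds s)"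
      using eventually_nhds_in_open[of "{..<0}" s] 1
      by (auto simp: bump_def elim!: eventually_mono)
    ultimately show ?thesis
      using 1 by (subst DERIV_cong_ev[OF refl _ refl]) (auto simp: bump_def)
  next
    case 2
    have d: "((\<lambda>s. 1 / s) has_real_derivative - ((1 / s) ^ 2)) (at s)"
      using 2 by (auto intro!: derivative_eq_intros simp: power2_eq_square)
    have "((\<lambda>s. (1 / s) ^ n * exp (- (1 / s))) has_real_derivative
        real n * (- ((1 / s)\<^sup>2) * (1 / s) ^ (n - Suc 0)) * exp (- (1 / s)) +
        exp (- (1 / s)) * (- (- ((1 / s)\<^sup>2))) * (1 / s) ^ n) (at s)"
      by (rule DERIV_mult[OF DERIV_power[OF d] DERIV_fun_exp[OF DERIV_minus[OF d]]])
    also have "real n * (- ((1 / s)\<^sup>2) * (1 / s) ^ (n - Suc 0)) * exp (- (1 / s)) +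
        exp (- (1 / s)) * (- (- ((1 / s)\<^sup>2))) * (1 / s) ^ n = bump (n + 2) s - n * bump (n + 1) s"
      using 2 by (cases n) (simp_all add: bump_def power2_eq_square algebra_simps del: power_divide)
    finally have "((\<lambda>s. (1 / s) ^ n * exp (- (1 / s))) has_real_derivative
        (bump (n + 2) s - n * bump (n + 1) s)) (at s)" .
    moreover have "eventually (\<lambda>s. (1 / s) ^ n * exp (- (1 / s)) = bump n s) (nhds s)"
      using eventually_nhds_in_open[of "{0<..}" s] 2
      by (auto simp: bump_def elim!: eventually_mono)
    ultimately show ?thesis
      by (subst (asm) DERIV_cong_ev[OF refl _ refl]) auto
  qed
qed

lemma has_derivative_bump_comp:
  assumes "(g has_derivative g') (at x)"
  shows "((\<lambda>x. bump n (g x)) has_derivative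
    (\<lambda>h. (bump (n + 2) (g x) - n * bump (n + 1) (g x)) * g' h)) (at x)"
  using has_derivative_compose[OF assms bump_deriv[of n "g x", unfolded has_field_derivative_def]]
  by simp

lemma partial_deriv_bump_comp:
  assumes "g differentiable at x"
  shows "partial_deriv i (\<lambda>x. bump n (g x)) x =
    (bump (n + 2) (g x) - n * bump (n + 1) (g x)) * partial_deriv i g x"
  using partial_deriv_eq[OF has_derivative_bump_comp[OF assms[THEN frechet_derivative_works[THEN iffD1]]]]
  by (simp add: partial_deriv_def)

lemma Ck_bump_comp:
  assumes "\<And>k. Ck k g"
  shows "Ck k (\<lambda>x. bump n (g x))"
proof (induction k arbitrary: n)
  case 0
  have "continuous_on UNIV g" "continuous_on UNIV (bump n)"
    using assms[of 0] DERIV_continuous_on[of UNIV "bump n", OF bump_deriv] by auto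
  then show ?case by (auto intro: continuous_on_compose2)
next
  case (Suc k)
  have d: "g differentiable at x" for x
    using assms Ck_differentiable by blast
  have "partial_deriv i (\<lambda>x. bump n (g x)) =
      (\<lambda>x. (bump (n + 2) (g x) + (- real n) * bump (n + 1) (g x)) * partial_deriv i g x)" for i
    using partial_deriv_bump_comp[OF d] by (auto simp: fun_eq_iff)
  moreover have "Ck k (\<lambda>x. (bump (n + 2) (g x) + (- real n) * bump (n + 1) (g x)) * partial_deriv i g x)" for i
    using assms[of "Suc k"] by (intro Ck_mult Ck_add Suc.IH Ck_const) auto
  moreover have "(\<lambda>x. bump n (g x)) differentiable at x" for x
    using has_derivative_bump_comp[OF d[THEN frechet_derivative_works[THEN iffD1]]]
      differentiable_def by blast
  ultimately show ?case by simp
qed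

section \<open>Weak gradients\<close>

lemma test_function_continuous: "test_function f \<Longrightarrow> continuous_on UNIV f"
  unfolding test_function_def using Ck.simps(1) by blast

lemma compact_closed_subset:
  fixes S :: "'a::heine_borel set"
  shows "compact T \<Longrightarrow> closed S \<Longrightarrow> S \<subseteq> T \<Longrightarrow> compact S"
  using bounded_subset by (auto simp: compact_eq_bounded_closed)

lemma test_function_mult:
  assumes "\<And>k. Ck k g" "test_function f"
  shows "test_function (\<lambda>x. g x * f x)"
proof -
  have "closure {x. g x * f x \<noteq> 0} \<subseteq> closure {x. f x \<noteq> 0}"
    by (intro closure_mono) auto
  with assms show ?thesis
    unfolding test_function_def using Ck_mult compact_closed_subset[OF _ closed_closure] by blast
qed

lemma partial_deriv_eq_0:
  assumes "x \<notin> closure {x. f x \<noteq> 0}"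
  shows "partial_deriv i f x = 0"
proof -
  define S where "S = - closure {x. f x \<noteq> 0}"
  have "open S" "x \<in> S" using assms by (auto simp: S_def)
  moreover have "f y = 0" if "y \<in> S" for y
    using that closure_subset[of "{x. f x \<noteq> 0}"] by (auto simp: S_def)
  ultimately have "(f has_derivative (\<lambda>h. 0)) (at x)"
    by (metis has_derivative_transform_within_open has_derivative_const)
  then show ?thesis by (rule partial_deriv_eq)
qed

section \<open>Local integrability and compactly supported factors\<close>

lemma locally_integrable_measurable:
  assumes "locally_integrable f"
  shows "f \<in> borel_measurable lebesgue"
proof (rule borel_measurable_LIMSEQ_metric)
  show "(\<lambda>x. indicat_real (cball 0 (real n)) x *\<^sub>R f x) \<in> borel_measurable lebesgue" for n
    using assms unfolding locally_integrable_def set_integrable_def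
    by (blast intro: borel_measurable_integrable compact_cball)
  show "(\<lambda>n. indicat_real (cball 0 (real n)) x *\<^sub>R f x) \<longlonglongrightarrow> f x" for x
  proof (rule tendsto_eventually)
    obtain N where "norm x \<le> real N" using real_arch_simple by blast
    then show "\<forall>\<^sub>F n in sequentially. indicat_real (cball 0 (real n)) x *\<^sub>R f x = f x"
      by (intro eventually_sequentiallyI[of N]) (auto simp: indicator_def)
  qed
qed

lemma locally_integrable_scaleR:
  fixes \<phi> :: "real^'n \<Rightarrow> real"
  assumes "continuous_on UNIV \<phi>" "locally_integrable g"
  shows "locally_integrable (\<lambda>x. \<phi> x *\<^sub>R g x)"
  unfolding locally_integrable_def
proof (intro allI impI)
  fix K :: "(real^'n) set" assume K: "compact K"
  then have "compact (\<phi> ` K)"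
    using assms(1) compact_continuous_image continuous_on_subset by blast
  then obtain B where B: "\<And>x. x \<in> K \<Longrightarrow> \<bar>\<phi> x\<bar> \<le> B"
    by (metis compact_imp_bounded bounded_iff image_eqI real_norm_def)
  have \<phi>: "\<phi> \<in> borel_measurable lebesgue"
    using assms(1) by (intro measurable_completion) (simp add: borel_measurable_continuous_onI)
  have g: "integrable lebesgue (\<lambda>x. indicat_real K x *\<^sub>R g x)"
    using K assms(2) by (auto simp: locally_integrable_def set_integrable_def)
  have "integrable lebesgue (\<lambda>x. \<phi> x *\<^sub>R (indicat_real K x *\<^sub>R g x))"
  proof (rule Bochner_Integration.integrable_bound)
    show "integrable lebesgue (\<lambda>x. B *\<^sub>R (indicat_real K x *\<^sub>R g x))"
      using g by (rule integrable_scaleR_right)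
    show "(\<lambda>x. \<phi> x *\<^sub>R indicat_real K x *\<^sub>R g x) \<in> borel_measurable lebesgue"
      by (rule borel_measurable_scaleR[OF \<phi> borel_measurable_integrable[OF g]])
    show "AE x in lebesgue. norm (\<phi> x *\<^sub>R indicat_real K x *\<^sub>R g x) \<le> norm (B *\<^sub>R indicat_real K x *\<^sub>R g x)"
      using B by (auto intro!: AE_I2 mult_right_mono order_trans[OF B abs_ge_self] simp: indicator_def)
  qed
  then show "set_integrable lebesgue K (\<lambda>x. \<phi> x *\<^sub>R g x)"
    by (simp add: set_integrable_def mult.commute)
qed

lemma integrable_scaleR_compact_support:
  fixes \<phi> :: "real^'n \<Rightarrow> real"
  assumes "continuous_on UNIV \<phi>" "locally_integrable g" "compact K" "\<And>x. x \<notin> K \<Longrightarrow> \<phi> x = 0"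
  shows "integrable lebesgue (\<lambda>x. \<phi> x *\<^sub>R g x)"
proof -
  have "set_integrable lebesgue K (\<lambda>x. \<phi> x *\<^sub>R g x)"
    using locally_integrable_scaleR[OF assms(1,2)] assms(3) by (auto simp: locally_integrable_def)
  moreover have "(\<lambda>x. indicat_real K x *\<^sub>R \<phi> x *\<^sub>R g x) = (\<lambda>x. \<phi> x *\<^sub>R g x)"
    using assms(4) by (auto simp: indicator_def fun_eq_iff)
  ultimately show ?thesis by (simp add: set_integrable_def)
qed

lemma locally_integrable_add:
  "locally_integrable f \<Longrightarrow> locally_integrable g \<Longrightarrow> locally_integrable (\<lambda>x. f x + g x)"
  by (simp add: locally_integrable_def set_integral_add)

lemma locally_integrable_diff:
  "locally_integrable f \<Longrightarrow> locally_integrable g \<Longrightarrow> locally_integrable (\<lambda>x. f x - g x)"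
  by (simp add: locally_integrable_def set_integral_diff)

lemma locally_integrable_component:
  fixes g :: "real^'n \<Rightarrow> real^'m"
  assumes "locally_integrable g"
  shows "locally_integrable (\<lambda>x. g x $ i)"
  unfolding locally_integrable_def set_integrable_def
proof (intro allI impI)
  fix K :: "(real^'n) set" assume "compact K"
  then have "integrable lebesgue (\<lambda>x. indicat_real K x *\<^sub>R g x)"
    using assms by (auto simp: locally_integrable_def set_integrable_def)
  from integrable_bounded_linear[OF bounded_linear_vec_nth this]
  show "integrable lebesgue (\<lambda>x. indicat_real K x *\<^sub>R g x $ i)"
    by simp
qed

text \<open>As \<open>exp (- 1 / (k s))\<close> tends to 1 for \<open>s > 0\<close>, products of bumps converge boundedly to the
  indicator function of an open box.\<close>

lemma locally_integrable_eq_0_box: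
  fixes h :: "real^'n \<Rightarrow> real"
  assumes h: "locally_integrable h" and 0: "\<And>f. test_function f \<Longrightarrow> (LINT x|lebesgue. h x * f x) = 0"
  shows "(LINT x:box a b|lebesgue. h x) = 0"
proof -
  define f where "f k x = (\<Prod>i\<in>UNIV. bump 0 (real (Suc k) * (x $ i - a $ i)) * bump 0 (real (Suc k) * (b $ i - x $ i)))"
    for k :: nat and x :: "real^'n"
  have f0: "f k x = 0" if "x \<notin> box a b" for k x
  proof -
    obtain i where "\<not> (a $ i < x $ i \<and> x $ i < b $ i)"
      using \<open>x \<notin> box a b\<close> by (auto simp: mem_box_cart)
    then have "bump 0 (real (Suc k) * (x $ i - a $ i)) * bump 0 (real (Suc k) * (b $ i - x $ i)) = 0"
      by (auto simp: bump_def zero_less_mult_iff)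
    then show ?thesis unfolding f_def by (intro prod_zero) auto
  qed
  have f1: "\<bar>f k x\<bar> \<le> 1" for k x
    unfolding f_def abs_prod
    by (intro prod_le_1) (auto simp: abs_mult bump_def intro!: mult_le_one)
  have Ckf: "Ck j (f k)" for j k
  proof -
    have "Ck j (\<lambda>x::real^'n. bump 0 (real (Suc k) * (x $ i + (- a $ i))))" for i j
      by (intro Ck_bump_comp Ck_mult Ck_add Ck_const Ck_component)
    moreover have "Ck j (\<lambda>x::real^'n. bump 0 (real (Suc k) * (b $ i + (- 1) * x $ i)))" for i j
      by (intro Ck_bump_comp Ck_mult Ck_add Ck_const Ck_component)
    ultimately show ?thesis
      unfolding f_def by (intro Ck_prod Ck_mult) auto
  qed
  have "closure {x. f k x \<noteq> 0} \<subseteq> closure (box a b)" for k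
    using f0 by (intro closure_mono) auto
  moreover have "compact (closure (box a b))"
    using bounded_box bounded_closure closed_closure compact_eq_bounded_closed by blast
  ultimately have test: "test_function (f k)" for k
    unfolding test_function_def using Ckf compact_closed_subset[OF _ closed_closure] by blast
  have lim: "(\<lambda>k. f k x) \<longlonglongrightarrow> indicator (box a b) x" for x
  proof (cases "x \<in> box a b")
    case True
    have "(\<lambda>k. bump 0 (real (Suc k) * s)) \<longlonglongrightarrow> 1" if "0 < s" for s
    proof -
      have "(\<lambda>k. exp (- (1 / s * inverse (real (Suc k))))) \<longlonglongrightarrow> exp (- (1 / s * 0))"
        by (intro tendsto_intros LIMSEQ_inverse_real_of_nat)
      then show ?thesis using that by (simp add: bump_def field_simps del: of_nat_Suc)
    qed
    moreover have "0 < x $ i - a $ i" "0 < b $ i - x $ i" for i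
      using True by (auto simp: mem_box_cart)
    ultimately have "(\<lambda>k. f k x) \<longlonglongrightarrow> (\<Prod>i\<in>(UNIV::'n set). 1 * 1)"
      unfolding f_def by (intro tendsto_prod tendsto_mult) auto
    then show ?thesis using True by simp
  next
    case False
    then show ?thesis by (simp add: f0)
  qed
  \<comment> \<open>Local integrability speaks of compact sets, so the majorant lives on the closed
    box although the limit is the indicator of the open one.\<close>
  have int: "integrable lebesgue (\<lambda>x. \<bar>indicat_real (cbox a b) x *\<^sub>R h x\<bar>)"
    using h by (intro integrable_abs) (auto simp: locally_integrable_def set_integrable_def)
  have meas: "(\<lambda>x. h x * f k x) \<in> borel_measurable lebesgue" for k
    using locally_integrable_measurable[OF h] test_function_continuous[OF test]
    by (intro borel_measurable_times measurable_completion[of "f k"]) (simp_all add: borel_measurable_continuous_onI)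
  have "(\<lambda>k. LINT x|lebesgue. h x * f k x) \<longlonglongrightarrow> (LINT x|lebesgue. h x * indicator (box a b) x)"
  proof (rule integral_dominated_convergence[OF _ meas int])
    show "(\<lambda>x. h x * indicator (box a b) x) \<in> borel_measurable lebesgue"
      using locally_integrable_measurable[OF h] by (intro borel_measurable_times borel_measurable_indicator) auto
    show "AE x in lebesgue. (\<lambda>k. h x * f k x) \<longlonglongrightarrow> h x * indicator (box a b) x"
      by (intro AE_I2 tendsto_intros lim)
    have "norm (h x * f k x) \<le> \<bar>indicat_real (cbox a b) x *\<^sub>R h x\<bar>" for k x
    proof (cases "x \<in> box a b")
      case True
      then have "x \<in> cbox a b" using box_subset_cbox by blast
      then show ?thesis using mult_left_mono[OF f1[of k x], of "\<bar>h x\<bar>"] by (simp add: abs_mult)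
    qed (simp add: f0)
    then show "AE x in lebesgue. norm (h x * f k x) \<le> \<bar>indicat_real (cbox a b) x *\<^sub>R h x\<bar>" for k
      by auto
  qed
  then have "(LINT x|lebesgue. h x * indicator (box a b) x) = 0"
    using LIMSEQ_unique 0[OF test] by auto
  then show ?thesis
    by (simp add: set_lebesgue_integral_def mult.commute)
qed

text \<open>The fundamental lemma of the calculus of variations.\<close>

lemma locally_integrable_AE_eq_0:
  fixes h :: "real^'n \<Rightarrow> real"
  assumes h: "locally_integrable h" and 0: "\<And>f. test_function f \<Longrightarrow> (LINT x|lebesgue. h x * f x) = 0"
  shows "AE x in lebesgue. h x = 0"
proof -
  \<comment> \<open>A Borel representative \<open>g\<close> allows an induction over the Borel sets
    generated by the boxes.\<close>
  obtain g where g [measurable]: "g \<in> borel_measurable lborel" and hg: "AE x in lborel. h x = g x"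
    using completion_ex_borel_measurable_real[OF locally_integrable_measurable[OF h]] by auto
  have hm: "(\<lambda>x. indicat_real (box a b) x *\<^sub>R h x) \<in> borel_measurable lebesgue" for a b
    using locally_integrable_measurable[OF h]
    by (intro borel_measurable_scaleR borel_measurable_indicator) auto
  have gm: "(\<lambda>x. indicat_real (box a b) x *\<^sub>R g x) \<in> borel_measurable lebesgue" for a b
    by (rule measurable_completion) simp
  have gh: "AE x in lebesgue. indicat_real (box a b) x *\<^sub>R g x = indicat_real (box a b) x *\<^sub>R h x" for a b
    using AE_completion[OF hg] by eventually_elim simp
  have g_box: "(LINT x:box a b|lborel. g x) = 0" for a b
  proof -
    have "(LINT x:box a b|lborel. g x) = (LINT x:box a b|lebesgue. g x)"
      unfolding set_lebesgue_integral_def by (rule integral_completion[symmetric]) simp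
    also have "\<dots> = (LINT x:box a b|lebesgue. h x)"
      unfolding set_lebesgue_integral_def
      by (rule integral_cong_AE[OF gm hm gh])
    finally show ?thesis using locally_integrable_eq_0_box[OF assms] by simp
  qed
  have g_int: "set_integrable lborel (box a b) g" for a b
  proof -
    have "set_integrable lebesgue (cbox a b) h"
      using h compact_cbox unfolding locally_integrable_def by blast
    then have "set_integrable lebesgue (box a b) h"
      by (rule set_integrable_subset[OF _ _ box_subset_cbox]) simp
    then have "set_integrable lebesgue (box a b) g"
      unfolding set_integrable_def using integrable_cong_AE[OF gm hm gh] by blast
    then show ?thesis
      unfolding set_integrable_def
      by (rule integrable_completion[THEN iffD1, rotated]) simp
  qed
  have "AE x in lborel. x \<in> box a b \<longrightarrow> g x = 0" for a b
  proof -
    let ?g = "\<lambda>x. indicat_real (box a b) x *\<^sub>R g x"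
    have int: "integrable lborel ?g"
      using g_int by (simp add: set_integrable_def)
    \<comment> \<open>Boxes are closed under intersection and generate the Borel sets, so vanishing
      integrals propagate from boxes to all Borel sets. Localising to one fixed box keeps
      \<open>?g\<close> integrable, which the complement and union cases use.\<close>
    have "(LINT x:A|lborel. ?g x) = 0" if "A \<in> sets lborel" for A
    proof -
      have "Int_stable (range (\<lambda>(a, b). box a b :: (real^'n) set))"
        by (auto simp: Int_stable_def box_Int_box)
      moreover have "range (\<lambda>(a, b). box a b) \<subseteq> Pow (UNIV :: (real^'n) set)"
        by simp
      moreover from that have "A \<in> sigma_sets UNIV (range (\<lambda>(a, b). box a b))"
        by (simp add: borel_eq_box)
      ultimately show ?thesis
      proof (induction A rule: sigma_sets_induct_disjoint)
        case (basic A)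
        then obtain c d where "A = box c d" by auto
        then obtain c d where "A \<inter> box a b = box c d" by (auto simp: box_Int_box)
        moreover from this have "(\<lambda>x. indicat_real A x *\<^sub>R ?g x) = (\<lambda>x. indicat_real (box c d) x *\<^sub>R g x)"
          by (auto simp: indicator_def fun_eq_iff)
        ultimately show ?case
          using g_box[of c d] by (simp add: set_lebesgue_integral_def)
      next
        case empty
        show ?case by (simp add: set_lebesgue_integral_def)
      next
        case (compl A)
        then have "A \<in> sets lborel" by (simp add: borel_eq_box)
        then have "integrable lborel (\<lambda>x. indicat_real A x *\<^sub>R ?g x)"
          using integrable_mult_indicator[OF _ int] by blast
        moreover have "(\<lambda>x. indicat_real (UNIV - A) x *\<^sub>R ?g x) = (\<lambda>x. ?g x - indicat_real A x *\<^sub>R ?g x)"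
          by (auto simp: indicator_def)
        ultimately show ?case
          using compl.IH int g_box[of a b] by (simp add: set_lebesgue_integral_def)
      next
        case (union A)
        then have A: "A i \<in> sets lborel" for i by (auto simp: borel_eq_box)
        moreover have "A i \<inter> A j = {}" if "i \<noteq> j" for i j
          using union.hyps(1) that by (auto simp: disjoint_family_on_def)
        moreover have "set_integrable lborel (\<Union>i. A i) ?g"
          unfolding set_integrable_def using A by (intro integrable_mult_indicator[OF _ int] sets.countable_UN) auto
        ultimately have "(LINT x:(\<Union>i. A i)|lborel. ?g x) = (\<Sum>i. LINT x:A i|lborel. ?g x)"
          by (rule lebesgue_integral_countable_add)
        then show ?case using union.IH by simp
      qed
    qed
    then have "AE x in lborel. ?g x = 0"
      by (intro density_unique_real[OF int integrable_zero]) (simp add: set_lebesgue_integral_def)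
    then show ?thesis by eventually_elim auto
  qed
  then have "AE x in lborel. \<forall>n::nat. x \<in> box (- (\<chi> i. real n)) (\<chi> i. real n) \<longrightarrow> g x = 0"
    unfolding AE_all_countable by blast
  with hg have "AE x in lborel. h x = 0"
  proof eventually_elim
    case (elim x)
    obtain n :: nat where "norm x < n" using reals_Archimedean2 by blast
    then have "\<bar>x $ i\<bar> < n" for i
      using component_le_norm_cart[of x i] by linarith
    then have "x \<in> box (- (\<chi> i. real n)) (\<chi> i. real n)"
      by (auto simp: mem_box_cart abs_less_iff minus_less_iff)
    with elim show ?case by auto
  qed
  then show ?thesis by (rule AE_completion)
qed

lemma locally_integrable_bounded_linear:
  assumes "bounded_linear T" "locally_integrable g"
  shows "locally_integrable (\<lambda>x. T (g x))"
  unfolding locally_integrable_def set_integrable_def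
proof (intro allI impI)
  fix K :: "(real^'c) set" assume "compact K"
  then have "integrable lebesgue (\<lambda>x. indicat_real K x *\<^sub>R g x)"
    using assms by (auto simp: locally_integrable_def set_integrable_def)
  from integrable_bounded_linear[OF assms(1) this]
  show "integrable lebesgue (\<lambda>x. indicat_real K x *\<^sub>R T (g x))"
    using assms(1) by (simp add: linear_simps)
qed

lemma locally_integrable_sum:
  assumes "finite I" "\<And>i. i \<in> I \<Longrightarrow> locally_integrable (f i)"
  shows "locally_integrable (\<lambda>x. \<Sum>i\<in>I. f i x)"
  using assms
proof (induction I rule: finite_induct)
  case empty
  show ?case by (simp add: locally_integrable_def set_integrable_def)
next
  case (insert i I)
  then show ?case by (simp add: locally_integrable_add)
qed

lemma test_function_partial_deriv:
  assumes "test_function f"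
  shows "continuous_on UNIV (partial_deriv i f)" "compact (closure {x. f x \<noteq> 0})"
    "x \<notin> closure {x. f x \<noteq> 0} \<Longrightarrow> partial_deriv i f x = 0"
proof -
  have "Ck (Suc 0) f" using assms unfolding test_function_def by blast
  then show "continuous_on UNIV (partial_deriv i f)" by simp
  show "compact (closure {x. f x \<noteq> 0})" using assms by (simp add: test_function_def)
qed (rule partial_deriv_eq_0)

lemma integrable_test_function:
  fixes h :: "real^'n \<Rightarrow> real"
  assumes "locally_integrable h" "test_function f"
  shows "integrable lebesgue (\<lambda>x. h x * f x)" "integrable lebesgue (\<lambda>x. h x * partial_deriv i f x)"
proof -
  have 0: "f x = 0" if "x \<notin> closure {x. f x \<noteq> 0}" for x
    using that closure_subset[of "{x. f x \<noteq> 0}"] by blast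
  have "integrable lebesgue (\<lambda>x. f x *\<^sub>R h x)"
    by (rule integrable_scaleR_compact_support[OF test_function_continuous[OF assms(2)] assms(1)
        test_function_partial_deriv(2)[OF assms(2)] 0])
  then show "integrable lebesgue (\<lambda>x. h x * f x)"
    by (simp add: mult.commute)
  have "integrable lebesgue (\<lambda>x. partial_deriv i f x *\<^sub>R h x)"
    by (rule integrable_scaleR_compact_support[OF test_function_partial_deriv(1)[OF assms(2)] assms(1)
        test_function_partial_deriv(2)[OF assms(2)] test_function_partial_deriv(3)[OF assms(2)]])
  then show "integrable lebesgue (\<lambda>x. h x * partial_deriv i f x)"
    by (simp add: mult.commute)
qed

text \<open>Both gradients have the same integrals against test functions, as these are determined
  by \<open>u\<close>; the fundamental lemma then applies to each component of the
  difference.\<close>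

lemma weak_gradient_unique:
  fixes g1 g2 :: "real^'n \<Rightarrow> real^'n"
  assumes g: "has_weak_gradient u g1" "has_weak_gradient u g2"
  shows "AE x in lebesgue. g1 x = g2 x"
proof -
  have "AE x in lebesgue. g1 x $ i - g2 x $ i = 0" for i
  proof (rule locally_integrable_AE_eq_0)
    have l: "locally_integrable (\<lambda>x. g1 x $ i)" "locally_integrable (\<lambda>x. g2 x $ i)"
      using g by (auto simp: has_weak_gradient_def intro: locally_integrable_component)
    then show "locally_integrable (\<lambda>x. g1 x $ i - g2 x $ i)"
      by (rule locally_integrable_diff)
    fix f :: "real^'n \<Rightarrow> real" assume f: "test_function f"
    have "(LINT x|lebesgue. (g1 x $ i - g2 x $ i) * f x) =
        (LINT x|lebesgue. g1 x $ i * f x) - (LINT x|lebesgue. g2 x $ i * f x)"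
      using integrable_test_function(1)[OF _ f] l by (simp add: left_diff_distrib)
    also have "(LINT x|lebesgue. g1 x $ i * f x) = - (LINT x|lebesgue. u x * partial_deriv i f x)"
      using g(1) f by (simp add: has_weak_gradient_def)
    also have "(LINT x|lebesgue. g2 x $ i * f x) = - (LINT x|lebesgue. u x * partial_deriv i f x)"
      using g(2) f by (simp add: has_weak_gradient_def)
    finally show "(LINT x|lebesgue. (g1 x $ i - g2 x $ i) * f x) = 0" by simp
  qed
  then have "AE x in lebesgue. \<forall>i\<in>UNIV. g1 x $ i - g2 x $ i = 0"
    by (subst AE_finite_all) auto
  then show ?thesis
    by eventually_elim (simp add: vec_eq_iff)
qed

lemma has_weak_gradient_weak_grad:
  "has_weak_gradient u g \<Longrightarrow> has_weak_gradient u (weak_grad u)"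
  unfolding weak_grad_def by (rule someI[where P = "has_weak_gradient u"])

lemma weak_grad_eq:
  assumes "has_weak_gradient u g"
  shows "AE x in lebesgue. weak_grad u x = g x"
  by (rule weak_gradient_unique[OF has_weak_gradient_weak_grad[OF assms] assms])

lemma has_weak_gradient_cmult:
  assumes g: "has_weak_gradient u g"
  shows "has_weak_gradient (\<lambda>x. c * u x) (\<lambda>x. c *\<^sub>R g x)"
proof -
  have "locally_integrable (\<lambda>x. c * u x)" "locally_integrable (\<lambda>x. c *\<^sub>R g x)"
    using g locally_integrable_bounded_linear[OF bounded_linear_mult_right]
      locally_integrable_bounded_linear[OF bounded_linear_scaleR_right]
    unfolding has_weak_gradient_def by blast+
  then show ?thesis
    using g by (auto simp: has_weak_gradient_def mult.assoc)
qed

text \<open>The weak gradient of \<open>u\<close> is tested with \<open>\<eta>\<close> times a test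
  function, whose partial derivative splits by the product rule. The factor \<open>\<eta>\<close>
  may have unbounded support, as the cutoff does, since the test function localises.\<close>

lemma has_weak_gradient_mult:
  fixes \<eta> :: "real^'n \<Rightarrow> real"
  assumes \<eta>: "\<And>k. Ck k \<eta>" and g: "has_weak_gradient u g"
  shows "has_weak_gradient (\<lambda>x. \<eta> x * u x) (\<lambda>x. \<eta> x *\<^sub>R g x + u x *\<^sub>R (\<chi> i. partial_deriv i \<eta> x))"
  unfolding has_weak_gradient_def
proof (intro conjI allI impI)
  have \<eta>c: "continuous_on UNIV \<eta>" "continuous_on UNIV (partial_deriv i \<eta>)" for i
    using \<eta>[of 0] \<eta>[of "Suc 0"] by auto
  have ul: "locally_integrable u" and gl: "locally_integrable g"
    using g by (auto simp: has_weak_gradient_def)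
  show \<eta>u: "locally_integrable (\<lambda>x. \<eta> x * u x)"
    using locally_integrable_scaleR[OF \<eta>c(1) ul] by simp
  have p: "locally_integrable (\<lambda>x. partial_deriv i \<eta> x * u x)" for i
    using locally_integrable_scaleR[OF \<eta>c(2) ul] by simp
  \<comment> \<open>Vector-valued local integrability is assembled from the components by summing
    along the axes.\<close>
  have "locally_integrable (\<lambda>x. \<Sum>i\<in>UNIV. (partial_deriv i \<eta> x * u x) *\<^sub>R (axis i 1 :: real^'n))"
    by (rule locally_integrable_sum[OF finite locally_integrable_bounded_linear[OF bounded_linear_scaleR_left p]])
  moreover have "(\<lambda>x. \<Sum>i\<in>UNIV. (partial_deriv i \<eta> x * u x) *\<^sub>R (axis i 1 :: real^'n)) =
      (\<lambda>x. u x *\<^sub>R (\<chi> i. partial_deriv i \<eta> x))"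
    by (auto simp: fun_eq_iff vec_eq_iff axis_def if_distrib sum.If_cases cong: if_cong)
  ultimately have "locally_integrable (\<lambda>x. u x *\<^sub>R (\<chi> i. partial_deriv i \<eta> x))"
    by simp
  then show "locally_integrable (\<lambda>x. \<eta> x *\<^sub>R g x + u x *\<^sub>R (\<chi> i. partial_deriv i \<eta> x))"
    using locally_integrable_scaleR[OF \<eta>c(1) gl] by (intro locally_integrable_add)
  fix f :: "real^'n \<Rightarrow> real" and i assume f: "test_function f"
  have d: "partial_deriv i (\<lambda>x. \<eta> x * f x) x = \<eta> x * partial_deriv i f x + partial_deriv i \<eta> x * f x" for x
  proof (rule partial_deriv_mult)
    show "\<eta> differentiable at x" using \<eta> Ck_differentiable by blast
    show "f differentiable at x" using f Ck_differentiable unfolding test_function_def by blast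
  qed
  have gi: "locally_integrable (\<lambda>x. \<eta> x * g x $ i)"
    using locally_integrable_scaleR[OF \<eta>c(1) locally_integrable_component[OF gl]] by simp
  note int = integrable_test_function(2)[OF \<eta>u f, of i] integrable_test_function(1)[OF p f, of i]
    integrable_test_function(1)[OF gi f]
  have "(LINT x|lebesgue. \<eta> x * u x * partial_deriv i f x) + (LINT x|lebesgue. partial_deriv i \<eta> x * u x * f x)
      = (LINT x|lebesgue. \<eta> x * u x * partial_deriv i f x + partial_deriv i \<eta> x * u x * f x)"
    using int by simp
  also have "\<dots> = (LINT x|lebesgue. u x * partial_deriv i (\<lambda>x. \<eta> x * f x) x)"
    by (intro Bochner_Integration.integral_cong) (simp_all add: d algebra_simps)
  also have "\<dots> = - (LINT x|lebesgue. g x $ i * (\<eta> x * f x))"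
    using g test_function_mult[OF \<eta> f] by (simp add: has_weak_gradient_def)
  finally have "(LINT x|lebesgue. \<eta> x * u x * partial_deriv i f x) =
      - ((LINT x|lebesgue. \<eta> x * g x $ i * f x) + (LINT x|lebesgue. partial_deriv i \<eta> x * u x * f x))"
    by (simp add: algebra_simps)
  also have "\<dots> = - (LINT x|lebesgue. \<eta> x * g x $ i * f x + partial_deriv i \<eta> x * u x * f x)"
    using int by simp
  finally show "(LINT x|lebesgue. \<eta> x * u x * partial_deriv i f x) =
      - (LINT x|lebesgue. (\<eta> x *\<^sub>R g x + u x *\<^sub>R (\<chi> i. partial_deriv i \<eta> x)) $ i * f x)"
    by (simp add: algebra_simps)
qed

section \<open>Cutoff functions\<close>

text \<open>A smooth function that vanishes on the ball of radius \<open>R\<close>, tends to 1 at infinity and has a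
  gradient of size \<open>O(1/R)\<close>. It never reaches 1, which is harmless: only its values far out matter.\<close>

definition cutoff :: "real \<Rightarrow> real^'n \<Rightarrow> real" where
  "cutoff R x = bump 0 ((norm x)\<^sup>2 / R\<^sup>2 - 1)"

lemma Ck_cutoff: "Ck k (cutoff R :: real^'n \<Rightarrow> real)"
proof -
  have "cutoff R = (\<lambda>x::real^'n. bump 0 ((1 / R\<^sup>2) * (\<Sum>i\<in>UNIV. x $ i * x $ i) + (- 1)))"
    by (simp add: cutoff_def[abs_def] power2_norm_eq_inner inner_vec_def)
  moreover have "Ck k (\<lambda>x::real^'n. bump 0 ((1 / R\<^sup>2) * (\<Sum>i\<in>UNIV. x $ i * x $ i) + (- 1)))"
    by (intro Ck_bump_comp Ck_add Ck_mult Ck_const Ck_sum Ck_component finite)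
  ultimately show ?thesis by simp
qed

lemma cutoff_nonneg: "0 \<le> cutoff R x"
  by (simp add: cutoff_def bump_nonneg)

lemma cutoff_le_1: "cutoff R x \<le> 1"
  by (simp add: cutoff_def bump_def)

lemma cutoff_eq_0: "0 < R \<Longrightarrow> norm x \<le> R \<Longrightarrow> cutoff R x = 0"
  by (simp add: cutoff_def bump_def not_less power_mono)

text \<open>At such points the argument of \<open>bump 0\<close> is at least
  \<open>k\<^sup>2 - 1\<close>. The lower bound does not depend on \<open>R\<close> and tends to 1
  as \<open>k\<close> grows.\<close>

lemma cutoff_ge:
  assumes "0 < R" "1 < k" "k * R \<le> norm x"
  shows "exp (- (1 / (k\<^sup>2 - 1))) \<le> cutoff R x"
proof -
  have "k\<^sup>2 * R\<^sup>2 \<le> (norm x)\<^sup>2"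
    using power_mono[OF assms(3), of 2] assms by (simp add: power_mult_distrib)
  then have "k\<^sup>2 - 1 \<le> (norm x)\<^sup>2 / R\<^sup>2 - 1"
    using assms by (simp add: field_simps)
  moreover have "0 < k\<^sup>2 - 1" using assms by simp
  ultimately show ?thesis
    by (auto simp: cutoff_def bump_def frac_le)
qed

lemma partial_deriv_cutoff:
  fixes x :: "real^'n"
  shows "partial_deriv i (cutoff R) x = bump 2 ((norm x)\<^sup>2 / R\<^sup>2 - 1) * (2 * x $ i / R\<^sup>2)"
proof -
  have d: "((\<lambda>x::real^'n. (norm x)\<^sup>2 / R\<^sup>2 - 1) has_derivative (\<lambda>h. 2 * (x \<bullet> h) / R\<^sup>2)) (at x)"
    unfolding power2_norm_eq_inner divide_inverse
    by (rule derivative_eq_intros refl)+ (simp add: inner_commute)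
  show ?thesis
    using partial_deriv_eq[OF has_derivative_bump_comp[OF d, of 0]]
    by (simp add: cutoff_def[abs_def] inner_axis numeral_2_eq_2)
qed

text \<open>With \<open>s\<close> the argument of the bump, the norm is \<open>2 / R\<close> times
  \<open>bump 2 s * (norm x / R)\<close>. For \<open>0 < s\<close>, \<open>norm x / R\<close> is the
  square root of \<open>1 + s\<close>, hence at most \<open>1 + s\<close>, and the quadratic Taylor
  bound for \<open>exp (1 / s)\<close> makes the product at most 2.\<close>

lemma norm_gradient_cutoff:
  assumes "0 < R"
  shows "norm (\<chi> i. partial_deriv i (cutoff R) x) \<le> 4 / R"
proof -
  define s where "s = (norm x)\<^sup>2 / R\<^sup>2 - 1"
  have "(\<chi> i. partial_deriv i (cutoff R) x) = (bump 2 s * 2 / R\<^sup>2) *\<^sub>R x"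
    by (simp add: partial_deriv_cutoff s_def vec_eq_iff)
  then have eq: "norm (\<chi> i. partial_deriv i (cutoff R) x) = bump 2 s * 2 / R * (norm x / R)"
    by (simp add: bump_nonneg power2_eq_square)
  show ?thesis
  proof (cases "0 < s")
    case True
    have "norm x / R \<le> 1 + s"
    proof (rule power2_le_imp_le)
      have "(norm x / R)\<^sup>2 = 1 + s" by (simp add: s_def power_divide)
      also have "\<dots> \<le> (1 + s)\<^sup>2" using True by (simp add: power2_eq_square algebra_simps)
      finally show "(norm x / R)\<^sup>2 \<le> (1 + s)\<^sup>2" .
    qed (use True in simp)
    then have "bump 2 s * (norm x / R) \<le> bump 2 s * (1 + s)"
      by (intro mult_left_mono bump_nonneg)
    also have "\<dots> = ((1 / s)\<^sup>2 + 1 / s) * exp (- (1 / s))"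
      using True by (simp add: bump_def field_simps power2_eq_square)
    also have "\<dots> \<le> 2 * exp (1 / s) * exp (- (1 / s))"
    proof (rule mult_right_mono)
      have "0 < 1 / s" using True by simp
      then show "(1 / s)\<^sup>2 + 1 / s \<le> 2 * exp (1 / s)"
        using exp_lower_Taylor_quadratic[of "1 / s"] by linarith
    qed simp
    also have "\<dots> = 2" by (simp add: exp_minus)
    finally have "bump 2 s * (norm x / R) * (2 / R) \<le> 2 * (2 / R)"
      using assms by (intro mult_right_mono) auto
    then show ?thesis unfolding eq by (simp add: field_simps)
  next
    case False
    then show ?thesis using assms unfolding eq by (simp add: bump_def)
  qed
qed

lemma gradient_cutoff_eq_0:
  assumes "0 < R" "norm x \<le> R"
  shows "(\<chi> i. partial_deriv i (cutoff R) x) = 0"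
proof -
  have "(norm x)\<^sup>2 / R\<^sup>2 - 1 \<le> 0"
    using assms by (simp add: power_mono)
  then show ?thesis
    by (simp add: partial_deriv_cutoff bump_def vec_eq_iff)
qed

section \<open>Functions of power growth\<close>

text \<open>The exponent condition of admissibility at a frozen point: it bounds the derivative of
  \<open>ln (f t)\<close> with respect to \<open>ln t\<close>. The value \<open>f 0\<close> is
  merely nonnegative, because the condition is available at every point while
  \<open>\<Phi> x 0 = 0\<close> holds only almost everywhere.\<close>

definition power_growth :: "real \<Rightarrow> real \<Rightarrow> (real \<Rightarrow> real) \<Rightarrow> bool" where
  "power_growth p q f \<longleftrightarrow> 0 < p \<and> (\<forall>t\<ge>0. 0 \<le> f t) \<and>
     (\<forall>t>0. f differentiable at t \<and> p \<le> deriv f t * t / f t \<and> deriv f t * t / f t \<le> q)"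

lemma power_growth_pos:
  assumes "power_growth p q f" "0 < t"
  shows "0 < f t"
proof -
  \<comment> \<open>Division by zero yields 0, so a zero of \<open>f\<close> would contradict
    \<open>0 < p\<close>.\<close>
  have "f t \<noteq> 0" using assms by (auto simp: power_growth_def)
  moreover have "0 \<le> f t" using assms by (simp add: power_growth_def)
  ultimately show ?thesis by simp
qed

lemma power_growth_le:
  assumes "power_growth p q f"
  shows "p \<le> q"
proof -
  have "p \<le> deriv f 1 * 1 / f 1" "deriv f 1 * 1 / f 1 \<le> q"
    using assms unfolding power_growth_def by (meson zero_less_one)+
  then show ?thesis by (rule order_trans)
qed

lemma power_growth_DERIV:
  assumes "power_growth p q f" "0 < t"
  shows "((\<lambda>t. f t * t powr r) has_real_derivative (deriv f t * t / f t + r) * (f t * t powr (r - 1))) (at t)"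
proof -
  have "(f has_real_derivative deriv f t) (at t)"
    using assms unfolding power_growth_def by (simp add: DERIV_deriv_iff_real_differentiable)
  then have "((\<lambda>t. f t * t powr r) has_real_derivative deriv f t * t powr r + r * t powr (r - 1) * f t) (at t)"
    by (rule DERIV_mult[OF _ has_real_derivative_powr[OF assms(2)]])
  moreover have "t powr r = t * t powr (r - 1)"
    using assms(2) by (simp add: powr_mult_base)
  ultimately show ?thesis
    using power_growth_pos[OF assms] by (simp add: algebra_simps)
qed

text \<open>\<open>f t * t powr (- p)\<close> is nondecreasing and \<open>f t * t powr (- q)\<close>
  nonincreasing, because \<open>power_growth_DERIV\<close> fixes the signs of their
  derivatives.\<close>

lemma power_growth_ratio:
  assumes f: "power_growth p q f" and st: "0 < s" "s \<le> t"
  shows "(t / s) powr p * f s \<le> f t" "f t \<le> (t / s) powr q * f s"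
proof -
  have "f s * s powr (- p) \<le> f t * t powr (- p)"
  proof (rule DERIV_nonneg_imp_nondecreasing[OF st(2)])
    fix x assume "s \<le> x"
    then have x: "0 < x" using st by simp
    have "0 \<le> (deriv f x * x / f x + - p) * (f x * x powr (- p - 1))"
      using f x power_growth_pos[OF f x] by (intro mult_nonneg_nonneg) (auto simp: power_growth_def)
    then show "\<exists>y. ((\<lambda>t. f t * t powr (- p)) has_real_derivative y) (at x) \<and> 0 \<le> y"
      using power_growth_DERIV[OF f x] by blast
  qed
  then show "(t / s) powr p * f s \<le> f t"
    using st by (simp add: powr_divide powr_minus field_simps)
  have "f s * s powr (- q) \<ge> f t * t powr (- q)"
  proof (rule DERIV_nonpos_imp_nonincreasing[OF st(2)])
    fix x assume "s \<le> x"
    then have x: "0 < x" using st by simp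
    have "(deriv f x * x / f x + - q) * (f x * x powr (- q - 1)) \<le> 0"
      using f x power_growth_pos[OF f x] by (intro mult_nonpos_nonneg) (auto simp: power_growth_def)
    then show "\<exists>y. ((\<lambda>t. f t * t powr (- q)) has_real_derivative y) (at x) \<and> y \<le> 0"
      using power_growth_DERIV[OF f x] by blast
  qed
  then show "f t \<le> (t / s) powr q * f s"
    using st by (simp add: powr_divide powr_minus field_simps)
qed

lemma power_growth_bounds:
  assumes f: "power_growth p q f" and "0 < t"
  shows "1 \<le> c \<Longrightarrow> c powr p * f t \<le> f (c * t)" "1 \<le> c \<Longrightarrow> f (c * t) \<le> c powr q * f t"
    "0 < c \<Longrightarrow> c \<le> 1 \<Longrightarrow> c powr q * f t \<le> f (c * t)"
    "0 < c \<Longrightarrow> c \<le> 1 \<Longrightarrow> f (c * t) \<le> c powr p * f t"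
proof -
  show "c powr p * f t \<le> f (c * t)" "f (c * t) \<le> c powr q * f t" if "1 \<le> c"
    using power_growth_ratio[OF f \<open>0 < t\<close>, of "c * t"] that \<open>0 < t\<close> by simp_all
  show "c powr q * f t \<le> f (c * t)" "f (c * t) \<le> c powr p * f t" if "0 < c" "c \<le> 1"
    using power_growth_ratio[OF f, of "c * t" t] that \<open>0 < t\<close>
    by (simp_all add: powr_divide field_simps)
qed

lemma power_growth_strict_mono:
  assumes f: "power_growth p q f" and "0 < s" "s < t"
  shows "f s < f t"
proof -
  have "1 < (t / s) powr p"
    using assms by (intro gr_one_powr) (auto simp: power_growth_def)
  then have "f s < (t / s) powr p * f s"
    using power_growth_pos[OF f \<open>0 < s\<close>] by simp
  also have "\<dots> \<le> f t"
    using power_growth_ratio(1)[OF f] assms by simp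
  finally show ?thesis .
qed

lemma power_growth_continuous:
  assumes "power_growth p q f"
  shows "continuous_on {0<..} f"
proof (rule continuous_at_imp_continuous_on, rule ballI)
  fix t :: real assume "t \<in> {0<..}"
  then have "f differentiable (at t)"
    using assms by (simp add: power_growth_def)
  then show "isCont f t" by (rule differentiable_imp_continuous_within)
qed

lemma power_growth_attains:
  assumes f: "power_growth p q f" and p: "1 \<le> p" and "0 < c"
  shows "\<exists>t>0. f t = c"
proof -
  \<comment> \<open>As \<open>1 \<le> p\<close>, the graph lies below the line
    \<open>t * f 1\<close> for \<open>0 < t \<le> 1\<close> and above it for
    \<open>1 \<le> t\<close>; the points \<open>s\<close> and \<open>T\<close> therefore enclose the
    value \<open>c\<close>.\<close>
  define s where "s = min 1 (c / f 1)"
  define T where "T = max 1 (c / f 1)"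
  have f1: "0 < f 1" using power_growth_pos[OF f] by simp
  then have s: "0 < s" "s \<le> 1" "s * f 1 \<le> c" and T: "1 \<le> T" "c \<le> T * f 1"
    using \<open>0 < c\<close> by (auto simp: s_def T_def min_def max_def field_simps)
  have "f s \<le> s powr p * f 1"
    using power_growth_bounds(4)[OF f zero_less_one s(1,2)] by simp
  also have "\<dots> \<le> s * f 1"
    using powr_mono'[of 1 p s] p s f1 by (intro mult_right_mono) auto
  finally have "f s \<le> c" using s by simp
  moreover have "T * f 1 \<le> T powr p * f 1"
    using powr_mono[of 1 p T] p T f1 by (intro mult_right_mono) auto
  then have "c \<le> f T"
    using power_growth_bounds(1)[OF f zero_less_one T(1)] T by simp
  moreover have "continuous_on {s..T} f"
    using s by (intro continuous_on_subset[OF power_growth_continuous[OF f]]) auto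
  ultimately obtain t where "s \<le> t" "f t = c"
    using IVT'[of f s c T] s T by auto
  then show ?thesis using s by (intro exI[of _ t]) simp
qed

section \<open>Caratheodory functions and inverses\<close>

text \<open>Writing \<open>s = (s / b) * b\<close> for a fixed base point \<open>b\<close>, the two
  bounds squeeze \<open>F s\<close> between functions that are continuous at \<open>t\<close> and
  agree there.\<close>

lemma power_bounds_imp_continuous:
  fixes F :: "real \<Rightarrow> real"
  assumes "0 < p" "0 < q" and F: "\<And>c t. 0 \<le> c \<Longrightarrow> 0 \<le> t \<Longrightarrow>
    min (c powr p) (c powr q) * F t \<le> F (c * t) \<and> F (c * t) \<le> max (c powr p) (c powr q) * F t"
  shows "continuous_on {0..} F"
  unfolding continuous_on_def
proof
  fix t :: real assume t: "t \<in> {0..}"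
  \<comment> \<open>At \<open>t = 0\<close> the base point 1 avoids a division by 0; there the
    bounds with \<open>c = 0\<close> give \<open>F 0 = 0\<close>.\<close>
  define b where "b = (if t = 0 then 1 else t)"
  have b: "0 < b" "(t / b) * b = t" using t by (auto simp: b_def)
  have lim: "((\<lambda>s. s / b) \<longlongrightarrow> t / b) (at t within {0..})"
    using b by (intro tendsto_intros) auto
  have p: "((\<lambda>s. (s / b) powr r) \<longlongrightarrow> (t / b) powr r) (at t within {0..})" if "0 < r" for r
    using lim that b t
    by (intro tendsto_powr' tendsto_const)
      (auto simp: eventually_at_filter intro!: always_eventually)
  have ev: "\<forall>\<^sub>F s in at t within {0..}. 0 \<le> s"
    by (auto simp: eventually_at_filter)
  have F_eq: "(t / b) powr r * F b = F t" if "0 < r" for r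
  proof (cases "t = 0")
    case True
    have "F 0 = 0" using F[of 0 b] b assms by simp
    then show ?thesis using True by simp
  next
    case False
    then show ?thesis by (simp add: b_def)
  qed
  show "(F \<longlongrightarrow> F t) (at t within {0..})"
  proof (rule tendsto_sandwich)
    show "\<forall>\<^sub>F s in at t within {0..}. min ((s / b) powr p) ((s / b) powr q) * F b \<le> F s"
      using ev
    proof eventually_elim
      case (elim s)
      then show ?case using F[of "s / b" b] b by simp
    qed
    show "\<forall>\<^sub>F s in at t within {0..}. F s \<le> max ((s / b) powr p) ((s / b) powr q) * F b"
      using ev
    proof eventually_elim
      case (elim s)
      then show ?case using F[of "s / b" b] b by simp
    qed
    have "((\<lambda>s. min ((s / b) powr p) ((s / b) powr q) * F b) \<longlongrightarrow> min ((t / b) powr p) ((t / b) powr q) * F b) (at t within {0..})"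
      by (rule tendsto_mult[OF tendsto_min[OF p[OF assms(1)] p[OF assms(2)]] tendsto_const])
    then show "((\<lambda>s. min ((s / b) powr p) ((s / b) powr q) * F b) \<longlongrightarrow> F t) (at t within {0..})"
      using F_eq assms by (simp add: min_def split: if_splits)
    have "((\<lambda>s. max ((s / b) powr p) ((s / b) powr q) * F b) \<longlongrightarrow> max ((t / b) powr p) ((t / b) powr q) * F b) (at t within {0..})"
      by (rule tendsto_mult[OF tendsto_max[OF p[OF assms(1)] p[OF assms(2)]] tendsto_const])
    then show "((\<lambda>s. max ((s / b) powr p) ((s / b) powr q) * F b) \<longlongrightarrow> F t) (at t within {0..})"
      using F_eq assms by (simp add: max_def split: if_splits)
  qed
qed

text \<open>The argument \<open>f x\<close> is rounded down to multiples of
  \<open>1 / (k + 1)\<close>. Each approximation takes countably many values, so only measurability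
  of \<open>F\<close> at fixed arguments enters, and continuity on the half-line carries the
  limit.\<close>

lemma caratheodory_measurable:
  fixes F :: "'a \<Rightarrow> real \<Rightarrow> real"
  assumes F: "\<And>t. 0 \<le> t \<Longrightarrow> (\<lambda>x. F x t) \<in> borel_measurable M"
    and cont: "\<And>x. x \<in> space M \<Longrightarrow> continuous_on {0..} (F x)"
    and f [measurable]: "f \<in> borel_measurable M" and f0: "\<And>x. x \<in> space M \<Longrightarrow> 0 \<le> f x"
  shows "(\<lambda>x. F x (f x)) \<in> borel_measurable M"
proof (rule borel_measurable_LIMSEQ_real)
  define r where "r k x = real (nat \<lfloor>real (Suc k) * f x\<rfloor>) / real (Suc k)" for k x
  show "(\<lambda>x. F x (r k x)) \<in> borel_measurable M" for k
    unfolding r_def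
    by (rule measurable_compose_countable[of "\<lambda>i x. F x (real i / real (Suc k))"]) (use F in auto)
  fix x assume x: "x \<in> space M"
  have "(\<lambda>k. r k x) \<longlonglongrightarrow> f x"
  proof (rule LIMSEQ_norm_0[THEN LIM_zero_cancel])
    fix k
    define N where "N = real (Suc k)"
    have "r k x = of_int \<lfloor>N * f x\<rfloor> / N"
      using f0[OF x] by (simp add: r_def N_def)
    moreover have "N * f x - 1 < of_int \<lfloor>N * f x\<rfloor>" "of_int \<lfloor>N * f x\<rfloor> \<le> N * f x"
      by linarith+
    moreover have "0 < N" by (simp add: N_def)
    ultimately have "N * r k x \<le> N * f x" "N * f x < N * (r k x + 1 / N)" and N: "0 < N"
      by (simp_all add: distrib_left)
    then have "r k x \<le> f x" "f x < r k x + 1 / N"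
      by (simp_all only: mult_le_cancel_left_pos mult_less_cancel_left_pos)
    then have "\<bar>r k x - f x\<bar> < 1 / N"
      by linarith
    then show "norm (r k x - f x) < 1 / real (Suc k)"
      by (simp add: N_def)
  qed
  moreover have "\<forall>k. r k x \<in> {0..}" by (simp add: r_def)
  ultimately show "(\<lambda>k. F x (r k x)) \<longlonglongrightarrow> F x (f x)"
    using f0[OF x] by (intro continuous_on_tendsto_compose[OF cont[OF x]]) auto
qed

lemma lebesgue_measurable_cong_AE:
  assumes "AE x in lebesgue. f x = g x" "f \<in> borel_measurable lebesgue"
  shows "g \<in> borel_measurable lebesgue"
proof (rule measurableI)
  fix A :: "'b set" assume A: "A \<in> sets borel"
  show "g -` A \<inter> space lebesgue \<in> sets lebesgue"
  proof (rule completion.in_sets_AE)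
    show "f -` A \<inter> space lebesgue \<in> sets lebesgue"
      using assms(2) A by (rule measurable_sets)
    show "AE x in lebesgue. x \<in> f -` A \<inter> space lebesgue \<longleftrightarrow> x \<in> g -` A \<inter> space lebesgue"
      using assms(1) by eventually_elim simp
  qed simp
qed simp

lemma AE_lebesgue_sets:
  assumes "AE x in lebesgue. P x"
  shows "{x. P x} \<in> sets lebesgue"
proof (rule completion.in_sets_AE)
  show "AE x in lebesgue. x \<in> UNIV \<longleftrightarrow> x \<in> {x. P x}"
    using assms by eventually_elim simp
qed simp_all

text \<open>Setting \<open>F\<close> to 0 on the null set where continuity fails reduces this to
  continuity at every point; completeness of the measure makes that set measurable.\<close>

lemma caratheodory_lebesgue:
  fixes F :: "'a::euclidean_space \<Rightarrow> real \<Rightarrow> real"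
  assumes F: "\<And>t. 0 \<le> t \<Longrightarrow> (\<lambda>x. F x t) \<in> borel_measurable lebesgue"
    and cont: "AE x in lebesgue. continuous_on {0..} (F x)"
    and f: "f \<in> borel_measurable lebesgue" "\<And>x. 0 \<le> f x"
  shows "(\<lambda>x. F x (f x)) \<in> borel_measurable lebesgue"
proof (rule lebesgue_measurable_cong_AE)
  let ?G = "{x. continuous_on {0..} (F x)}"
  have G: "?G \<in> sets lebesgue" using AE_lebesgue_sets[OF cont] .
  define F' where "F' x t = (if x \<in> ?G then F x t else 0)" for x t
  have "(\<lambda>x. F' x t) \<in> borel_measurable lebesgue" if "0 \<le> t" for t
    unfolding F'_def using F[OF that] G by (intro measurable_If_set) auto
  moreover have "continuous_on {0..} (F' x)" for x
    by (cases "x \<in> ?G") (simp_all add: F'_def cong: continuous_on_cong)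
  ultimately show "(\<lambda>x. F' x (f x)) \<in> borel_measurable lebesgue"
    using caratheodory_measurable[of F' lebesgue f] f by simp
  show "AE x in lebesgue. F' x (f x) = F x (f x)"
    using cont by eventually_elim (simp add: F'_def)
qed

text \<open>Where \<open>t\<close> is not attained, \<open>inv_into\<close> returns a junk value, which does not depend on \<open>x\<close>.\<close>

lemma inv2_cases:
  assumes mono: "strict_mono_on {0..} (H x)" and cont: "continuous_on {0..} (H x)"
    and 0: "H x 0 = 0" and t: "0 \<le> t"
  shows "inv2 H x t \<le> c \<longleftrightarrow>
    (if \<exists>n::nat. t \<le> H x (real n) then 0 \<le> c \<and> t \<le> H x c else (SOME s::real. False) \<le> c)"
    and "0 \<le> inv2 H x t \<or> inv2 H x t = (SOME s::real. False)"
proof -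
  have *: "(inv2 H x t \<le> c \<longleftrightarrow>
    (if \<exists>n::nat. t \<le> H x (real n) then 0 \<le> c \<and> t \<le> H x c else (SOME s::real. False) \<le> c)) \<and>
    (0 \<le> inv2 H x t \<or> inv2 H x t = (SOME s::real. False))"
  \<comment> \<open>By continuity, monotonicity and \<open>H x 0 = 0\<close>, the value
    \<open>t\<close> is attained exactly when \<open>H x\<close> reaches it at some natural number.
    This countable condition keeps the sublevel sets of the inverse measurable.\<close>
  proof (cases "\<exists>n::nat. t \<le> H x (real n)")
    case True
    then obtain n :: nat where n: "t \<le> H x (real n)" by blast
    have "\<exists>s\<ge>0. s \<le> real n \<and> H x s = t"
      using n 0 t by (intro IVT' continuous_on_subset[OF cont]) auto
    then obtain s where s: "0 \<le> s" "H x s = t" by blast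
    then have "inv2 H x t = s"
      unfolding inv2_def using strict_mono_on_imp_inj_on[OF mono] by (metis atLeast_iff inv_into_f_f)
    moreover have "s \<le> c \<longleftrightarrow> 0 \<le> c \<and> t \<le> H x c"
      using s strict_mono_on_leD[OF mono, of s c] strict_mono_onD[OF mono, of c s] by force
    ultimately show ?thesis using True s by simp
  next
    case False
    have "\<not> (s \<in> {0..} \<and> H x s = t)" for s
    proof
      assume s: "s \<in> {0..} \<and> H x s = t"
      obtain n :: nat where "s \<le> real n" using real_arch_simple by blast
      then have "t \<le> H x (real n)"
        using s strict_mono_on_leD[OF mono, of s "real n"] by auto
      with False show False by blast
    qed
    then have "inv2 H x t = (SOME s. False)"
      unfolding inv2_def inv_into_def by (simp only:)
    then show ?thesis using False by simp
  qed
  then show "inv2 H x t \<le> c \<longleftrightarrow>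
    (if \<exists>n::nat. t \<le> H x (real n) then 0 \<le> c \<and> t \<le> H x c else (SOME s::real. False) \<le> c)"
    and "0 \<le> inv2 H x t \<or> inv2 H x t = (SOME s::real. False)"
    by blast+
qed

lemma inv2_measurable:
  fixes H :: "'a::euclidean_space \<Rightarrow> real \<Rightarrow> real"
  assumes H: "\<And>s. 0 \<le> s \<Longrightarrow> (\<lambda>x. H x s) \<in> borel_measurable lebesgue"
    and ae: "AE x in lebesgue. strict_mono_on {0..} (H x) \<and> continuous_on {0..} (H x) \<and> H x 0 = 0"
    and t: "0 \<le> t"
  shows "(\<lambda>x. inv2 H x t) \<in> borel_measurable lebesgue"
  unfolding borel_measurable_iff_le
proof
  fix c
  define c0 where "c0 = (SOME s::real. False)"
  define P where "P x \<longleftrightarrow> (\<exists>n::nat. t \<le> H x (real n)) \<and> 0 \<le> c \<and> t \<le> H x c \<or>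
    (\<forall>n::nat. \<not> t \<le> H x (real n)) \<and> c0 \<le> c" for x
  have [measurable]: "(\<lambda>x. H x (real n)) \<in> borel_measurable lebesgue" for n
    using H by simp
  have "{x \<in> space lebesgue. P x} \<in> sets lebesgue"
  proof (cases "0 \<le> c")
    case True
    then have [measurable]: "(\<lambda>x. H x c) \<in> borel_measurable lebesgue" using H by simp
    show ?thesis unfolding P_def by measurable
  next
    case False
    \<comment> \<open>Measurability of \<open>H x c\<close> is known only for
      \<open>0 \<le> c\<close>; for negative \<open>c\<close> the alternative containing it is false
      and has to be removed first.\<close>
    then have P: "P = (\<lambda>x. (\<forall>n::nat. \<not> t \<le> H x (real n)) \<and> c0 \<le> c)"
      by (simp add: P_def fun_eq_iff)
    show ?thesis unfolding P by measurable
  qed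
  from _ this show "{x \<in> space lebesgue. inv2 H x t \<le> c} \<in> sets lebesgue"
  proof (rule completion.in_sets_AE)
    show "AE x in lebesgue. x \<in> {x \<in> space lebesgue. P x} \<longleftrightarrow> x \<in> {x \<in> space lebesgue. inv2 H x t \<le> c}"
      using ae
    proof eventually_elim
      case (elim x)
      then have "inv2 H x t \<le> c \<longleftrightarrow>
          (if \<exists>n::nat. t \<le> H x (real n) then 0 \<le> c \<and> t \<le> H x c else c0 \<le> c)"
        unfolding c0_def using inv2_cases(1)[of H x t c] t by blast
      also have "\<dots> \<longleftrightarrow> P x"
        unfolding P_def by metis
      finally show ?case by (simp only: mem_Collect_eq)
    qed
  qed simp
qed

text \<open>The complement of any ball contains a unit ball, which has positive measure.\<close>

lemma AE_lebesgue_imp_frequently_at_infinity: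
  fixes P :: "'a::euclidean_space \<Rightarrow> bool"
  assumes "AE x in lebesgue. P x"
  shows "frequently P at_infinity"
proof (rule ccontr)
  assume "\<not> frequently P at_infinity"
  then obtain b where b: "\<And>x. b \<le> norm x \<Longrightarrow> \<not> P x"
    by (auto simp: frequently_def eventually_at_infinity)
  obtain c :: 'a where c: "norm c = \<bar>b\<bar> + 1"
    using vector_choose_size[of "\<bar>b\<bar> + 1"] by auto
  have "\<not> P x" if "x \<in> ball c 1" for x
  proof (rule b)
    have "norm c \<le> norm x + dist c x" by (metis add.commute dist_norm norm_triangle_sub)
    then show "b \<le> norm x" using that c by simp
  qed
  with assms have "AE x in lebesgue. x \<notin> ball c 1"
    by (auto elim!: eventually_mono)
  then have "negligible (ball c 1)"
    by (simp add: negligible_iff_null_sets completion.null_sets_iff_AE)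
  then show False
    using open_not_negligible[of "ball c 1"] by simp
qed

section \<open>Measurability of the Sobolev conjugate\<close>

locale admissible_young =
  fixes \<Phi> :: "real^'n \<Rightarrow> real \<Rightarrow> real" and m l :: "real^'n \<Rightarrow> real"
  assumes young: "generalized_young \<Phi>" and adm: "admissible \<Phi> m l"
begin

definition d :: real where "d = real CARD('n)"
definition mlow :: real where "mlow = exp_minus m"
definition lup :: real where "lup = exp_plus l"

lemma mlow: "1 < mlow" "mlow \<le> m x"
  using adm by (auto simp: admissible_def cond_exponents_def C_plus_def mlow_def exp_minus_def intro: cINF_lower)

lemma lup: "l x \<le> lup"
  using adm by (auto simp: admissible_def cond_exponents_def C_plus_def lup_def exp_plus_def intro: cSUP_upper)

lemma growth: "power_growth (m x) (l x) (\<Phi> x)"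
  using young adm mlow(1) mlow(2)[of x]
  unfolding power_growth_def generalized_young_def admissible_def cond_exponents_def by fastforce

lemma m_gt_1: "1 < m x"
  using mlow(1) mlow(2)[of x] by simp

lemma m_le_l: "m x \<le> l x"
  by (rule power_growth_le[OF growth])

text \<open>The chain \<open>1 < m x \<le> l x < d\<close> excludes dimension one, where the
  exponent \<open>1 / (d - 1)\<close> would degenerate.\<close>

lemma d_gt_1: "1 < d"
proof -
  have "l x < d" for x
    using adm by (auto simp: admissible_def cond_exponents_def d_def)
  then show ?thesis using m_gt_1[of 0] m_le_l[of 0] by (meson less_le_trans less_trans)
qed

definition good :: "real^'n \<Rightarrow> bool" where
  "good x \<longleftrightarrow> young_function (\<Phi> x) \<and> strict_mono_on {0..} (\<Phi> x)"

lemma AE_good: "AE x in lebesgue. good x"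
  using young adm unfolding good_def generalized_young_def admissible_def by auto

lemma goodD:
  assumes "good x"
  shows "\<Phi> x 0 = 0" "continuous_on {0..} (\<Phi> x)" "convex_on {0..} (\<Phi> x)" "strict_mono_on {0..} (\<Phi> x)"
  using assms by (auto simp: good_def young_function_def)

lemma nonneg: "0 \<le> t \<Longrightarrow> 0 \<le> \<Phi> x t"
  using young by (auto simp: generalized_young_def)

lemma good_mono: "good x \<Longrightarrow> 0 \<le> s \<Longrightarrow> s \<le> t \<Longrightarrow> \<Phi> x s \<le> \<Phi> x t"
  using strict_mono_on_leD[OF goodD(4)] by auto

lemma measurable_Phi [measurable]: "0 \<le> t \<Longrightarrow> (\<lambda>x. \<Phi> x t) \<in> borel_measurable lebesgue"
  using young by (auto simp: generalized_young_def)

lemma measurable_Phi_compose: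
  assumes "f \<in> borel_measurable lebesgue" "\<And>x. 0 \<le> f x"
  shows "(\<lambda>x. \<Phi> x (f x)) \<in> borel_measurable lebesgue"
proof (rule caratheodory_lebesgue[OF measurable_Phi _ assms])
  show "AE x in lebesgue. continuous_on {0..} (\<Phi> x)"
    using AE_good by eventually_elim (rule goodD)
qed

definition a :: "real^'n \<Rightarrow> real" where "a x = inv2 \<Phi> x 1"

text \<open>The value 1 is attained at every point, good or not, because attainment follows from the
  growth exponents; \<open>inv_into\<close> never falls back to its default here.\<close>

lemma a: "0 \<le> a x" "\<Phi> x (a x) = 1"
proof -
  have "1 \<in> \<Phi> x ` {0..}"
    using power_growth_attains[OF growth[of x], of 1] m_gt_1[of x] by (auto simp: image_iff)
  then show "0 \<le> a x" "\<Phi> x (a x) = 1"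
    unfolding a_def inv2_def using inv_into_into[of 1 "\<Phi> x" "{0..}"] f_inv_into_f[of 1 "\<Phi> x" "{0..}"] by auto
qed

lemma measurable_a [measurable]: "a \<in> borel_measurable lebesgue"
proof -
  have "(\<lambda>x. inv2 \<Phi> x 1) \<in> borel_measurable lebesgue"
  proof (rule inv2_measurable)
    show "AE x in lebesgue. strict_mono_on {0..} (\<Phi> x) \<and> continuous_on {0..} (\<Phi> x) \<and> \<Phi> x 0 = 0"
      using AE_good by eventually_elim (auto dest: goodD)
  qed auto
  then show ?thesis by (simp add: a_def[abs_def])
qed

lemma Phi0_eq: "Phi0 \<Phi> x t = max (\<Phi> x (a x * t)) (2 * t - 1)"
  by (simp add: Phi0_def a_def)

text \<open>The part of \<open>Phi_bar\<close> below 1 does not depend on \<open>x\<close>. The limit superior in it runs over all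
  points, including the null set on which \<open>\<Phi> y\<close> may be nonzero at 0 and \<open>a y\<close> may vanish.\<close>

definition B :: "real \<Rightarrow> real" where
  "B t = real_of_ereal (Limsup at_infinity (\<lambda>y. ereal (Phi0 \<Phi> y t)))"

lemma Phi_bar_eq:
  "Phi_bar \<Phi> x t = (if 1 \<le> t then 2 * max (\<Phi> x (a x * t)) (2 * t - 1) - 1 else B t)"
  by (simp add: Phi_bar_def Phi0_eq B_def)

lemma Phi0_le_1:
  assumes "0 < t" "t < 1"
  shows "Phi0 \<Phi> y t \<le> 1"
\<comment> \<open>If \<open>a y = 0\<close>, then
  \<open>\<Phi> y (a y * t) = \<Phi> y (a y) = 1\<close>; the growth bounds, which concern positive
  arguments, cover the other case.\<close>
proof (cases "a y = 0")
  case True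
  then show ?thesis using a[of y] assms by (simp add: Phi0_eq)
next
  case False
  then have "0 < a y" using a(1)[of y] by simp
  then have "\<Phi> y (t * a y) \<le> t powr m y * \<Phi> y (a y)"
    using power_growth_bounds(4)[OF growth] assms by simp
  also have "\<dots> \<le> 1"
    using a(2)[of y] assms m_gt_1[of y] powr_mono2[of "m y" t 1] by simp
  finally show ?thesis using assms by (simp add: Phi0_eq mult.commute)
qed

lemma Phi0_mono:
  assumes "0 < s" "s \<le> t"
  shows "Phi0 \<Phi> y s \<le> Phi0 \<Phi> y t"
proof (cases "a y = 0")
  case True
  then show ?thesis using assms by (auto simp: Phi0_eq)
next
  case False
  then have "0 < a y" using a(1)[of y] by simp
  then have "\<Phi> y (a y * s) \<le> \<Phi> y (a y * t)"
    using assms power_growth_strict_mono[OF growth[of y], of "a y * s" "a y * t"] by (cases "s = t") auto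
  then show ?thesis using assms by (auto simp: Phi0_eq)
qed

lemma Phi0_nonneg: "0 \<le> t \<Longrightarrow> 0 \<le> Phi0 \<Phi> y t"
  using nonneg[of "a y * t" y] a(1)[of y] by (auto simp: Phi0_eq le_max_iff_disj)

section \<open>The limit superior that defines the conjugate below 1\<close>

abbreviation Bsup :: "real \<Rightarrow> ereal" where
  "Bsup t \<equiv> Limsup at_infinity (\<lambda>y. ereal (Phi0 \<Phi> y t))"

text \<open>These bounds keep the limit superior finite, so that \<open>real_of_ereal\<close> in
  \<open>B\<close> does not collapse an infinite value to 0.\<close>

lemma Bsup_bounds:
  assumes "0 < t" "t < 1"
  shows "0 \<le> Bsup t" "Bsup t \<le> 1"
proof -
  show "0 \<le> Bsup t"
    using Phi0_nonneg[of t] assms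
    by (intro le_Limsup always_eventually trivial_limit_at_infinity) auto
  show "Bsup t \<le> 1"
    using Phi0_le_1[OF assms] by (intro Limsup_bounded always_eventually) auto
qed

lemma B_mono:
  assumes "0 < s" "s \<le> t" "t < 1"
  shows "B s \<le> B t"
  unfolding B_def
proof (rule real_of_ereal_positive_mono)
  show "0 \<le> Bsup s" using Bsup_bounds(1)[of s] assms by simp
  show "Bsup s \<le> Bsup t"
    using Phi0_mono[OF assms(1,2)] by (intro Limsup_mono always_eventually) auto
  show "Bsup t \<noteq> \<infinity>" using Bsup_bounds(2)[of t] assms by auto
qed

text \<open>\<open>B\<close> is monotone on the open unit interval; its behaviour at 0 and below is
  not controlled, hence the truncation.\<close>

lemma B_measurable: "(\<lambda>t. if t \<in> {0<..<1} then B t else 0) \<in> borel_measurable borel"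
proof -
  have "mono_on {0<..<1} B" by (auto intro!: mono_onI B_mono)
  then have "B \<in> borel_measurable (restrict_space borel {0<..<1})"
    by (rule borel_measurable_mono_on_fnc)
  then show ?thesis
    by (subst (asm) measurable_restrict_space_iff) auto
qed

lemma B_ge:
  assumes t: "0 < t" "t < 1" and q: "frequently (\<lambda>y. q \<le> Phi0 \<Phi> y t) at_infinity"
  shows "q \<le> B t"
proof -
  have "ereal q \<le> Bsup t"
  proof (rule ccontr)
    assume "\<not> ereal q \<le> Bsup t"
    then have "eventually (\<lambda>y. ereal (Phi0 \<Phi> y t) < ereal q) at_infinity"
      by (intro Limsup_lessD) simp
    then show False using q by (auto simp: frequently_def not_le)
  qed
  then show ?thesis
    unfolding B_def using Bsup_bounds[OF t] by (cases "Bsup t") auto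
qed

text \<open>Condition (B0) bounds \<open>\<Phi> y 1\<close> from both sides uniformly in
  \<open>y\<close>. The upper bound keeps the normalisation \<open>a y\<close> away from 0, and the
  lower one gives a power minorant.\<close>

lemma obtain_lower_constants:
  obtains q c where "0 < q" "0 < c"
    "AE y in lebesgue. \<forall>t. 0 < t \<and> t < 1 \<longrightarrow> q * \<Phi> y t \<le> Phi0 \<Phi> y t \<and> c * t powr lup \<le> \<Phi> y t"
proof -
  obtain c c' where c: "0 < c" "0 < c'" "AE y in lebesgue. c < \<Phi> y 1 \<and> \<Phi> y 1 < c'"
    using adm by (auto simp: admissible_def cond_B0_def)
  \<comment> \<open>Since \<open>\<Phi> y s \<le> s * \<Phi> y 1\<close> and
    \<open>s * c' < 1\<close>, this choice gives \<open>\<Phi> y s < 1 = \<Phi> y (a y)\<close>,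
    hence \<open>s \<le> a y\<close>.\<close>
  define s where "s = 1 / (c' + 1)"
  have s: "0 < s" "s \<le> 1" "s * c' < 1" using c by (auto simp: s_def field_simps)
  have "AE y in lebesgue. \<forall>t. 0 < t \<and> t < 1 \<longrightarrow> s powr lup * \<Phi> y t \<le> Phi0 \<Phi> y t \<and> c * t powr lup \<le> \<Phi> y t"
    using AE_good c(3)
  proof eventually_elim
    case (elim y)
    have "\<Phi> y s \<le> s powr m y * \<Phi> y 1"
      using power_growth_bounds(4)[OF growth zero_less_one s(1,2)] by simp
    also have "\<dots> \<le> s * \<Phi> y 1"
      using powr_mono'[of 1 "m y" s] m_gt_1[of y] s nonneg[of 1 y] by (intro mult_right_mono) auto
    also have "\<dots> < 1"
      using elim s by (meson less_imp_le less_trans mult_strict_left_mono)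
    finally have "s \<le> a y"
      using good_mono[OF elim(1), of "a y" s] a(1)[of y] a(2)[of y] by linarith
    show ?case
    proof (intro allI impI conjI)
      fix t :: real assume t: "0 < t \<and> t < 1"
      have "s powr lup * \<Phi> y t \<le> s powr l y * \<Phi> y t"
        using lup[of y] s nonneg[of t y] t by (intro mult_right_mono powr_mono') auto
      also have "\<dots> \<le> \<Phi> y (s * t)"
        using power_growth_bounds(3)[OF growth _ s(1,2)] t by simp
      also have "\<dots> \<le> \<Phi> y (a y * t)"
        using good_mono[OF elim(1)] \<open>s \<le> a y\<close> s t by simp
      finally show "s powr lup * \<Phi> y t \<le> Phi0 \<Phi> y t" by (simp add: Phi0_eq)
      have "c * t powr lup \<le> \<Phi> y 1 * t powr l y"
        using elim lup[of y] t c by (intro mult_mono powr_mono') auto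
      also have "\<dots> \<le> \<Phi> y t"
        using power_growth_bounds(3)[OF growth zero_less_one, of t y] t by (simp add: mult.commute)
      finally show "c * t powr lup \<le> \<Phi> y t" .
    qed
  qed
  then show ?thesis using s c by (intro that[of "s powr lup" c]) auto
qed

text \<open>The power minorant makes \<open>B\<close> positive. The comparison with the limit
  \<open>v\<close> transfers to \<open>B\<close> the integral condition near 0, which is formulated
  with that limit.\<close>

lemma B_lower:
  obtains q c where "0 < q" "0 < c" "\<And>t. 0 < t \<Longrightarrow> t < 1 \<Longrightarrow> c * t powr lup \<le> B t"
    "\<And>t v. 0 < t \<Longrightarrow> t < 1 \<Longrightarrow> ((\<lambda>y. \<Phi> y t) \<longlongrightarrow> v) at_infinity \<Longrightarrow> 0 < v \<and> q * v \<le> B t"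
proof -
  obtain q c where qc: "0 < q" "0 < c" and
    ae: "AE y in lebesgue. \<forall>t. 0 < t \<and> t < 1 \<longrightarrow> q * \<Phi> y t \<le> Phi0 \<Phi> y t \<and> c * t powr lup \<le> \<Phi> y t"
    by (rule obtain_lower_constants)
  note freq = AE_lebesgue_imp_frequently_at_infinity[OF ae]
  show ?thesis
  proof (rule that[of q "q * c"])
    fix t :: real assume t: "0 < t" "t < 1"
    show "q * c * t powr lup \<le> B t"
    proof (rule B_ge[OF t frequently_elim1[OF freq]])
      fix y assume "\<forall>t. 0 < t \<and> t < 1 \<longrightarrow> q * \<Phi> y t \<le> Phi0 \<Phi> y t \<and> c * t powr lup \<le> \<Phi> y t"
      with t have "q * \<Phi> y t \<le> Phi0 \<Phi> y t" "c * t powr lup \<le> \<Phi> y t" by auto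
      then have "q * (c * t powr lup) \<le> q * \<Phi> y t"
        using qc by (intro mult_left_mono) auto
      also have "\<dots> \<le> Phi0 \<Phi> y t" by fact
      finally show "q * c * t powr lup \<le> Phi0 \<Phi> y t"
        by (simp only: mult.assoc)
    qed
    fix v assume v: "((\<lambda>y. \<Phi> y t) \<longlongrightarrow> v) at_infinity"
    have "c * t powr lup \<le> v"
    proof (rule ccontr)
      assume "\<not> c * t powr lup \<le> v"
      then have "\<forall>\<^sub>F y in at_infinity. \<Phi> y t < c * t powr lup"
        using order_tendstoD(2)[OF v] by simp
      then have "\<forall>\<^sub>F y in at_infinity. \<not> (\<forall>t. 0 < t \<and> t < 1 \<longrightarrow> q * \<Phi> y t \<le> Phi0 \<Phi> y t \<and> c * t powr lup \<le> \<Phi> y t)"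
        by eventually_elim (use t in \<open>auto simp: not_le\<close>)
      then show False using freq by (simp add: frequently_def)
    qed
    \<comment> \<open>Every \<open>w < v\<close> is eventually exceeded by
      \<open>\<Phi> y t\<close>, and the almost-everywhere bound holds frequently, which is all that
      a limit superior asks for.\<close>
    moreover have "v \<le> B t / q"
    proof (rule dense_le)
      fix w assume "w < v"
      then have "\<forall>\<^sub>F y in at_infinity. w < \<Phi> y t"
        using order_tendstoD(1)[OF v] by simp
      from frequently_eventually_conj[OF freq this]
      have "frequently (\<lambda>y. q * w \<le> Phi0 \<Phi> y t) at_infinity"
      proof (rule frequently_elim1)
        fix y assume *: "w < \<Phi> y t \<and> (\<forall>t. 0 < t \<and> t < 1 \<longrightarrow> q * \<Phi> y t \<le> Phi0 \<Phi> y t \<and> c * t powr lup \<le> \<Phi> y t)"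
        then have "q * w \<le> q * \<Phi> y t" using qc by simp
        also have "\<dots> \<le> Phi0 \<Phi> y t" using * t by simp
        finally show "q * w \<le> Phi0 \<Phi> y t" .
      qed
      from B_ge[OF t this] show "w \<le> B t / q" using qc by (simp add: field_simps)
    qed
    moreover have "0 < c * t powr lup" using qc t by simp
    ultimately show "0 < v \<and> q * v \<le> B t"
      using qc by (auto simp: field_simps)
  qed (use qc in auto)
qed

section \<open>Integrability of the integrand of \<open>G1\<close>\<close>

lemma Phi_bar_ge: "1 \<le> t \<Longrightarrow> t \<le> Phi_bar \<Phi> x t"
  by (auto simp: Phi_bar_eq max_def)

lemma Phi_bar_pos: "0 < t \<Longrightarrow> 0 < Phi_bar \<Phi> x t"
proof (cases "1 \<le> t")
  case True
  then show ?thesis using Phi_bar_ge[of t x] by linarith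
next
  case False
  assume "0 < t"
  obtain c where "0 < c" "\<And>t. 0 < t \<Longrightarrow> t < 1 \<Longrightarrow> c * t powr lup \<le> B t"
    using B_lower by metis
  with False \<open>0 < t\<close> have "0 < c * t powr lup" "c * t powr lup \<le> B t" by auto
  then show ?thesis using False by (simp add: Phi_bar_eq)
qed

definition K :: "real^'n \<Rightarrow> real \<Rightarrow> real" where
  "K x t = (t / Phi_bar \<Phi> x t) powr (1 / (d - 1))"

lemma K_nonneg: "0 \<le> K x t"
  by (simp add: K_def)

lemma K_pos: "0 < t \<Longrightarrow> 0 < K x t"
  using Phi_bar_pos[of t x] by (simp add: K_def)

lemma K_le:
  assumes "0 < b" "0 < t" "b * t \<le> Phi_bar \<Phi> x t"
  shows "K x t \<le> (1 / b) powr (1 / (d - 1))"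
  unfolding K_def using assms Phi_bar_pos[of t x] d_gt_1
  by (intro powr_mono2) (auto simp: field_simps)

text \<open>The integrand of \<open>G1\<close>, altered for \<open>x\<close> in a null set so as to be jointly measurable.\<close>

definition KT :: "real \<Rightarrow> real^'n \<Rightarrow> real \<Rightarrow> real" where
  "KT T x t = indicator {0..T} t * (t / (if 1 \<le> t
     then 2 * max ((if good x then \<Phi> x (a x * max 0 t) else 0)) (2 * t - 1) - 1
     else if t \<in> {0<..<1} then B t else 0)) powr (1 / (d - 1))"

text \<open>The truncation of \<open>B\<close> at 0 does no harm, because there the numerator makes
  both sides 0.\<close>

lemma KT_eq: "good x \<Longrightarrow> KT T x t = indicator {0..T} t * K x t"
  by (cases "t = 0") (auto simp: KT_def K_def Phi_bar_eq indicator_def)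

lemma KT_measurable: "case_prod (KT T) \<in> borel_measurable (lebesgue \<Otimes>\<^sub>M lborel)"
proof -
  have G: "{x. good x} \<in> sets lebesgue" by (rule AE_lebesgue_sets[OF AE_good])
  have F: "(\<lambda>z. (if good (fst z) then \<Phi> (fst z) (a (fst z) * max 0 (snd z)) else 0)) \<in> borel_measurable (lebesgue \<Otimes>\<^sub>M lborel)"
  proof -
    \<comment> \<open>With the pair \<open>z\<close> as parameter this is a Caratheodory function on
      the product space, so the composition lemma yields joint measurability.\<close>
    define F where "F z t = (if good (fst z) then \<Phi> (fst z) t else 0)" for z :: "(real^'n) \<times> real" and t
    have "(\<lambda>z. F z (a (fst z) * max 0 (snd z))) \<in> borel_measurable (lebesgue \<Otimes>\<^sub>M lborel)"
    proof (rule caratheodory_measurable[where F = F and f = "\<lambda>z. a (fst z) * max 0 (snd z)"])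
      show "(\<lambda>z. F z t) \<in> borel_measurable (lebesgue \<Otimes>\<^sub>M lborel)" if "0 \<le> t" for t
      proof -
        have "(\<lambda>x. if x \<in> {x. good x} then \<Phi> x t else 0) \<in> borel_measurable lebesgue"
          using G measurable_Phi[OF that] by (intro measurable_If_set) auto
        from measurable_compose[OF measurable_fst this] show ?thesis
          by (simp add: F_def)
      qed
      show "continuous_on {0..} (F z)" for z
        by (cases "good (fst z)") (simp_all add: F_def goodD cong: continuous_on_cong)
      show "(\<lambda>z. a (fst z) * max 0 (snd z)) \<in> borel_measurable (lebesgue \<Otimes>\<^sub>M lborel)"
        by measurable
      show "0 \<le> a (fst z) * max 0 (snd z)" for z using a(1) by simp
    qed
    then show ?thesis by (simp add: F_def)
  qed
  have Bm: "(\<lambda>z. if snd z \<in> {0<..<1} then B (snd z) else 0) \<in> borel_measurable (lebesgue \<Otimes>\<^sub>M lborel)"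
    using measurable_compose[OF _ B_measurable, of snd "lebesgue \<Otimes>\<^sub>M lborel"] by simp
  have I: "(\<lambda>z. indicat_real {0..T} (snd z)) \<in> borel_measurable (lebesgue \<Otimes>\<^sub>M lborel)"
    by measurable
  show ?thesis
    unfolding KT_def split_beta'
    by (intro borel_measurable_times I powr_real_measurable borel_measurable_divide measurable_If F Bm
        borel_measurable_diff borel_measurable_max borel_measurable_const) measurable
qed

lemma K_measurable:
  assumes "good x"
  shows "(\<lambda>t. indicator {0..T} t * K x t) \<in> borel_measurable lborel"
  using measurable_Pair2[OF KT_measurable, of x T] assms by (simp add: KT_eq)

lemma K_integrable_near_0:
  assumes x: "good x"
  obtains e where "0 < e" "e < 1" "set_integrable lborel {0<..<e} (K x)"
proof -
  define p where "p = 1 / (d - 1)"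
  have p: "0 < p" using d_gt_1 by (simp add: p_def)
  obtain \<epsilon> \<Phi>inf where \<epsilon>: "0 < \<epsilon>" and lim: "\<And>t. t \<in> {0<..<\<epsilon>} \<Longrightarrow> ((\<lambda>x. \<Phi> x t) \<longlongrightarrow> \<Phi>inf t) at_infinity"
    and fin: "(\<integral>\<^sup>+t\<in>{0<..<\<epsilon>}. ennreal ((t / \<Phi>inf t) powr p) \<partial>lborel) < \<infinity>"
    using adm unfolding admissible_def cond_infinity_def p_def d_def by blast
  obtain q where q: "0 < q"
    "\<And>t v. 0 < t \<Longrightarrow> t < 1 \<Longrightarrow> ((\<lambda>y. \<Phi> y t) \<longlongrightarrow> v) at_infinity \<Longrightarrow> 0 < v \<and> q * v \<le> B t"
    using B_lower by metis
  \<comment> \<open>The bound \<open>1 / 2\<close> keeps \<open>e\<close> below 1, where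
    \<open>Phi_bar\<close> is given by \<open>B\<close> and can be compared with
    \<open>\<Phi>inf\<close>.\<close>
  define e where "e = min \<epsilon> (1 / 2)"
  have e: "0 < e" "e < 1" "e \<le> \<epsilon>" using \<epsilon> by (auto simp: e_def)
  have le: "q powr p * K x t \<le> (t / \<Phi>inf t) powr p" if t: "0 < t" "t < e" for t
  proof -
    have v: "0 < \<Phi>inf t" "q * \<Phi>inf t \<le> B t"
      using q(2)[OF _ _ lim, of t] t e by auto
    then have "t / B t \<le> t / (q * \<Phi>inf t)"
      using t q by (intro divide_left_mono mult_pos_pos) (auto intro: less_le_trans[OF mult_pos_pos])
    moreover have "0 < B t" using v q by (auto intro: less_le_trans[OF mult_pos_pos])
    ultimately have "q * (t / B t) \<le> t / \<Phi>inf t"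
      using v q by (simp add: field_simps)
    then have "(q * (t / B t)) powr p \<le> (t / \<Phi>inf t) powr p"
      using q t p \<open>0 < B t\<close> by (intro powr_mono2) auto
    then have "q powr p * (t / B t) powr p \<le> (t / \<Phi>inf t) powr p"
      using q t \<open>0 < B t\<close> by (subst (asm) powr_mult) auto
    then show ?thesis
      using t e by (simp add: K_def p_def Phi_bar_eq)
  qed
  have [measurable]: "(\<lambda>t. indicator {0..e} t * K x t) \<in> borel_measurable lborel"
    by (rule K_measurable[OF x])
  have eq: "(\<lambda>t. indicator {0<..<e} t * (q powr p * K x t)) =
      (\<lambda>t. indicator {0<..<e} t * (q powr p * (indicator {0..e} t * K x t)))"
    by (auto simp: indicator_def fun_eq_iff)
  have "integrable lborel (\<lambda>t. indicator {0<..<e} t * (q powr p * K x t))"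
  proof (rule integrableI_bounded)
    show "(\<lambda>t. indicator {0<..<e} t * (q powr p * K x t)) \<in> borel_measurable lborel"
      unfolding eq by measurable
    have "(\<integral>\<^sup>+t. ennreal (norm (indicator {0<..<e} t * (q powr p * K x t))) \<partial>lborel) \<le>
        (\<integral>\<^sup>+t\<in>{0<..<\<epsilon>}. ennreal ((t / \<Phi>inf t) powr p) \<partial>lborel)"
      using le e K_nonneg[of x]
      by (intro nn_integral_mono) (auto simp: indicator_def abs_mult intro!: ennreal_leI)
    then show "(\<integral>\<^sup>+t. ennreal (norm (indicator {0<..<e} t * (q powr p * K x t))) \<partial>lborel) < \<infinity>"
      using fin by (rule le_less_trans)
  qed
  then have "integrable lborel (\<lambda>t. q powr p * (indicator {0<..<e} t * K x t))"
    by (simp add: ac_simps)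
  then have "integrable lborel (\<lambda>t. indicator {0<..<e} t * K x t)"
    using integrable_mult_left_iff[of lborel "q powr p" "\<lambda>t. indicator {0<..<e} t * K x t"] q by simp
  then show ?thesis
    using that e by (simp add: set_integrable_def)
qed

text \<open>Away from 0 the integrand is bounded: on \<open>{e..<1}\<close> because \<open>B\<close>
  is monotone, from 1 on because \<open>Phi_bar\<close> dominates \<open>t\<close>. The constant
  \<open>b\<close> serves both ranges.\<close>

lemma K_integrable:
  assumes x: "good x"
  shows "set_integrable lborel {0..T} (K x)"
proof -
  obtain e where e: "0 < e" "e < 1" "set_integrable lborel {0<..<e} (K x)"
    by (rule K_integrable_near_0[OF x])
  obtain c where c: "0 < c" "\<And>t. 0 < t \<Longrightarrow> t < 1 \<Longrightarrow> c * t powr lup \<le> B t"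
    using B_lower by metis
  define b where "b = min 1 (B e)"
  have "0 < c * e powr lup" using c e by simp
  then have "0 < B e" using c(2)[OF e(1,2)] by linarith
  then have b: "0 < b" "b \<le> 1" "b \<le> B e" by (auto simp: b_def)
  have bound: "b * t \<le> Phi_bar \<Phi> x t" if "e \<le> t" for t
  proof (cases "1 \<le> t")
    case True
    then have "b * t \<le> 1 * t" using b by (intro mult_right_mono) auto
    then show ?thesis using Phi_bar_ge[OF True, of x] by simp
  next
    case False
    then have "b * t \<le> b * 1" using b that e by (intro mult_left_mono) auto
    also have "\<dots> \<le> B t" using b B_mono[OF e(1) that] False by simp
    finally show ?thesis using False by (simp add: Phi_bar_eq)
  qed
  show ?thesis
    unfolding set_integrable_def
  proof (rule Bochner_Integration.integrable_bound)
    show "integrable lborel (\<lambda>t. indicat_real {0<..<e} t *\<^sub>R K x t + indicat_real {0..T} t *\<^sub>R (1 / b) powr (1 / (d - 1)))"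
      using e(3) unfolding set_integrable_def
      by (intro Bochner_Integration.integrable_add integrable_scaleR_left) (auto simp: integrable_indicator_iff emeasure_lborel_Icc_eq)
    show "(\<lambda>t. indicat_real {0..T} t *\<^sub>R K x t) \<in> borel_measurable lborel"
      using K_measurable[OF x] by simp
    have "norm (indicat_real {0..T} t *\<^sub>R K x t) \<le>
        norm (indicat_real {0<..<e} t *\<^sub>R K x t + indicat_real {0..T} t *\<^sub>R (1 / b) powr (1 / (d - 1)))" for t
    proof -
      consider "t \<notin> {0..T}" | "t = 0" | "0 < t" "t < e" | "0 < t" "e \<le> t" by force
      then show ?thesis
      proof cases
        case 4
        then show ?thesis using K_le[OF b(1) 4(1) bound] K_nonneg[of x t] by (auto simp: indicator_def)
      qed (use K_nonneg[of x t] in \<open>auto simp: indicator_def K_def\<close>)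
    qed
    then show "AE t in lborel. norm (indicat_real {0..T} t *\<^sub>R K x t) \<le>
        norm (indicat_real {0<..<e} t *\<^sub>R K x t + indicat_real {0..T} t *\<^sub>R (1 / b) powr (1 / (d - 1)))"
      by simp
  qed
qed

lemma G1_eq: "G1 \<Phi> x T = (LINT t:{0..T}|lborel. K x t) powr ((d - 1) / d)"
  by (simp add: G1_def K_def[abs_def] d_def)

text \<open>The integrand is positive on \<open>{s<..t}\<close>, so a vanishing integral would make
  this interval a null set. Strictness is what makes \<open>G1\<close> injective.\<close>

lemma integral_K_mono:
  assumes x: "good x" and "0 \<le> s" "s < t"
  shows "(LINT r:{0..s}|lborel. K x r) < (LINT r:{0..t}|lborel. K x r)"
proof -
  have int: "set_integrable lborel {0..s} (K x)" "set_integrable lborel {s<..t} (K x)"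
    using K_integrable[OF x, of t] assms by (auto intro: set_integrable_subset)
  have "{0..t} = {0..s} \<union> {s<..t}" "{0..s} \<inter> {s<..t} = {}"
    using assms by auto
  then have "(LINT r:{0..t}|lborel. K x r) = (LINT r:{0..s}|lborel. K x r) + (LINT r:{s<..t}|lborel. K x r)"
    using set_integral_Un[OF _ int] by simp
  moreover have "0 \<le> (LINT r:{s<..t}|lborel. K x r)"
    unfolding set_lebesgue_integral_def using K_nonneg by (intro Bochner_Integration.integral_nonneg) auto
  moreover have "(LINT r:{s<..t}|lborel. K x r) \<noteq> 0"
  proof
    assume "(LINT r:{s<..t}|lborel. K x r) = 0"
    then have "AE r in lborel. indicat_real {s<..t} r *\<^sub>R K x r = 0"
      unfolding set_lebesgue_integral_def using int(2) K_nonneg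
      by (subst (asm) integral_nonneg_eq_0_iff_AE) (auto simp: set_integrable_def)
    then have "AE r in lborel. r \<notin> {s<..t}"
    proof eventually_elim
      case (elim r)
      show ?case
      proof
        assume "r \<in> {s<..t}"
        with elim K_pos[of r x] assms show False by simp
      qed
    qed
    then have "emeasure lborel {s<..t} = 0"
      by (subst (asm) AE_iff_null_sets[symmetric]) auto
    then show False using assms by simp
  qed
  ultimately show ?thesis by linarith
qed

lemma integral_K_nonneg: "0 \<le> (LINT r:{0..s}|lborel. K x r)"
  unfolding set_lebesgue_integral_def using K_nonneg by (intro Bochner_Integration.integral_nonneg) auto

section \<open>Monotonicity, continuity and measurability of \<open>G1\<close>\<close>

lemma G1_strict_mono: "good x \<Longrightarrow> strict_mono_on {0..} (G1 \<Phi> x)"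
  unfolding G1_eq using d_gt_1
  by (intro strict_mono_onI powr_less_mono2 integral_K_mono integral_K_nonneg) auto

lemma G1_0: "G1 \<Phi> x 0 = 0"
proof -
  have "(\<lambda>t. indicat_real {0..0} t *\<^sub>R K x t) = (\<lambda>t. 0)"
    by (auto simp: K_def indicator_def fun_eq_iff)
  then show ?thesis by (simp add: G1_eq set_lebesgue_integral_def)
qed

text \<open>The integral is rewritten as a gauge integral, whose indefinite integral is continuous
  on \<open>{0..T + 1}\<close>; near \<open>T\<close> this interval and the half-line
  coincide.\<close>

lemma G1_continuous:
  assumes x: "good x"
  shows "continuous_on {0..} (G1 \<Phi> x)"
proof -
  have eq: "(LINT t:{0..T}|lborel. K x t) = integral {0..T} (K x)" for T
    using set_borel_integral_eq_integral(2)[OF K_integrable[OF x]] .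
  have "continuous (at T within {0..}) (\<lambda>T. integral {0..T} (K x))" if T: "T \<in> {0..}" for T
  proof -
    have "K x integrable_on {0..T + 1}"
      using set_borel_integral_eq_integral(1)[OF K_integrable[OF x]] .
    then have "continuous_on {0..T + 1} (\<lambda>T. integral {0..T} (K x))"
      by (rule indefinite_integral_continuous_1)
    then have "continuous (at T within {0..T + 1}) (\<lambda>T. integral {0..T} (K x))"
      using T by (auto simp: continuous_on_eq_continuous_within)
    moreover have "at T within {0..T + 1} = at T within {0..}"
      using T by (intro at_within_nhd[of _ "{T - 1<..<T + 1}"]) auto
    ultimately show ?thesis by simp
  qed
  then have "continuous_on {0..} (\<lambda>T. integral {0..T} (K x))"
    by (simp add: continuous_on_eq_continuous_within)
  moreover have "0 \<le> integral {0..T} (K x)" for T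
    using integral_K_nonneg[of T x] by (simp add: eq)
  ultimately show ?thesis
    unfolding G1_eq[abs_def] eq using d_gt_1
    by (intro continuous_on_powr' continuous_on_const) auto
qed

text \<open>For good \<open>x\<close> this is a power of a parameter integral over the jointly
  measurable \<open>KT\<close>.\<close>

lemma G1_measurable:
  "(\<lambda>x. G1 \<Phi> x T) \<in> borel_measurable lebesgue"
proof (rule lebesgue_measurable_cong_AE)
  have "(\<lambda>x. LINT t|lborel. KT T x t) \<in> borel_measurable lebesgue"
    by (rule lborel.borel_measurable_lebesgue_integral[OF KT_measurable])
  then show "(\<lambda>x. (LINT t|lborel. KT T x t) powr ((d - 1) / d)) \<in> borel_measurable lebesgue"
    by measurable
  show "AE x in lebesgue. (LINT t|lborel. KT T x t) powr ((d - 1) / d) = G1 \<Phi> x T"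
    using AE_good
  proof eventually_elim
    case (elim x)
    then have "KT T x = (\<lambda>t. indicator {0..T} t * K x t)"
      by (simp add: KT_eq fun_eq_iff)
    then show ?case by (simp add: G1_eq set_lebesgue_integral_def)
  qed
qed

lemma sobolev_conj_measurable:
  assumes t: "0 \<le> t"
  shows "(\<lambda>x. sobolev_conj \<Phi> x t) \<in> borel_measurable lebesgue"
proof (rule lebesgue_measurable_cong_AE)
  define g where "g x = inv2 (G1 \<Phi>) x t" for x
  define c0 where "c0 = (SOME s::real. False)"
  have g [measurable]: "g \<in> borel_measurable lebesgue"
    unfolding g_def
  proof (rule inv2_measurable[OF G1_measurable _ t])
    show "AE x in lebesgue. strict_mono_on {0..} (G1 \<Phi> x) \<and> continuous_on {0..} (G1 \<Phi> x) \<and> G1 \<Phi> x 0 = 0"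
      using AE_good by eventually_elim (simp add: G1_strict_mono G1_continuous G1_0)
  qed
  have [measurable]: "(\<lambda>x. \<Phi> x (a x * max 0 (g x))) \<in> borel_measurable lebesgue"
    using a(1) by (intro measurable_Phi_compose) auto
  define B0 where "B0 x = (if g x \<in> {0<..<1} then B (g x) else 0)" for x
  have [measurable]: "B0 \<in> borel_measurable lebesgue"
    using measurable_compose[OF g B_measurable] by (simp add: B0_def[abs_def])
  \<comment> \<open>\<open>g x\<close> is nonnegative or equals the unspecified \<open>c0\<close>,
    which might be negative. As \<open>B 0\<close> and \<open>B c0\<close> are constants,
    measurability of \<open>B\<close> is called for only on the open unit interval.\<close>
  define h where "h x = (if 1 \<le> g x then 2 * max (\<Phi> x (a x * max 0 (g x))) (2 * g x - 1) - 1
      else if g x = 0 then B 0 else if g x = c0 then B c0 else B0 x)" for x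
  show "h \<in> borel_measurable lebesgue"
    unfolding h_def by measurable
  show "AE x in lebesgue. h x = sobolev_conj \<Phi> x t"
    using AE_good
  proof eventually_elim
    case (elim x)
    have "0 \<le> g x \<or> g x = c0"
      using inv2_cases(2)[where H = "G1 \<Phi>", OF G1_strict_mono[OF elim] G1_continuous[OF elim] G1_0 t]
      by (simp add: g_def c0_def)
    then show ?case
      by (auto simp: h_def B0_def sobolev_conj_def Phi_bar_eq g_def[symmetric])
  qed
qed

end

section \<open>Mass at infinity\<close>

text \<open>Subtraction on \<open>ennreal\<close> truncates, so both inequalities are proved up to a
  slack \<open>e\<close>. Finiteness of \<open>L\<close> gives \<open>L < L + e\<close>, whence
  \<open>f n\<close> is eventually within the slack.\<close>

lemma limsup_add_tendsto:
  fixes f g :: "nat \<Rightarrow> ennreal"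
  assumes f: "f \<longlonglongrightarrow> L" and L: "L < \<infinity>"
  shows "limsup (\<lambda>n. f n + g n) = L + limsup g"
proof (rule antisym)
  obtain r where r: "L = ennreal r" "0 \<le> r" using L by (cases L) auto
  have less: "L < L + ennreal e" if "0 < e" for e
    using r that by (simp add: ennreal_less_iff flip: ennreal_plus)
  show "limsup (\<lambda>n. f n + g n) \<le> L + limsup g"
  proof (rule ennreal_le_epsilon)
    fix e :: real assume "0 < e"
    then have "\<forall>\<^sub>F n in sequentially. f n < L + ennreal e"
      by (intro order_tendstoD(2)[OF f] less)
    then have "limsup (\<lambda>n. f n + g n) \<le> limsup (\<lambda>n. (L + ennreal e) + g n)"
      by (intro Limsup_mono) (auto elim!: eventually_mono intro: add_right_mono)
    also have "\<dots> = L + ennreal e + limsup g"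
      by (rule Limsup_const_add) simp
    finally show "limsup (\<lambda>n. f n + g n) \<le> L + limsup g + ennreal e"
      by (simp add: ac_simps)
  qed
  show "L + limsup g \<le> limsup (\<lambda>n. f n + g n)"
  proof (rule ennreal_le_epsilon)
    fix e :: real assume "0 < e"
    have "(\<lambda>n. ennreal e + f n) \<longlonglongrightarrow> ennreal e + L"
      using f by (intro tendsto_intros)
    then have "\<forall>\<^sub>F n in sequentially. L < ennreal e + f n"
      using less[OF \<open>0 < e\<close>] by (intro order_tendstoD(1)) (auto simp: add.commute)
    then have "limsup (\<lambda>n. L + g n) \<le> limsup (\<lambda>n. ennreal e + (f n + g n))"
      by (intro Limsup_mono) (auto elim!: eventually_mono intro: add_right_mono simp flip: add.assoc)
    then show "L + limsup g \<le> limsup (\<lambda>n. f n + g n) + ennreal e"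
      by (simp add: Limsup_const_add add.commute)
  qed
qed

lemma tendsto_at_top_INF_antimono:
  fixes T :: "real \<Rightarrow> ennreal"
  assumes "antimono T"
  shows "(T \<longlongrightarrow> (INF R. T R)) at_top"
proof (rule order_tendstoI)
  fix c assume "c < (INF R. T R)"
  then have "c < T R" for R
    by (rule less_le_trans) (simp add: INF_lower)
  then show "\<forall>\<^sub>F R in at_top. c < T R" by simp
next
  fix c assume "(INF R. T R) < c"
  then obtain R0 where "T R0 < c" by (auto simp: INF_less_iff)
  then have "T R < c" if "R0 \<le> R" for R
    using antimonoD[OF assms that] by (rule le_less_trans[rotated])
  then show "\<forall>\<^sub>F R in at_top. T R < c"
    by (auto simp: eventually_at_top_linorder)
qed

definition tail_mass :: "(nat \<Rightarrow> real^'n \<Rightarrow> ennreal) \<Rightarrow> real \<Rightarrow> ennreal" where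
  "tail_mass f R = limsup (\<lambda>n. \<integral>\<^sup>+x\<in>{x. R \<le> norm x}. f n x \<partial>lebesgue)"

lemma tail_mass_antimono: "antimono (tail_mass f)"
  unfolding tail_mass_def
  by (intro antimonoI Limsup_mono always_eventually allI nn_integral_mono)
    (auto simp: indicator_def)

text \<open>Tail masses decrease in the radius, so the limit exists and is an infimum. In that form
  a strict upper bound is met at a single radius, and a lower bound holds at all radii.\<close>

lemma mass_at_infinity_tendsto: "(tail_mass f \<longlongrightarrow> mass_at_infinity f) at_top"
  and mass_at_infinity_eq_INF: "mass_at_infinity f = (INF R. tail_mass f R)"
proof -
  note t = tendsto_at_top_INF_antimono[OF tail_mass_antimono[of f]]
  from t show eq: "mass_at_infinity f = (INF R. tail_mass f R)"
    unfolding mass_at_infinity_def tail_mass_def[symmetric]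
    by (intro tendsto_Lim) auto
  from t show "(tail_mass f \<longlongrightarrow> mass_at_infinity f) at_top" by (simp add: eq)
qed

text \<open>Weak-star convergence is tested with continuous functions, so a piecewise linear cutoff
  is enough here, whereas \<open>cutoff\<close> is smooth for the sake of weak gradients.\<close>

definition tent :: "real \<Rightarrow> real^'n \<Rightarrow> real" where
  "tent R x = max 0 (min 1 (R + 1 - norm x))"

lemma tent_bounds [simp]: "0 \<le> tent R x" "tent R x \<le> 1" "\<bar>tent R x\<bar> \<le> 1"
  by (auto simp: tent_def)

lemma tent_continuous: "continuous_on UNIV (tent R)"
  unfolding tent_def[abs_def] by (intro continuous_intros)

lemma tent_measurable [measurable]: "tent R \<in> borel_measurable borel"
  by (intro borel_measurable_continuous_onI tent_continuous)

lemma tent_C0: "\<exists>f\<in>C0. apply_bcontfun f = (tent R :: real^'n \<Rightarrow> real)"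
proof -
  have "(tent R :: real^'n \<Rightarrow> real) \<in> bcontfun"
    using tent_continuous by (auto simp: bcontfun_def bounded_iff intro!: exI[of _ 1])
  then have app: "apply_bcontfun (Bcontfun (tent R)) = (tent R :: real^'n \<Rightarrow> real)"
    by (rule Bcontfun_inverse)
  have "{x. tent R x \<noteq> 0} \<subseteq> cball (0 :: real^'n) (R + 1)"
    by (auto simp: tent_def)
  then have "compact (closure {x::real^'n. tent R x \<noteq> 0})"
    by (intro compact_closed_subset[OF compact_cball closed_closure] closure_minimal closed_cball)
  then have "(Bcontfun (tent R) :: (real^'n) \<Rightarrow>\<^sub>C real) \<in> C0"
    unfolding C0_def by (intro subsetD[OF closure_subset] CollectI) (simp only: app)
  with app show ?thesis by blast
qed

lemma borel_density_nn_integral: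
  assumes f: "f \<in> borel_measurable lebesgue" and g: "g \<in> borel_measurable borel"
  shows "(\<integral>\<^sup>+x. g x \<partial>borel_density f) = (\<integral>\<^sup>+x. f x * g x \<partial>lebesgue)"
proof -
  have id: "(\<lambda>x. x) \<in> density lebesgue f \<rightarrow>\<^sub>M borel"
    using measurable_ident_sets[of "lborel" borel] by (auto intro: measurable_completion)
  have gl: "g \<in> borel_measurable lebesgue"
    using g by (intro measurable_completion) simp
  have "(\<integral>\<^sup>+x. g x \<partial>borel_density f) = (\<integral>\<^sup>+x. g x \<partial>density lebesgue f)"
    unfolding borel_density_def using g by (intro nn_integral_distr[OF id]) simp
  also have "\<dots> = (\<integral>\<^sup>+x. f x * g x \<partial>lebesgue)"
    by (rule nn_integral_density[OF f gl])
  finally show ?thesis .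
qed

text \<open>Weak-star convergence is stated with Bochner integrals, the masses with nonnegative
  ones; finiteness of the measure reconciles the two.\<close>

lemma finite_borel_tent:
  assumes "\<mu> \<in> finite_borel"
  shows "(\<integral>\<^sup>+x. ennreal (tent R x) \<partial>\<mu>) = ennreal (LINT x|\<mu>. tent R x)"
    and "(\<integral>\<^sup>+x. ennreal (tent R x) \<partial>\<mu>) < \<infinity>"
proof -
  interpret finite_measure \<mu> using assms by (simp add: finite_borel_def)
  have sets: "sets \<mu> = sets borel" using assms by (simp add: finite_borel_def)
  have "integrable \<mu> (tent R)"
    by (intro integrable_const_bound[of _ 1]) (auto simp: measurable_cong_sets[OF sets refl])
  then show "(\<integral>\<^sup>+x. ennreal (tent R x) \<partial>\<mu>) = ennreal (LINT x|\<mu>. tent R x)"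
    by (intro nn_integral_eq_integral) auto
  then show "(\<integral>\<^sup>+x. ennreal (tent R x) \<partial>\<mu>) < \<infinity>" by simp
qed

lemma limsup_eq_weak_limit_plus_mass_at_infinity:
  fixes f :: "nat \<Rightarrow> real^'n \<Rightarrow> ennreal"
  assumes f: "\<And>n. f n \<in> borel_measurable lebesgue"
    and ws: "weak_star_conv (\<lambda>n. borel_density (f n)) \<mu>"
  shows "limsup (\<lambda>n. \<integral>\<^sup>+x. f n x \<partial>lebesgue) = emeasure \<mu> UNIV + mass_at_infinity f"
proof -
  have \<mu>: "\<mu> \<in> finite_borel" and \<mu>n: "borel_density (f n) \<in> finite_borel" for n
    using ws by (auto simp: weak_star_conv_def)
  have sets: "sets \<mu> = sets borel" using \<mu> by (simp add: finite_borel_def)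
  note f [measurable]
  have [measurable]: "tent R \<in> borel_measurable lebesgue" for R
    by (rule measurable_completion) simp
  define A where "A R = (\<integral>\<^sup>+x. ennreal (tent R x) \<partial>\<mu>)" for R
  define D where "D R = limsup (\<lambda>n. \<integral>\<^sup>+x. f n x * ennreal (1 - tent R x) \<partial>lebesgue)" for R
  have eq: "limsup (\<lambda>n. \<integral>\<^sup>+x. f n x \<partial>lebesgue) = A R + D R" for R
  proof -
    obtain g where g: "g \<in> C0" "apply_bcontfun g = (tent R :: real^'n \<Rightarrow> real)"
      using tent_C0 by blast
    then have "(\<lambda>n. LINT x|borel_density (f n). tent R x) \<longlonglongrightarrow> (LINT x|\<mu>. tent R x)"
      using ws by (auto simp: weak_star_conv_def)
    then have "(\<lambda>n. ennreal (LINT x|borel_density (f n). tent R x)) \<longlonglongrightarrow> ennreal (LINT x|\<mu>. tent R x)"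
      by (rule tendsto_ennrealI)
    then have "(\<lambda>n. \<integral>\<^sup>+x. f n x * ennreal (tent R x) \<partial>lebesgue) \<longlonglongrightarrow> A R"
      by (simp add: A_def finite_borel_tent(1)[OF \<mu>, symmetric] finite_borel_tent(1)[OF \<mu>n, symmetric]
          borel_density_nn_integral[OF f])
    from limsup_add_tendsto[OF this, of "\<lambda>n. \<integral>\<^sup>+x. f n x * ennreal (1 - tent R x) \<partial>lebesgue"]
    have "limsup (\<lambda>n. (\<integral>\<^sup>+x. f n x * ennreal (tent R x) \<partial>lebesgue) +
        (\<integral>\<^sup>+x. f n x * ennreal (1 - tent R x) \<partial>lebesgue)) = A R + D R"
      using finite_borel_tent(2)[OF \<mu>] by (simp add: A_def D_def)
    moreover have "(\<integral>\<^sup>+x. f n x * ennreal (tent R x) \<partial>lebesgue) +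
        (\<integral>\<^sup>+x. f n x * ennreal (1 - tent R x) \<partial>lebesgue) = (\<integral>\<^sup>+x. f n x \<partial>lebesgue)" for n
    proof -
      have "(\<integral>\<^sup>+x. f n x \<partial>lebesgue) = (\<integral>\<^sup>+x. f n x * ennreal (tent R x) + f n x * ennreal (1 - tent R x) \<partial>lebesgue)"
        by (intro nn_integral_cong) (subst distrib_left[symmetric], subst ennreal_plus[symmetric], auto)
      also have "\<dots> = (\<integral>\<^sup>+x. f n x * ennreal (tent R x) \<partial>lebesgue) +
          (\<integral>\<^sup>+x. f n x * ennreal (1 - tent R x) \<partial>lebesgue)"
        by (rule nn_integral_add) measurable
      finally show ?thesis ..
    qed
    ultimately show ?thesis by simp
  qed
  \<comment> \<open>\<open>1 - tent R\<close> vanishes up to radius \<open>R\<close> and equals 1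
    from \<open>1 + R\<close> on, which traps \<open>D R\<close> between two tail masses with the
    same limit.\<close>
  have D: "tail_mass f (1 + R) \<le> D R" "D R \<le> tail_mass f R" for R
    unfolding D_def tail_mass_def
    by (intro Limsup_mono always_eventually allI nn_integral_mono;
        use tent_bounds[of R] in \<open>auto simp: indicator_def tent_def mult_left_le\<close>)+
  have "(\<lambda>n::nat. tail_mass f (real (Suc n))) \<longlonglongrightarrow> mass_at_infinity f"
    by (rule filterlim_compose[OF mass_at_infinity_tendsto filterlim_compose[OF filterlim_real_sequentially filterlim_Suc]])
  moreover have "(\<lambda>n::nat. tail_mass f (real n)) \<longlonglongrightarrow> mass_at_infinity f"
    by (rule filterlim_compose[OF mass_at_infinity_tendsto filterlim_real_sequentially])
  ultimately have "(\<lambda>n::nat. D (real n)) \<longlonglongrightarrow> mass_at_infinity f"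
    by (rule tendsto_sandwich[rotated 2]) (use D in auto)
  moreover have "(\<lambda>n::nat. A (real n)) \<longlonglongrightarrow> (\<integral>\<^sup>+x. 1 \<partial>\<mu>)"
    unfolding A_def
  proof (rule nn_integral_LIMSEQ)
    show "incseq (\<lambda>n x. ennreal (tent (real n) x))"
      by (auto simp: incseq_def le_fun_def tent_def intro!: ennreal_leI)
    show "(\<lambda>x. ennreal (tent (real n) x)) \<in> borel_measurable \<mu>" for n
      by (simp add: measurable_cong_sets[OF sets refl])
    show "(\<lambda>n. ennreal (tent (real n) x)) \<longlonglongrightarrow> 1" for x :: "real^'n"
    proof (rule tendsto_eventually)
      obtain N where "norm x \<le> real N" using real_arch_simple by blast
      then show "\<forall>\<^sub>F n in sequentially. ennreal (tent (real n) x) = 1"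
        by (intro eventually_sequentiallyI[of N]) (auto simp: tent_def min_def)
    qed
  qed
  ultimately have "(\<lambda>n::nat. A (real n) + D (real n)) \<longlonglongrightarrow> emeasure \<mu> (space \<mu>) + mass_at_infinity f"
    by (intro tendsto_add) auto
  moreover have "space \<mu> = UNIV" using sets_eq_imp_space_eq[OF sets] by simp
  ultimately show ?thesis
    by (simp only: eq[symmetric] LIMSEQ_const_iff)
qed

section \<open>Modulars and norms\<close>

lemma max_ennreal: "max (ennreal a) (ennreal b) = ennreal (max a b)"
  by (rule max_of_mono) (intro monoI ennreal_leI)

lemma min_ennreal: "min (ennreal a) (ennreal b) = ennreal (min a b)"
  by (rule min_of_mono) (intro monoI ennreal_leI)

lemma inverse_antimono_ennreal: "a \<le> b \<Longrightarrow> inverse b \<le> inverse (a::ennreal)"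
  including ennreal.lifting by transfer (rule ereal_inverse_antimono)

context admissible_young
begin

lemma energy_measurable:
  assumes V: "V \<in> borel_measurable lebesgue" and u: "u \<in> borel_measurable lebesgue" "has_weak_gradient u g"
  shows "(\<lambda>x. ennreal (\<Phi> x (norm (weak_grad u x)))) \<in> borel_measurable lebesgue"
    "(\<lambda>x. ennreal (V x * \<Phi> x \<bar>u x\<bar>)) \<in> borel_measurable lebesgue"
    "energy \<Phi> V u \<in> borel_measurable lebesgue"
proof -
  have "weak_grad u \<in> borel_measurable lebesgue"
    using has_weak_gradient_weak_grad[OF u(2)] locally_integrable_measurable
    by (auto simp: has_weak_gradient_def)
  then have [measurable]: "(\<lambda>x. \<Phi> x (norm (weak_grad u x))) \<in> borel_measurable lebesgue"
    by (intro measurable_Phi_compose) auto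
  have [measurable]: "(\<lambda>x. \<Phi> x \<bar>u x\<bar>) \<in> borel_measurable lebesgue"
    using u(1) by (intro measurable_Phi_compose) auto
  show "(\<lambda>x. ennreal (\<Phi> x (norm (weak_grad u x)))) \<in> borel_measurable lebesgue" by measurable
  show "(\<lambda>x. ennreal (V x * \<Phi> x \<bar>u x\<bar>)) \<in> borel_measurable lebesgue" using V by measurable
  then show "energy \<Phi> V u \<in> borel_measurable lebesgue"
    unfolding energy_def[abs_def] by measurable
qed

lemma Phi_scale:
  assumes x: "good x" and "0 \<le> t" "0 < c"
  shows "\<Phi> x (c * t) \<le> max (c powr m x) (c powr l x) * \<Phi> x t"
proof (cases "t = 0")
  case True
  then show ?thesis using goodD(1)[OF x] by simp
next
  case False
  then have t: "0 < t" using assms by simp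
  have "c powr m x * \<Phi> x t \<le> max (c powr m x) (c powr l x) * \<Phi> x t"
    "c powr l x * \<Phi> x t \<le> max (c powr m x) (c powr l x) * \<Phi> x t"
    using nonneg[of t x] t by (intro mult_right_mono; simp)+
  then show ?thesis
    using power_growth_bounds(2,4)[OF growth t, of c x] assms by (cases "1 \<le> c") auto
qed

text \<open>\<open>s + t\<close> is a convex combination of \<open>s / (1 - r)\<close> and
  \<open>t / r\<close>, and undoing each dilation costs at most the power \<open>lup\<close> of its
  factor.\<close>

lemma Phi_add:
  assumes x: "good x" and st: "0 \<le> s" "0 \<le> t" and r: "0 < r" "r < 1"
  shows "\<Phi> x (s + t) \<le> (1 - r) powr (1 - lup) * \<Phi> x s + r powr (1 - lup) * \<Phi> x t"
proof -
  have *: "c * \<Phi> x (w / c) \<le> c powr (1 - lup) * \<Phi> x w" if c: "0 < c" "c \<le> 1" and w: "0 \<le> w" for c w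
  proof -
    have "\<Phi> x ((1 / c) * w) \<le> max ((1 / c) powr m x) ((1 / c) powr l x) * \<Phi> x w"
      using c w by (intro Phi_scale x) auto
    also have "\<dots> \<le> (1 / c) powr lup * \<Phi> x w"
      using c w nonneg[of w x] lup[of x] m_le_l[of x]
      by (intro mult_right_mono) (auto intro!: powr_mono order_trans[OF m_le_l lup])
    finally have "c * \<Phi> x (w / c) \<le> c * ((1 / c) powr lup * \<Phi> x w)"
      using c by (intro mult_left_mono) auto
    also have "c * ((1 / c) powr lup * \<Phi> x w) = c powr (1 - lup) * \<Phi> x w"
      using c by (simp add: powr_diff powr_divide)
    finally show ?thesis .
  qed
  have "\<Phi> x (s + t) = \<Phi> x ((1 - r) *\<^sub>R (s / (1 - r)) + r *\<^sub>R (t / r))"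
    using r by simp
  also have "\<dots> \<le> (1 - r) * \<Phi> x (s / (1 - r)) + r * \<Phi> x (t / r)"
    using st r by (intro convex_onD[OF goodD(3)[OF x]]) auto
  also have "\<dots> \<le> (1 - r) powr (1 - lup) * \<Phi> x s + r powr (1 - lup) * \<Phi> x t"
    using st r by (intro add_mono *) auto
  finally show ?thesis .
qed

text \<open>The bound on the powers is asked only where \<open>u\<close> or its gradient is nonzero.
  For a function that vanishes on a ball, only the exponents outside then matter.\<close>

lemma W_modular_scale:
  assumes g: "has_weak_gradient u g" and u: "u \<in> borel_measurable lebesgue"
    and V: "V \<in> borel_measurable lebesgue" "AE x in lebesgue. 0 \<le> V x"
    and c: "0 < c" and D: "0 \<le> D"
    and ae: "AE x in lebesgue. u x = 0 \<and> weak_grad u x = 0 \<or> max (c powr m x) (c powr l x) \<le> D"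
  shows "W_modular \<Phi> V (\<lambda>x. c * u x) \<le> ennreal D * W_modular \<Phi> V u"
proof -
  note g' = has_weak_gradient_weak_grad[OF g]
  have *: "AE x in lebesgue. \<Phi> x (norm (weak_grad (\<lambda>x. c * u x) x)) \<le> D * \<Phi> x (norm (weak_grad u x)) \<and>
      \<Phi> x \<bar>c * u x\<bar> \<le> D * \<Phi> x \<bar>u x\<bar>"
    using AE_good ae weak_grad_eq[OF has_weak_gradient_cmult[OF g', of c]]
  proof eventually_elim
    case (elim x)
    have "\<Phi> x (c * t) \<le> D * \<Phi> x t" if "0 \<le> t" "t = 0 \<or> max (c powr m x) (c powr l x) \<le> D" for t
    proof (cases "t = 0")
      case True
      then show ?thesis using goodD(1)[OF elim(1)] by simp
    next
      case False
      then show ?thesis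
        using that Phi_scale[OF elim(1) that(1) c] mult_right_mono[OF _ nonneg[OF that(1)]]
        by (meson order_trans)
    qed
    from this[of "norm (weak_grad u x)"] this[of "\<bar>u x\<bar>"] show ?case
      using elim c by (auto simp: abs_mult)
  qed
  have 1: "(\<integral>\<^sup>+x. ennreal (\<Phi> x (norm (weak_grad (\<lambda>x. c * u x) x))) \<partial>lebesgue) \<le>
      ennreal D * (\<integral>\<^sup>+x. ennreal (\<Phi> x (norm (weak_grad u x))) \<partial>lebesgue)"
    unfolding nn_integral_cmult[OF energy_measurable(1)[OF V(1) u g], symmetric]
    using * D by (intro nn_integral_mono_AE) (auto elim!: eventually_mono simp: ennreal_mult'[symmetric] intro!: ennreal_leI)
  have 2: "(\<integral>\<^sup>+x. ennreal (V x * \<Phi> x \<bar>c * u x\<bar>) \<partial>lebesgue) \<le>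
      ennreal D * (\<integral>\<^sup>+x. ennreal (V x * \<Phi> x \<bar>u x\<bar>) \<partial>lebesgue)"
    unfolding nn_integral_cmult[OF energy_measurable(2)[OF V(1) u g], symmetric]
  proof (rule nn_integral_mono_AE)
    show "AE x in lebesgue. ennreal (V x * \<Phi> x \<bar>c * u x\<bar>) \<le> ennreal D * ennreal (V x * \<Phi> x \<bar>u x\<bar>)"
      using * V(2)
    proof eventually_elim
      case (elim x)
      then have "V x * \<Phi> x \<bar>c * u x\<bar> \<le> V x * (D * \<Phi> x \<bar>u x\<bar>)"
        by (intro mult_left_mono) auto
      then show ?case
        using D by (subst ennreal_mult'[symmetric]) (auto intro!: ennreal_leI simp: ac_simps)
    qed
  qed
  show ?thesis
    unfolding W_modular_def distrib_left using 1 2 by (rule add_mono)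
qed

lemma W_modular_eq_energy:
  assumes "V \<in> borel_measurable lebesgue" "u \<in> borel_measurable lebesgue" "has_weak_gradient u g"
  shows "W_modular \<Phi> V u = (\<integral>\<^sup>+x. energy \<Phi> V u x \<partial>lebesgue)"
  unfolding W_modular_def energy_def
  using energy_measurable(1,2)[OF assms] by (rule nn_integral_add[symmetric])

end

locale concentration = admissible_young \<Phi> m l
  for \<Phi> :: "real^'n \<Rightarrow> real \<Rightarrow> real" and m l :: "real^'n \<Rightarrow> real" +
  fixes \<kappa> \<delta> V :: "real^'n \<Rightarrow> real"
  assumes \<kappa>_pos: "\<kappa> \<in> C_plus" and \<delta>_pos: "\<delta> \<in> C_plus"
    and \<kappa>_le_\<delta>: "AE x in lebesgue. \<kappa> x \<le> \<delta> x"
    and conj_bounds: "AE x in lebesgue. \<forall>c\<ge>0. \<forall>t\<ge>0.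
           min (c powr \<kappa> x) (c powr \<delta> x) * sobolev_conj \<Phi> x t \<le> sobolev_conj \<Phi> x (c * t) \<and>
           sobolev_conj \<Phi> x (c * t) \<le> max (c powr \<kappa> x) (c powr \<delta> x) * sobolev_conj \<Phi> x t"
    and V_loc: "locally_integrable V" and V_pos: "0 < essinf V"
begin

lemma C_plus_gt_1:
  fixes r :: "real^'n \<Rightarrow> real"
  shows "r \<in> C_plus \<Longrightarrow> 1 < r x"
proof -
  assume r: "r \<in> C_plus"
  then have "exp_minus r \<le> r x"
    by (auto simp: C_plus_def exp_minus_def intro: cINF_lower)
  with r show "1 < r x" by (simp add: C_plus_def)
qed

lemma \<kappa>_gt_1: "1 < \<kappa> x" and \<delta>_gt_1: "1 < \<delta> x"
  using C_plus_gt_1 \<kappa>_pos \<delta>_pos by auto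

lemma V_measurable: "V \<in> borel_measurable lebesgue"
  by (rule locally_integrable_measurable[OF V_loc])

lemma V_lower: obtains v where "0 < v" "AE x in lebesgue. v \<le> V x"
proof -
  obtain c where c: "AE x in lebesgue. c \<le> ereal (V x)" "0 < c"
    using V_pos unfolding essinf_def less_Sup_iff by auto
  then obtain v where v: "0 < v" "ereal v < c"
    using ereal_dense2[of 0 c] by (auto simp: zero_ereal_def)
  have "AE x in lebesgue. v \<le> V x"
    using c(1) by eventually_elim (use v in \<open>metis ereal_less_eq(3) less_imp_le order_trans\<close>)
  with v show ?thesis using that by blast
qed

lemma V_nonneg: "AE x in lebesgue. 0 \<le> V x"
proof -
  obtain v where v: "0 < v" "AE x in lebesgue. v \<le> V x" by (rule V_lower)
  from v(2) show ?thesis by eventually_elim (use v(1) in simp)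
qed

text \<open>Continuity of the conjugate in \<open>t\<close> is read off from the two-sided power
  bounds rather than from its construction; with measurability at fixed \<open>t\<close> it is a
  Caratheodory function.\<close>

lemma sobolev_conj_compose_measurable:
  assumes "u \<in> borel_measurable lebesgue"
  shows "(\<lambda>x. ennreal (sobolev_conj \<Phi> x \<bar>u x\<bar>)) \<in> borel_measurable lebesgue"
proof -
  have "(\<lambda>x. sobolev_conj \<Phi> x \<bar>u x\<bar>) \<in> borel_measurable lebesgue"
  proof (rule caratheodory_lebesgue[OF sobolev_conj_measurable])
    show "AE x in lebesgue. continuous_on {0..} (sobolev_conj \<Phi> x)"
      using conj_bounds
    proof eventually_elim
      case (elim x)
      show ?case
        by (rule power_bounds_imp_continuous[of "\<kappa> x" "\<delta> x"])
          (use elim \<kappa>_gt_1[of x] \<delta>_gt_1[of x] in auto)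
    qed
  qed (use assms in auto)
  then show ?thesis by simp
qed

section \<open>Power bounds between modulars and Luxemburg norms\<close>

lemma W_spaceD:
  assumes "u \<in> W_space \<Phi> V"
  shows "u \<in> borel_measurable lebesgue" "has_weak_gradient u (weak_grad u)" "W_modular \<Phi> V u < \<infinity>"
  using assms has_weak_gradient_weak_grad by (auto simp: W_space_def L_space_def)

text \<open>The claimed bound \<open>s\<close> is itself admissible in the infimum. For
  \<open>1 \<le> A\<close> it equals \<open>A powr (1 / p)\<close>, and exponents from
  \<open>p\<close> on satisfy \<open>(1 / s) powr r \<le> 1 / A\<close>; for \<open>A < 1\<close>
  the exponent \<open>q\<close> takes over.\<close>

lemma W_norm_le:
  assumes u: "u \<in> borel_measurable lebesgue" "has_weak_gradient u g"
    and A: "0 < A" "W_modular \<Phi> V u \<le> ennreal A" and pq: "0 < p" "p \<le> q"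
    and ae: "AE x in lebesgue. u x = 0 \<and> weak_grad u x = 0 \<or> p \<le> m x \<and> l x \<le> q"
  shows "W_norm \<Phi> V u \<le> ennreal (max (A powr (1 / p)) (A powr (1 / q)))"
proof -
  define s where "s = max (A powr (1 / p)) (A powr (1 / q))"
  have s: "0 < s" using A by (simp add: s_def max_def)
  have *: "max ((1 / s) powr m x) ((1 / s) powr l x) \<le> 1 / A" if x: "p \<le> m x" "l x \<le> q" for x
  proof (cases "1 \<le> A")
    case True
    have "A powr (1 / q) \<le> A powr (1 / p)"
      using True pq by (intro powr_mono) (auto simp: field_simps)
    then have s_eq: "s = A powr (1 / p)" by (simp add: s_def)
    then have "1 \<le> s" using True pq by (simp add: ge_one_powr_ge_zero)
    then have "(1 / s) powr r \<le> (1 / s) powr p" if "p \<le> r" for r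
      using s that by (intro powr_mono') auto
    moreover have "(1 / s) powr p = 1 / A"
      using pq A by (simp add: s_eq powr_divide powr_powr)
    ultimately show ?thesis using x m_le_l[of x] by auto
  next
    case False
    have "A powr (1 / p) \<le> A powr (1 / q)"
      using False A pq by (intro powr_mono') (auto simp: field_simps)
    then have s_eq: "s = A powr (1 / q)" by (simp add: s_def)
    then have "s \<le> 1" using False A pq by (simp add: powr_le1)
    then have "(1 / s) powr r \<le> (1 / s) powr q" if "r \<le> q" for r
      using s that by (intro powr_mono) auto
    moreover have "(1 / s) powr q = 1 / A"
      using pq A by (simp add: s_eq powr_divide powr_powr)
    ultimately show ?thesis using x m_le_l[of x] by auto
  qed
  have "W_modular \<Phi> V (\<lambda>x. (1 / s) * u x) \<le> ennreal (1 / A) * W_modular \<Phi> V u"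
  proof (rule W_modular_scale[OF u(2,1) V_measurable V_nonneg])
    show "AE x in lebesgue. u x = 0 \<and> weak_grad u x = 0 \<or> max ((1 / s) powr m x) ((1 / s) powr l x) \<le> 1 / A"
      using ae by eventually_elim (use * in blast)
  qed (use s A in auto)
  also have "\<dots> \<le> ennreal (1 / A) * ennreal A"
    using A by (intro mult_left_mono) auto
  also have "\<dots> = 1"
    using A by (simp flip: ennreal_mult)
  finally have "W_modular \<Phi> V (\<lambda>x. u x / s) \<le> 1"
    by simp
  then show ?thesis
    unfolding W_norm_def s_def[symmetric] using s by (intro Inf_lower) auto
qed

lemma W_modular_le_of_W_norm:
  assumes u: "u \<in> W_space \<Phi> V" and C: "0 \<le> C" "W_norm \<Phi> V u \<le> ennreal C"
  shows "W_modular \<Phi> V u \<le> ennreal ((C + 1) powr lup)"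
proof -
  \<comment> \<open>The infimum need not be attained, so the slack 1 provides an admissible
    \<open>c\<close> below \<open>C + 1\<close>; it also makes the base at least 1, where
    \<open>lup\<close> gives the largest power.\<close>
  have "W_norm \<Phi> V u < ennreal (C + 1)"
    using C by (intro le_less_trans[OF C(2)]) (simp add: ennreal_less_iff)
  then obtain c where c: "0 < c" "ennreal c < ennreal (C + 1)" "W_modular \<Phi> V (\<lambda>x. u x / c) \<le> 1"
    unfolding W_norm_def Inf_less_iff by auto
  then have cC: "c \<le> C + 1" using ennreal_less_iff[of c "C + 1"] by (simp only: less_imp_le)
  note gu = W_spaceD(2)[OF u]
  have gc: "has_weak_gradient (\<lambda>x. (1 / c) * u x) (\<lambda>x. (1 / c) *\<^sub>R weak_grad u x)"
    by (rule has_weak_gradient_cmult[OF gu])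
  have "W_modular \<Phi> V (\<lambda>x. c * ((1 / c) * u x)) \<le> ennreal ((C + 1) powr lup) * W_modular \<Phi> V (\<lambda>x. (1 / c) * u x)"
  proof (rule W_modular_scale[OF gc _ V_measurable V_nonneg c(1)])
    have "c powr r \<le> (C + 1) powr lup" if "0 \<le> r" "r \<le> lup" for r
    proof -
      have "c powr r \<le> (C + 1) powr r" using c cC that by (intro powr_mono2) auto
      also have "\<dots> \<le> (C + 1) powr lup" using C that by (intro powr_mono) auto
      finally show ?thesis .
    qed
    then have "max (c powr m x) (c powr l x) \<le> (C + 1) powr lup" for x
      using m_gt_1[of x] m_le_l[of x] lup[of x] by auto
    then show "AE x in lebesgue. (1 / c) * u x = 0 \<and> weak_grad (\<lambda>x. (1 / c) * u x) x = 0 \<or>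
        max (c powr m x) (c powr l x) \<le> (C + 1) powr lup"
      by auto
    show "(\<lambda>x. (1 / c) * u x) \<in> borel_measurable lebesgue"
      using W_spaceD(1)[OF u] by measurable
  qed simp
  also have "\<dots> \<le> ennreal ((C + 1) powr lup) * 1"
    using c by (intro mult_left_mono) auto
  finally show ?thesis using c by simp
qed

text \<open>Every \<open>c\<close> admissible in the Luxemburg infimum satisfies
  \<open>b \<le> max (c powr p) (c powr q)\<close>, since scaling \<open>v / c\<close> back by
  \<open>c\<close> costs at most that factor; taking roots bounds \<open>c\<close> from
  below.\<close>

lemma L_norm_ge:
  assumes v: "v \<in> borel_measurable lebesgue"
    and b: "0 < b" "ennreal b \<le> (\<integral>\<^sup>+x. ennreal (sobolev_conj \<Phi> x \<bar>v x\<bar>) \<partial>lebesgue)"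
    and pq: "0 < p" "p \<le> q"
    and ae: "AE x in lebesgue. v x = 0 \<or> p \<le> \<kappa> x \<and> \<delta> x \<le> q"
  shows "ennreal (min (b powr (1 / p)) (b powr (1 / q))) \<le> L_norm (sobolev_conj \<Phi>) v"
  unfolding L_norm_def
proof (rule Inf_greatest, clarify)
  fix c assume c: "0 < c" "(\<integral>\<^sup>+x. ennreal (sobolev_conj \<Phi> x (\<bar>v x\<bar> / c)) \<partial>lebesgue) \<le> 1"
  define M where "M = max (c powr p) (c powr q)"
  have vc: "(\<lambda>x. ennreal (sobolev_conj \<Phi> x (\<bar>v x\<bar> / c))) \<in> borel_measurable lebesgue"
    using sobolev_conj_compose_measurable[of "\<lambda>x. v x / c"] v c by (simp add: abs_divide)
  have "ennreal b \<le> (\<integral>\<^sup>+x. ennreal M * ennreal (sobolev_conj \<Phi> x (\<bar>v x\<bar> / c)) \<partial>lebesgue)"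
  proof (rule order_trans[OF b(2) nn_integral_mono_AE])
    show "AE x in lebesgue. ennreal (sobolev_conj \<Phi> x \<bar>v x\<bar>) \<le> ennreal M * ennreal (sobolev_conj \<Phi> x (\<bar>v x\<bar> / c))"
      using ae conj_bounds \<kappa>_le_\<delta>
    proof eventually_elim
      case (elim x)
      show ?case
      proof (cases "v x = 0")
        case True
        \<comment> \<open>The comparison with \<open>p\<close> and \<open>q\<close> may fail at such
          \<open>x\<close>. The power bounds with \<open>c = 0\<close> and \<open>t = 0\<close> show
          that the conjugate at 0 is at most 0, which \<open>ennreal\<close> turns into 0.\<close>
        have "sobolev_conj \<Phi> x (0 * 0) \<le> max (0 powr \<kappa> x) (0 powr \<delta> x) * sobolev_conj \<Phi> x 0"
          using elim(2) by blast
        then have "sobolev_conj \<Phi> x 0 \<le> 0" by simp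
        then have "ennreal (sobolev_conj \<Phi> x 0) = 0" by (rule ennreal_neg)
        then show ?thesis by (simp only: True abs_zero zero_le)
      next
        case False
        have "max (c powr \<kappa> x) (c powr \<delta> x) \<le> M"
        proof (cases "1 \<le> c")
          case True
          then show ?thesis
            using elim False by (auto simp: M_def le_max_iff_disj intro!: disjI2 powr_mono)
        next
          case c1: False
          then show ?thesis
            using elim False c by (auto simp: M_def le_max_iff_disj intro!: disjI1 powr_mono')
        qed
        then have "ennreal (max (c powr \<kappa> x) (c powr \<delta> x)) \<le> ennreal M"
          by (rule ennreal_leI)
        have "sobolev_conj \<Phi> x (c * (\<bar>v x\<bar> / c)) \<le> max (c powr \<kappa> x) (c powr \<delta> x) * sobolev_conj \<Phi> x (\<bar>v x\<bar> / c)"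
          using elim(2) c by (meson abs_ge_zero divide_nonneg_pos less_imp_le)
        then have "ennreal (sobolev_conj \<Phi> x (c * (\<bar>v x\<bar> / c))) \<le>
            ennreal (max (c powr \<kappa> x) (c powr \<delta> x) * sobolev_conj \<Phi> x (\<bar>v x\<bar> / c))"
          by (rule ennreal_leI)
        also have "\<dots> = ennreal (max (c powr \<kappa> x) (c powr \<delta> x)) * ennreal (sobolev_conj \<Phi> x (\<bar>v x\<bar> / c))"
          by (rule ennreal_mult') (simp add: le_max_iff_disj)
        also have "\<dots> \<le> ennreal M * ennreal (sobolev_conj \<Phi> x (\<bar>v x\<bar> / c))"
          by (rule mult_right_mono) (fact, simp)
        finally show ?thesis using c by simp
      qed
    qed
  qed
  also have "\<dots> = ennreal M * (\<integral>\<^sup>+x. ennreal (sobolev_conj \<Phi> x (\<bar>v x\<bar> / c)) \<partial>lebesgue)"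
    by (rule nn_integral_cmult[OF vc])
  also have "\<dots> \<le> ennreal M * 1"
    using c(2) by (intro mult_left_mono) auto
  finally have bM: "b \<le> M" by (simp add: M_def ennreal_le_iff le_max_iff_disj)
  have "b powr (1 / r) \<le> c" if "b \<le> c powr r" "0 < r" for r
  proof -
    have "b powr (1 / r) \<le> (c powr r) powr (1 / r)"
      using that b by (intro powr_mono2) auto
    then show ?thesis using that c by (simp add: powr_powr)
  qed
  then have "min (b powr (1 / p)) (b powr (1 / q)) \<le> c"
    using bM pq unfolding M_def by (auto simp: le_max_iff_disj min_le_iff_disj)
  then show "ennreal (min (b powr (1 / p)) (b powr (1 / q))) \<le> ennreal c"
    by (rule ennreal_leI)
qed

text \<open>\<open>L_norm\<close> may be infinite; a positive real lower bound \<open>y\<close> in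
  its place permits cancellation in \<open>ennreal\<close>.\<close>

lemma S2_mult_le:
  assumes v: "v \<in> W_space \<Phi> V" "\<not> (AE x in lebesgue. v x = 0)"
    and y: "0 < y" "ennreal y \<le> L_norm (sobolev_conj \<Phi>) v"
  shows "S2 \<Phi> V * ennreal y \<le> W_norm \<Phi> V v"
proof -
  have "S2 \<Phi> V \<le> W_norm \<Phi> V v / L_norm (sobolev_conj \<Phi>) v"
    unfolding S2_def using v by (intro INF_lower) auto
  also have "\<dots> \<le> W_norm \<Phi> V v / ennreal y"
    unfolding divide_ennreal_def using y by (intro mult_left_mono inverse_antimono_ennreal) auto
  finally have "S2 \<Phi> V * ennreal y \<le> W_norm \<Phi> V v / ennreal y * ennreal y"
    by (intro mult_right_mono) auto
  also have "\<dots> = W_norm \<Phi> V v"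
    using y by (simp add: ennreal_divide_times ennreal_mult_divide_eq)
  finally show ?thesis .
qed

section \<open>Concentration at infinity\<close>

text \<open>This bound takes the place of a compact embedding into \<open>L\<^sup>\<Phi>\<close> over the region where the cutoff varies.\<close>

lemma Phi_integral_le:
  assumes u: "u \<in> W_space \<Phi> V"
  shows "0 < v \<Longrightarrow> AE x in lebesgue. v \<le> V x \<Longrightarrow>
    (\<integral>\<^sup>+x. ennreal (\<Phi> x \<bar>u x\<bar>) \<partial>lebesgue) \<le> ennreal (1 / v) * W_modular \<Phi> V u"
proof -
  assume v: "0 < v" "AE x in lebesgue. v \<le> V x"
  have "(\<integral>\<^sup>+x. ennreal (\<Phi> x \<bar>u x\<bar>) \<partial>lebesgue) \<le>
      (\<integral>\<^sup>+x. ennreal (1 / v) * ennreal (V x * \<Phi> x \<bar>u x\<bar>) \<partial>lebesgue)"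
  proof (rule nn_integral_mono_AE)
    show "AE x in lebesgue. ennreal (\<Phi> x \<bar>u x\<bar>) \<le> ennreal (1 / v) * ennreal (V x * \<Phi> x \<bar>u x\<bar>)"
      using v(2)
    proof eventually_elim
      case (elim x)
      have "v * \<Phi> x \<bar>u x\<bar> \<le> V x * \<Phi> x \<bar>u x\<bar>"
        using elim nonneg by (intro mult_right_mono) auto
      then have "\<Phi> x \<bar>u x\<bar> \<le> (1 / v) * (V x * \<Phi> x \<bar>u x\<bar>)"
        using v(1) by (simp add: field_simps)
      then have "ennreal (\<Phi> x \<bar>u x\<bar>) \<le> ennreal ((1 / v) * (V x * \<Phi> x \<bar>u x\<bar>))"
        by (rule ennreal_leI)
      also have "\<dots> = ennreal (1 / v) * ennreal (V x * \<Phi> x \<bar>u x\<bar>)"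
        using v(1) by (intro ennreal_mult') simp
      finally show ?case .
    qed
  qed
  also have "\<dots> = ennreal (1 / v) * (\<integral>\<^sup>+x. ennreal (V x * \<Phi> x \<bar>u x\<bar>) \<partial>lebesgue)"
    by (rule nn_integral_cmult[OF energy_measurable(2)[OF V_measurable W_spaceD(1,2)[OF u]]])
  also have "\<dots> \<le> ennreal (1 / v) * W_modular \<Phi> V u"
    unfolding W_modular_def by (intro mult_left_mono) auto
  finally show ?thesis .
qed

context
  fixes u :: "real^'n \<Rightarrow> real" and R :: real
  assumes u: "u \<in> W_space \<Phi> V" and R: "4 \<le> R"
begin

lemma cutoff_weak_gradient:
  "has_weak_gradient (\<lambda>x. cutoff R x * u x)
     (\<lambda>x. cutoff R x *\<^sub>R weak_grad u x + u x *\<^sub>R (\<chi> i. partial_deriv i (cutoff R) x))"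
  by (rule has_weak_gradient_mult[OF Ck_cutoff W_spaceD(2)[OF u]])

lemma cutoff_measurable: "(\<lambda>x. cutoff R x * u x) \<in> borel_measurable lebesgue"
  using cutoff_weak_gradient locally_integrable_measurable unfolding has_weak_gradient_def by blast

text \<open>\<open>weak_grad\<close> is an arbitrary representative, so its vanishing on the ball is
  only an almost-everywhere fact. It confines the exponent estimates to points outside the
  ball.\<close>

lemma cutoff_support:
  "AE x in lebesgue. norm x \<le> R \<longrightarrow> cutoff R x * u x = 0 \<and> weak_grad (\<lambda>x. cutoff R x * u x) x = 0"
  using weak_grad_eq[OF cutoff_weak_gradient]
  by eventually_elim (use R in \<open>simp add: cutoff_eq_0 gradient_cutoff_eq_0\<close>)

lemma cutoff_modular_le:
  assumes r: "0 < r" "r < 1"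
  shows "W_modular \<Phi> V (\<lambda>x. cutoff R x * u x) \<le>
    ennreal ((1 - r) powr (1 - lup)) * (\<integral>\<^sup>+x\<in>{x. R \<le> norm x}. energy \<Phi> V u x \<partial>lebesgue) +
    ennreal (r powr (1 - lup) * (4 / R) powr mlow) * (\<integral>\<^sup>+x. ennreal (\<Phi> x \<bar>u x\<bar>) \<partial>lebesgue)"
proof -
  define A where "A = (1 - r) powr (1 - lup)"
  define D where "D = r powr (1 - lup) * (4 / R) powr mlow"
  \<comment> \<open>The potential term is not split and carries the factor 1;
    \<open>1 \<le> A\<close> lets it share the factor of the gradient term.\<close>
  have "(1 - r) powr 0 \<le> A"
    unfolding A_def using r m_gt_1[of 0] m_le_l[of 0] lup[of 0] by (intro powr_mono') auto
  then have A: "1 \<le> A" using r by simp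
  have D: "0 \<le> D" by (simp add: D_def)
  have [measurable]: "energy \<Phi> V u \<in> borel_measurable lebesgue"
    by (rule energy_measurable(3)[OF V_measurable W_spaceD(1,2)[OF u]])
  have [measurable]: "(\<lambda>x. \<Phi> x \<bar>u x\<bar>) \<in> borel_measurable lebesgue"
    using W_spaceD(1)[OF u] by (intro measurable_Phi_compose) auto
  have [measurable]: "{x::real^'n. R \<le> norm x} \<in> sets lebesgue"
  proof -
    have "closed {x::real^'n. R \<le> norm x}"
      by (intro closed_Collect_le continuous_intros)
    then show ?thesis by (simp add: borel_closed)
  qed
  have "W_modular \<Phi> V (\<lambda>x. cutoff R x * u x) = (\<integral>\<^sup>+x. energy \<Phi> V (\<lambda>x. cutoff R x * u x) x \<partial>lebesgue)"
    by (rule W_modular_eq_energy[OF V_measurable cutoff_measurable cutoff_weak_gradient])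
  also have "\<dots> \<le> (\<integral>\<^sup>+x. ennreal A * (energy \<Phi> V u x * indicator {x. R \<le> norm x} x) +
      ennreal D * ennreal (\<Phi> x \<bar>u x\<bar>) \<partial>lebesgue)"
  proof (rule nn_integral_mono_AE)
    show "AE x in lebesgue. energy \<Phi> V (\<lambda>x. cutoff R x * u x) x \<le>
        ennreal A * (energy \<Phi> V u x * indicator {x. R \<le> norm x} x) + ennreal D * ennreal (\<Phi> x \<bar>u x\<bar>)"
      using AE_good V_nonneg cutoff_support weak_grad_eq[OF cutoff_weak_gradient]
    proof eventually_elim
      case (elim x)
      show ?case
      proof (cases "R \<le> norm x")
        case False
        then have 0: "cutoff R x * u x = 0" "weak_grad (\<lambda>x. cutoff R x * u x) x = 0"
          using elim(3) by auto
        have "energy \<Phi> V (\<lambda>x. cutoff R x * u x) x = 0"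
          unfolding energy_def 0 by (simp add: goodD(1)[OF elim(1)])
        then show ?thesis by simp
      next
        case True
        let ?g = "norm (weak_grad u x)"
        have "norm (weak_grad (\<lambda>x. cutoff R x * u x) x) \<le>
            cutoff R x * ?g + \<bar>u x\<bar> * norm (\<chi> i. partial_deriv i (cutoff R) x)"
          unfolding elim(4) by (rule order_trans[OF norm_triangle_ineq]) (simp add: cutoff_nonneg)
        also have "\<dots> \<le> 1 * ?g + \<bar>u x\<bar> * (4 / R)"
          using R by (intro add_mono mult_right_mono mult_left_mono cutoff_le_1 norm_gradient_cutoff) auto
        finally have le: "norm (weak_grad (\<lambda>x. cutoff R x * u x) x) \<le> ?g + 4 / R * \<bar>u x\<bar>"
          by (simp add: mult.commute)
        \<comment> \<open>For a ratio at most 1, which is the purpose of \<open>4 \<le> R\<close>,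
          the smallest exponent \<open>mlow\<close> gives the largest power.\<close>
        have R4: "0 < 4 / R" "4 / R \<le> 1" using R by auto
        have "(4 / R) powr q \<le> (4 / R) powr mlow" if "mlow \<le> q" for q
          using that R4 by (intro powr_mono') auto
        then have "max ((4 / R) powr m x) ((4 / R) powr l x) \<le> (4 / R) powr mlow"
          using mlow(2)[of x] m_le_l[of x] by auto
        then have "\<Phi> x (4 / R * \<bar>u x\<bar>) \<le> (4 / R) powr mlow * \<Phi> x \<bar>u x\<bar>"
          using Phi_scale[OF elim(1) _ R4(1), of "\<bar>u x\<bar>"] nonneg[of "\<bar>u x\<bar>" x]
          by (meson abs_ge_zero mult_right_mono order_trans)
        then have "r powr (1 - lup) * \<Phi> x (4 / R * \<bar>u x\<bar>) \<le> r powr (1 - lup) * ((4 / R) powr mlow * \<Phi> x \<bar>u x\<bar>)"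
          by (intro mult_left_mono) auto
        moreover have "\<Phi> x (norm (weak_grad (\<lambda>x. cutoff R x * u x) x)) \<le> \<Phi> x (?g + 4 / R * \<bar>u x\<bar>)"
          by (intro good_mono[OF elim(1)] le) auto
        moreover have "\<Phi> x (?g + 4 / R * \<bar>u x\<bar>) \<le> A * \<Phi> x ?g + r powr (1 - lup) * \<Phi> x (4 / R * \<bar>u x\<bar>)"
          unfolding A_def using R r by (intro Phi_add[OF elim(1)]) auto
        ultimately have 1: "\<Phi> x (norm (weak_grad (\<lambda>x. cutoff R x * u x) x)) \<le> A * \<Phi> x ?g + D * \<Phi> x \<bar>u x\<bar>"
          unfolding D_def by (simp only: mult.assoc)
        have "\<bar>cutoff R x * u x\<bar> \<le> \<bar>u x\<bar>"
          using cutoff_nonneg[of R x] cutoff_le_1[of R x] by (simp add: abs_mult mult_left_le_one_le)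
        then have "\<Phi> x \<bar>cutoff R x * u x\<bar> \<le> \<Phi> x \<bar>u x\<bar>"
          by (intro good_mono[OF elim(1)]) auto
        also have "\<dots> \<le> A * \<Phi> x \<bar>u x\<bar>"
          using mult_right_mono[OF A nonneg[of "\<bar>u x\<bar>" x]] by simp
        finally have 2: "V x * \<Phi> x \<bar>cutoff R x * u x\<bar> \<le> A * (V x * \<Phi> x \<bar>u x\<bar>)"
          using mult_left_mono[OF _ elim(2)] by (metis mult.left_commute)
        have "energy \<Phi> V (\<lambda>x. cutoff R x * u x) x \<le>
            ennreal (A * \<Phi> x ?g + D * \<Phi> x \<bar>u x\<bar>) + ennreal (A * (V x * \<Phi> x \<bar>u x\<bar>))"
          unfolding energy_def using 1 2 by (intro add_mono ennreal_leI)
        also have "\<dots> = ennreal A * energy \<Phi> V u x + ennreal D * ennreal (\<Phi> x \<bar>u x\<bar>)"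
          using A D nonneg[of ?g x] nonneg[of "\<bar>u x\<bar>" x] elim(2)
          by (simp add: energy_def ennreal_plus ennreal_mult' distrib_left ac_simps)
        finally show ?thesis using True by simp
      qed
    qed
  qed
  also have "\<dots> = ennreal A * (\<integral>\<^sup>+x\<in>{x. R \<le> norm x}. energy \<Phi> V u x \<partial>lebesgue) +
      ennreal D * (\<integral>\<^sup>+x. ennreal (\<Phi> x \<bar>u x\<bar>) \<partial>lebesgue)"
  proof -
    have 1: "(\<lambda>x. energy \<Phi> V u x * indicator {x. R \<le> norm x} x) \<in> borel_measurable lebesgue"
      by measurable
    have 2: "(\<lambda>x. ennreal (\<Phi> x \<bar>u x\<bar>)) \<in> borel_measurable lebesgue"
      by measurable
    show ?thesis
      unfolding nn_integral_cmult[OF 1, symmetric] nn_integral_cmult[OF 2, symmetric]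
      by (rule nn_integral_add; rule borel_measurable_times_ennreal[OF borel_measurable_const]) (rule 1 2)+
  qed
  finally show ?thesis by (simp only: A_def D_def)
qed

lemma cutoff_W_space: "(\<lambda>x. cutoff R x * u x) \<in> W_space \<Phi> V"
proof -
  obtain v where v: "0 < v" "AE x in lebesgue. v \<le> V x" by (rule V_lower)
  have "(\<integral>\<^sup>+x\<in>{x. R \<le> norm x}. energy \<Phi> V u x \<partial>lebesgue) \<le> W_modular \<Phi> V u"
    unfolding W_modular_eq_energy[OF V_measurable W_spaceD(1,2)[OF u]]
    by (intro nn_integral_mono) (auto simp: indicator_def)
  then have "(\<integral>\<^sup>+x\<in>{x. R \<le> norm x}. energy \<Phi> V u x \<partial>lebesgue) < \<infinity>"
    using W_spaceD(3)[OF u] by (rule le_less_trans)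
  moreover have "(\<integral>\<^sup>+x. ennreal (\<Phi> x \<bar>u x\<bar>) \<partial>lebesgue) < \<infinity>"
    by (rule le_less_trans[OF Phi_integral_le[OF u v]])
      (use W_spaceD(3)[OF u] in \<open>simp add: ennreal_mult_less_top\<close>)
  \<comment> \<open>Only finiteness matters here, so the weight \<open>r = 1 / 2\<close> is an
    arbitrary choice.\<close>
  ultimately have "W_modular \<Phi> V (\<lambda>x. cutoff R x * u x) < \<infinity>"
    by (intro le_less_trans[OF cutoff_modular_le[of "1 / 2"]]) (simp_all add: ennreal_mult_less_top)
  moreover obtain c where c: "0 < c" "(\<integral>\<^sup>+x. ennreal (\<Phi> x (c * \<bar>u x\<bar>)) \<partial>lebesgue) < \<infinity>"
    using u by (auto simp: W_space_def L_space_def)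
  have "(\<integral>\<^sup>+x. ennreal (\<Phi> x (c * \<bar>cutoff R x * u x\<bar>)) \<partial>lebesgue) \<le> (\<integral>\<^sup>+x. ennreal (\<Phi> x (c * \<bar>u x\<bar>)) \<partial>lebesgue)"
  proof (rule nn_integral_mono_AE)
    show "AE x in lebesgue. ennreal (\<Phi> x (c * \<bar>cutoff R x * u x\<bar>)) \<le> ennreal (\<Phi> x (c * \<bar>u x\<bar>))"
      using AE_good
    proof eventually_elim
      case (elim x)
      have "\<bar>cutoff R x * u x\<bar> \<le> \<bar>u x\<bar>"
        using cutoff_nonneg[of R x] cutoff_le_1[of R x] by (simp add: abs_mult mult_left_le_one_le)
      then show ?case
        using c(1) by (intro ennreal_leI good_mono[OF elim] mult_left_mono) auto
    qed
  qed
  then have "(\<integral>\<^sup>+x. ennreal (\<Phi> x (c * \<bar>cutoff R x * u x\<bar>)) \<partial>lebesgue) < \<infinity>"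
    using c(2) by (rule le_less_trans)
  ultimately show ?thesis
    using c(1) cutoff_measurable cutoff_weak_gradient by (auto simp: W_space_def L_space_def)
qed

text \<open>Beyond \<open>k * R\<close> the cutoff is at least
  \<open>s = exp (- (1 / (k\<^sup>2 - 1)))\<close>, and by the lower power bound the conjugate keeps
  at least the fraction \<open>s powr exp_plus \<delta>\<close>.\<close>

lemma cutoff_conj_ge:
  assumes k: "1 < k"
  shows "ennreal (exp (- (exp_plus \<delta> / (k\<^sup>2 - 1)))) *
      (\<integral>\<^sup>+x\<in>{x. k * R \<le> norm x}. ennreal (sobolev_conj \<Phi> x \<bar>u x\<bar>) \<partial>lebesgue) \<le>
    (\<integral>\<^sup>+x. ennreal (sobolev_conj \<Phi> x \<bar>cutoff R x * u x\<bar>) \<partial>lebesgue)"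
proof -
  define s where "s = exp (- (1 / (k\<^sup>2 - 1)))"
  have k2: "0 < k\<^sup>2 - 1" using k by simp
  have s: "0 < s" "s \<le> 1" using k2 by (auto simp: s_def)
  have s_powr: "s powr exp_plus \<delta> = exp (- (exp_plus \<delta> / (k\<^sup>2 - 1)))"
    by (simp add: s_def powr_def)
  have \<delta>_le: "\<delta> x \<le> exp_plus \<delta>" for x
    using \<delta>_pos by (auto simp: C_plus_def exp_plus_def intro: cSUP_upper)
  have [measurable]: "{x::real^'n. k * R \<le> norm x} \<in> sets lebesgue"
  proof -
    have "closed {x::real^'n. k * R \<le> norm x}"
      by (intro closed_Collect_le continuous_intros)
    then show ?thesis by (simp add: borel_closed)
  qed
  note [measurable] = sobolev_conj_compose_measurable[OF W_spaceD(1)[OF u]]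
  have "ennreal (s powr exp_plus \<delta>) * (\<integral>\<^sup>+x\<in>{x. k * R \<le> norm x}. ennreal (sobolev_conj \<Phi> x \<bar>u x\<bar>) \<partial>lebesgue) =
    (\<integral>\<^sup>+x. ennreal (s powr exp_plus \<delta>) * (ennreal (sobolev_conj \<Phi> x \<bar>u x\<bar>) * indicator {x. k * R \<le> norm x} x) \<partial>lebesgue)"
    by (rule nn_integral_cmult[symmetric]) measurable
  also have "\<dots> \<le> (\<integral>\<^sup>+x. ennreal (sobolev_conj \<Phi> x \<bar>cutoff R x * u x\<bar>) \<partial>lebesgue)"
  proof (rule nn_integral_mono_AE)
    show "AE x in lebesgue. ennreal (s powr exp_plus \<delta>) * (ennreal (sobolev_conj \<Phi> x \<bar>u x\<bar>) * indicator {x. k * R \<le> norm x} x)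
        \<le> ennreal (sobolev_conj \<Phi> x \<bar>cutoff R x * u x\<bar>)"
      using conj_bounds \<kappa>_le_\<delta>
    proof eventually_elim
      case (elim x)
      show ?case
      proof (cases "k * R \<le> norm x")
        case True
        let ?c = "cutoff R x"
        have c: "s \<le> ?c" "?c \<le> 1" "0 \<le> ?c"
          using cutoff_ge[OF _ k True] R by (auto simp: s_def cutoff_le_1 cutoff_nonneg)
        have "s powr exp_plus \<delta> \<le> ?c powr r" if "r \<le> exp_plus \<delta>" "0 \<le> r" for r
        proof -
          have "s powr exp_plus \<delta> \<le> s powr r" using s that by (intro powr_mono') auto
          also have "\<dots> \<le> ?c powr r" using s c that by (intro powr_mono2) auto
          finally show ?thesis .
        qed
        from this[of "\<kappa> x"] this[of "\<delta> x"]
        have "s powr exp_plus \<delta> \<le> min (?c powr \<kappa> x) (?c powr \<delta> x)"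
          using elim(2) \<delta>_le[of x] \<kappa>_gt_1[of x] \<delta>_gt_1[of x] by auto
        then have "ennreal (s powr exp_plus \<delta>) * ennreal (sobolev_conj \<Phi> x \<bar>u x\<bar>) \<le>
            ennreal (min (?c powr \<kappa> x) (?c powr \<delta> x)) * ennreal (sobolev_conj \<Phi> x \<bar>u x\<bar>)"
          by (intro mult_right_mono ennreal_leI) auto
        also have "\<dots> = ennreal (min (?c powr \<kappa> x) (?c powr \<delta> x) * sobolev_conj \<Phi> x \<bar>u x\<bar>)"
          by (rule ennreal_mult'[symmetric]) simp
        also have "\<dots> \<le> ennreal (sobolev_conj \<Phi> x (?c * \<bar>u x\<bar>))"
          using elim(1) c by (intro ennreal_leI) auto
        finally show ?thesis using True c by (simp add: abs_mult)
      qed simp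
    qed
  qed
  finally show ?thesis by (simp add: s_powr)
qed

end

text \<open>The gaps between \<open>\<nu>'\<close>, \<open>\<mu>'\<close> and the masses at infinity
  pay for all losses: \<open>r\<close> is fixed so that the factor on the main energy term fits into
  the gap at \<open>\<mu>'\<close>, then \<open>R\<close> so that the remainder does, and
  \<open>k\<close> so that the loss of the conjugate fits into the gap at \<open>\<nu>'\<close>. The
  competitor in \<open>S2\<close> is the cutoff of a single \<open>us n\<close>.\<close>

lemma concentration_step:
  assumes us: "\<And>n. us n \<in> W_space \<Phi> V" "\<And>n. W_norm \<Phi> V (us n) \<le> ennreal C" and C: "0 \<le> C"
    and pq: "0 < p" "0 < p'"
    and far: "\<And>x. R0 \<le> norm x \<Longrightarrow> p \<le> \<kappa> x \<and> \<delta> x \<le> q \<and> p' \<le> m x \<and> l x \<le> q'"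
    and \<nu>: "0 < \<nu>'" "ennreal \<nu>' < mass_at_infinity (\<lambda>n x. ennreal (sobolev_conj \<Phi> x \<bar>us n x\<bar>))"
    and \<mu>: "mass_at_infinity (\<lambda>n. energy \<Phi> V (us n)) < ennreal \<mu>'"
  shows "S2 \<Phi> V * ennreal (min (\<nu>' powr (1 / p)) (\<nu>' powr (1 / q))) \<le>
    ennreal (max (\<mu>' powr (1 / p')) (\<mu>' powr (1 / q')))"
proof -
  have \<mu>'_pos: "0 < \<mu>'"
    using \<mu> by (metis ennreal_neg not_less not_less_zero)
  have p_le_q: "p \<le> q" "p' \<le> q'"
  proof -
    \<comment> \<open>\<open>\<kappa> x \<le> \<delta> x\<close> holds almost everywhere, thus at
      some point of the far region, where it forces \<open>p \<le> q\<close>.\<close>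
    have "\<forall>\<^sub>F x in at_infinity. p \<le> \<kappa> x \<and> \<delta> x \<le> q \<and> p' \<le> m x \<and> l x \<le> q'"
      using far by (auto simp: eventually_at_infinity)
    from frequently_eventually_conj[OF AE_lebesgue_imp_frequently_at_infinity[OF \<kappa>_le_\<delta>] this]
    have "frequently (\<lambda>x. \<kappa> x \<le> \<delta> x \<and> p \<le> \<kappa> x \<and> \<delta> x \<le> q \<and> p' \<le> m x \<and> l x \<le> q') at_infinity"
      by (rule frequently_elim1) auto
    then obtain x where "\<kappa> x \<le> \<delta> x" "p \<le> \<kappa> x" "\<delta> x \<le> q" "p' \<le> m x" "l x \<le> q'"
      using frequently_ex by blast
    then show "p \<le> q" "p' \<le> q'" using m_le_l[of x] by auto
  qed
  obtain v0 where v0: "0 < v0" "AE x in lebesgue. v0 \<le> V x" by (rule V_lower)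
  define K where "K = (1 / v0) * (C + 1) powr lup"
  have K: "(\<integral>\<^sup>+x. ennreal (\<Phi> x \<bar>us n x\<bar>) \<partial>lebesgue) \<le> ennreal K" for n
  proof -
    have "(\<integral>\<^sup>+x. ennreal (\<Phi> x \<bar>us n x\<bar>) \<partial>lebesgue) \<le> ennreal (1 / v0) * W_modular \<Phi> V (us n)"
      by (rule Phi_integral_le[OF us(1) v0])
    also have "\<dots> \<le> ennreal (1 / v0) * ennreal ((C + 1) powr lup)"
      by (intro mult_left_mono W_modular_le_of_W_norm us C) auto
    also have "\<dots> = ennreal K"
      unfolding K_def using v0 by (intro ennreal_mult[symmetric]) auto
    finally show ?thesis .
  qed
  obtain z where z: "mass_at_infinity (\<lambda>n. energy \<Phi> V (us n)) < z" "z < ennreal \<mu>'"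
    using dense[OF \<mu>] by blast
  \<comment> \<open>\<open>\<mu>1\<close> divides the gap: the tails of the energy stay below it,
    and the room above it is left for the errors of the cutoff.\<close>
  then obtain \<mu>1 where \<mu>1: "0 \<le> \<mu>1" "\<mu>1 < \<mu>'" "mass_at_infinity (\<lambda>n. energy \<Phi> V (us n)) < ennreal \<mu>1"
    by (cases z) (auto simp: ennreal_less_iff)
  obtain R1 where R1: "tail_mass (\<lambda>n. energy \<Phi> V (us n)) R1 < ennreal \<mu>1"
    using \<mu>1(3) unfolding mass_at_infinity_eq_INF INF_less_iff by blast
  have "((\<lambda>r. (1 - r) powr (1 - lup) * \<mu>1) \<longlongrightarrow> (1 - 0) powr (1 - lup) * \<mu>1) (at_right 0)"
    by (intro tendsto_intros) auto
  then have "\<forall>\<^sub>F r in at_right 0. (1 - r) powr (1 - lup) * \<mu>1 < \<mu>'"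
    using \<mu>1 by (intro order_tendstoD(2)) auto
  then have "\<forall>\<^sub>F r in at_right 0. (1 - r) powr (1 - lup) * \<mu>1 < \<mu>' \<and> 0 < r \<and> r < 1"
    using eventually_at_right_real[OF zero_less_one] by eventually_elim simp
  then obtain r where r: "(1 - r) powr (1 - lup) * \<mu>1 < \<mu>'" "0 < r" "r < 1"
    using eventually_happens'[of "at_right (0::real)"] by (auto simp: trivial_limit_at_right_real)
  have "((\<lambda>R. r powr (1 - lup) * (4 / R) powr mlow * K) \<longlongrightarrow> r powr (1 - lup) * 0 * K) at_top"
  proof (intro tendsto_intros)
    have "((\<lambda>R::real. 4 / R) \<longlongrightarrow> 0) at_top"
      by (rule tendsto_divide_0[OF tendsto_const]) (simp add: filterlim_at_top_imp_at_infinity filterlim_ident)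
    moreover have "\<forall>\<^sub>F R::real in at_top. 0 \<le> 4 / R"
      using eventually_gt_at_top[of 0] by eventually_elim simp
    ultimately show "((\<lambda>R. (4 / R) powr mlow) \<longlongrightarrow> 0) at_top"
      using mlow(1) tendsto_powr'[of "\<lambda>R. 4 / R" 0 at_top "\<lambda>R. mlow" mlow] by simp
  qed
  then have "\<forall>\<^sub>F R in at_top. r powr (1 - lup) * (4 / R) powr mlow * K < \<mu>' - (1 - r) powr (1 - lup) * \<mu>1"
    using r(1) by (intro order_tendstoD(2)) auto
  then have "\<forall>\<^sub>F R in at_top. r powr (1 - lup) * (4 / R) powr mlow * K < \<mu>' - (1 - r) powr (1 - lup) * \<mu>1 \<and>
      4 \<le> R \<and> R0 \<le> R \<and> R1 \<le> R"
    using eventually_ge_at_top[of 4] eventually_ge_at_top[of R0] eventually_ge_at_top[of R1]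
    by eventually_elim auto
  then obtain R where R: "r powr (1 - lup) * (4 / R) powr mlow * K < \<mu>' - (1 - r) powr (1 - lup) * \<mu>1"
    "4 \<le> R" "R0 \<le> R" "R1 \<le> R"
    using eventually_happens'[OF trivial_limit_at_top_linorder] by blast
  have "tail_mass (\<lambda>n. energy \<Phi> V (us n)) R < ennreal \<mu>1"
    using R1 antimonoD[OF tail_mass_antimono R(4)] by (rule le_less_trans[rotated])
  then have ev: "\<forall>\<^sub>F n in sequentially. (\<integral>\<^sup>+x\<in>{x. R \<le> norm x}. energy \<Phi> V (us n) x \<partial>lebesgue) < ennreal \<mu>1"
    unfolding tail_mass_def by (rule Limsup_lessD)
  obtain w where w: "ennreal \<nu>' < w" "w < mass_at_infinity (\<lambda>n x. ennreal (sobolev_conj \<Phi> x \<bar>us n x\<bar>))"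
    using dense[OF \<nu>(2)] by blast
  have "w < top" using w(2) top.not_eq_extremum by fastforce
  then obtain \<nu>1 where \<nu>1: "w = ennreal \<nu>1" "\<nu>' < \<nu>1"
    using w(1) \<nu>(1) by (cases w) (auto simp: ennreal_less_iff)
  \<comment> \<open>\<open>k\<close> is computed backwards: \<open>exp (- e)\<close> carries
    \<open>\<nu>1\<close> to \<open>\<nu>'\<close>, and \<open>k\<close> is the value at which the
    factor in \<open>cutoff_conj_ge\<close> equals \<open>exp (- e)\<close>.\<close>
  define e where "e = ln (\<nu>1 / \<nu>')"
  have e: "0 < e" using \<nu>1 \<nu>(1) by (simp add: e_def)
  have D: "0 < exp_plus \<delta>"
  proof -
    have "\<delta> 0 \<le> exp_plus \<delta>"
      using \<delta>_pos by (auto simp: C_plus_def exp_plus_def intro: cSUP_upper)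
    then show ?thesis using \<delta>_gt_1[of 0] by linarith
  qed
  define k where "k = sqrt (1 + exp_plus \<delta> / e)"
  have k: "1 < k" "exp_plus \<delta> / (k\<^sup>2 - 1) = e"
    using e D by (auto simp: k_def)
  have k_exp: "exp (- e) * \<nu>1 = \<nu>'"
    using \<nu>1 \<nu>(1) by (simp add: e_def exp_minus)
  have "ennreal \<nu>1 < tail_mass (\<lambda>n x. ennreal (sobolev_conj \<Phi> x \<bar>us n x\<bar>)) (k * R)"
    using w(2) unfolding \<nu>1(1) mass_at_infinity_eq_INF by (rule less_le_trans) (simp add: INF_lower)
  then have "frequently (\<lambda>n. ennreal \<nu>1 < (\<integral>\<^sup>+x\<in>{x. k * R \<le> norm x}. ennreal (sobolev_conj \<Phi> x \<bar>us n x\<bar>) \<partial>lebesgue)) sequentially"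
    unfolding tail_mass_def frequently_def not_less by (auto dest: Limsup_bounded)
  \<comment> \<open>A strict upper bound on a limit superior holds eventually, a strict lower bound
    only frequently; together they still yield a common index.\<close>
  from frequently_eventually_conj[OF this ev] obtain n
    where n: "(\<integral>\<^sup>+x\<in>{x. R \<le> norm x}. energy \<Phi> V (us n) x \<partial>lebesgue) < ennreal \<mu>1"
      "ennreal \<nu>1 < (\<integral>\<^sup>+x\<in>{x. k * R \<le> norm x}. ennreal (sobolev_conj \<Phi> x \<bar>us n x\<bar>) \<partial>lebesgue)"
    using frequently_ex by blast
  define v where "v x = cutoff R x * us n x" for x
  have v_W: "v \<in> W_space \<Phi> V"
    unfolding v_def by (rule cutoff_W_space[OF us(1) R(2)])
  have "W_modular \<Phi> V v \<le> ennreal ((1 - r) powr (1 - lup)) * (\<integral>\<^sup>+x\<in>{x. R \<le> norm x}. energy \<Phi> V (us n) x \<partial>lebesgue) +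
    ennreal (r powr (1 - lup) * (4 / R) powr mlow) * (\<integral>\<^sup>+x. ennreal (\<Phi> x \<bar>us n x\<bar>) \<partial>lebesgue)"
    unfolding v_def by (rule cutoff_modular_le[OF us(1) R(2) r(2,3)])
  also have "\<dots> \<le> ennreal ((1 - r) powr (1 - lup)) * ennreal \<mu>1 + ennreal (r powr (1 - lup) * (4 / R) powr mlow) * ennreal K"
    using n(1) K by (intro add_mono mult_left_mono) auto
  also have "\<dots> = ennreal ((1 - r) powr (1 - lup) * \<mu>1 + r powr (1 - lup) * (4 / R) powr mlow * K)"
  proof -
    have "0 \<le> K" using v0(1) by (simp add: K_def)
    then show ?thesis
      using \<mu>1(1) by (subst ennreal_plus) (auto simp only: ennreal_mult' powr_ge_zero mult_nonneg_nonneg)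
  qed
  also have "\<dots> \<le> ennreal \<mu>'"
    using R(1) by (intro ennreal_leI) simp
  finally have modular: "W_modular \<Phi> V v \<le> ennreal \<mu>'" .
  have "ennreal \<nu>' = ennreal (exp (- e)) * ennreal \<nu>1"
    unfolding k_exp[symmetric] by (rule ennreal_mult') simp
  also have "\<dots> \<le> ennreal (exp (- e)) * (\<integral>\<^sup>+x\<in>{x. k * R \<le> norm x}. ennreal (sobolev_conj \<Phi> x \<bar>us n x\<bar>) \<partial>lebesgue)"
    using n(2) by (intro mult_left_mono) auto
  also have "\<dots> \<le> (\<integral>\<^sup>+x. ennreal (sobolev_conj \<Phi> x \<bar>v x\<bar>) \<partial>lebesgue)"
    using cutoff_conj_ge[OF us(1) R(2) k(1)] unfolding k(2) v_def .
  finally have conj: "ennreal \<nu>' \<le> (\<integral>\<^sup>+x. ennreal (sobolev_conj \<Phi> x \<bar>v x\<bar>) \<partial>lebesgue)" .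
  \<comment> \<open>A competitor in \<open>S2\<close> must be nonzero; otherwise its conjugate
    integral would vanish, against \<open>0 < \<nu>'\<close>.\<close>
  have "\<not> (AE x in lebesgue. v x = 0)"
  proof
    assume "AE x in lebesgue. v x = 0"
    then have "AE x in lebesgue. ennreal (sobolev_conj \<Phi> x \<bar>v x\<bar>) = 0"
      using conj_bounds
    proof eventually_elim
      case (elim x)
      have "sobolev_conj \<Phi> x (0 * 0) \<le> max (0 powr \<kappa> x) (0 powr \<delta> x) * sobolev_conj \<Phi> x 0"
        using elim(2) by blast
      then have "sobolev_conj \<Phi> x 0 \<le> 0" by simp
      then have "ennreal (sobolev_conj \<Phi> x 0) = 0" by (rule ennreal_neg)
      then show ?case by (simp only: elim(1) abs_zero)
    qed
    then have "(\<integral>\<^sup>+x. ennreal (sobolev_conj \<Phi> x \<bar>v x\<bar>) \<partial>lebesgue) = 0"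
      by (simp add: nn_integral_0_iff_AE[OF sobolev_conj_compose_measurable[OF W_spaceD(1)[OF v_W]]])
    with conj \<nu>(1) show False by simp
  qed
  moreover have "ennreal (min (\<nu>' powr (1 / p)) (\<nu>' powr (1 / q))) \<le> L_norm (sobolev_conj \<Phi>) v"
  proof (rule L_norm_ge[OF W_spaceD(1)[OF v_W] \<nu>(1) conj pq(1) p_le_q(1)])
    have "v x = 0 \<or> p \<le> \<kappa> x \<and> \<delta> x \<le> q" for x
      using far[of x] cutoff_eq_0[of R x] R by (cases "norm x \<le> R") (auto simp: v_def)
    then show "AE x in lebesgue. v x = 0 \<or> p \<le> \<kappa> x \<and> \<delta> x \<le> q" by simp
  qed
  ultimately have "S2 \<Phi> V * ennreal (min (\<nu>' powr (1 / p)) (\<nu>' powr (1 / q))) \<le> W_norm \<Phi> V v"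
    using \<nu>(1) by (intro S2_mult_le[OF v_W]) auto
  also have "\<dots> \<le> ennreal (max (\<mu>' powr (1 / p')) (\<mu>' powr (1 / q')))"
  proof (rule W_norm_le[OF W_spaceD(1,2)[OF v_W] \<mu>'_pos modular pq(2) p_le_q(2)])
    show "AE x in lebesgue. v x = 0 \<and> weak_grad v x = 0 \<or> p' \<le> m x \<and> l x \<le> q'"
      using cutoff_support[OF us(1) R(2), of n]
    proof eventually_elim
      case (elim x)
      then show ?case
        using far[of x] R unfolding v_def[abs_def] by (cases "norm x \<le> R") auto
    qed
  qed
  finally show ?thesis .
qed

section \<open>Closing the gaps by passing to the limit\<close>

lemma limit_exponentD:
  fixes r :: "real^'n \<Rightarrow> real"
  assumes "limit_exponent r r0" "r \<in> C_plus"
  shows "1 < r0" "0 < e \<Longrightarrow> \<forall>\<^sub>F x in at_infinity. \<bar>r x - r0\<bar> < e"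
  using assms by (auto simp: limit_exponent_def C_plus_def dist_real_def dest: tendstoD)

text \<open>Far out the exponents lie within a margin \<open>e\<close> of their limits, and both
  sides of the resulting estimate are continuous as \<open>e\<close> tends to 0.\<close>

lemma concentration_limit_exponents:
  assumes us: "\<And>n. us n \<in> W_space \<Phi> V" "\<And>n. W_norm \<Phi> V (us n) \<le> ennreal C" and C: "0 \<le> C"
    and lim: "limit_exponent m m0" "limit_exponent \<kappa> \<kappa>0" "limit_exponent l l0" "limit_exponent \<delta> \<delta>0"
    and \<nu>: "0 < \<nu>'" "ennreal \<nu>' < mass_at_infinity (\<lambda>n x. ennreal (sobolev_conj \<Phi> x \<bar>us n x\<bar>))"
    and \<mu>: "mass_at_infinity (\<lambda>n. energy \<Phi> V (us n)) < ennreal \<mu>'"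
  shows "S2 \<Phi> V < top"
    and "S2 \<Phi> V * ennreal (min (\<nu>' powr (1 / \<kappa>0)) (\<nu>' powr (1 / \<delta>0))) \<le>
      ennreal (max (\<mu>' powr (1 / m0)) (\<mu>' powr (1 / l0)))"
proof -
  have ml: "m \<in> C_plus" "l \<in> C_plus"
    using adm by (auto simp: admissible_def cond_exponents_def)
  note gt = limit_exponentD(1)[OF lim(1) ml(1)] limit_exponentD(1)[OF lim(2) \<kappa>_pos]
    limit_exponentD(1)[OF lim(3) ml(2)] limit_exponentD(1)[OF lim(4) \<delta>_pos]
  have \<mu>'_pos: "0 < \<mu>'"
    using \<mu> by (metis ennreal_neg not_less not_less_zero)
  have step: "S2 \<Phi> V * ennreal (min (\<nu>' powr (1 / (\<kappa>0 - e))) (\<nu>' powr (1 / (\<delta>0 + e)))) \<le>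
      ennreal (max (\<mu>' powr (1 / (m0 - e))) (\<mu>' powr (1 / (l0 + e))))" if e: "0 < e" "e < 1" for e
  proof -
    have "\<forall>\<^sub>F x in at_infinity. \<kappa>0 - e \<le> \<kappa> x \<and> \<delta> x \<le> \<delta>0 + e \<and> m0 - e \<le> m x \<and> l x \<le> l0 + e"
      using limit_exponentD(2)[OF lim(1) ml(1) e(1)] limit_exponentD(2)[OF lim(2) \<kappa>_pos e(1)]
        limit_exponentD(2)[OF lim(3) ml(2) e(1)] limit_exponentD(2)[OF lim(4) \<delta>_pos e(1)]
      by eventually_elim (auto simp: abs_less_iff)
    then obtain R0 where "\<And>x. R0 \<le> norm x \<Longrightarrow> \<kappa>0 - e \<le> \<kappa> x \<and> \<delta> x \<le> \<delta>0 + e \<and> m0 - e \<le> m x \<and> l x \<le> l0 + e"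
      by (auto simp: eventually_at_infinity)
    then show ?thesis
      using gt e by (intro concentration_step[OF us C _ _ _ \<nu> \<mu>]) auto
  qed
  \<comment> \<open>The limit exponents exceed 1, so with margin \<open>1 / 2\<close> they stay
    positive. A positive \<open>y\<close> and a finite right-hand side exclude
    \<open>S2 \<Phi> V = top\<close>; finiteness makes multiplication by \<open>S2 \<Phi> V\<close>
    continuous in the limit below.\<close>
  define y where "y = min (\<nu>' powr (1 / (\<kappa>0 - 1 / 2))) (\<nu>' powr (1 / (\<delta>0 + 1 / 2)))"
  have "0 < y" using \<nu>(1) by (simp add: y_def)
  have "S2 \<Phi> V \<noteq> top"
  proof
    assume "S2 \<Phi> V = top"
    with step[of "1 / 2"] have "top * ennreal y \<le> ennreal (max (\<mu>' powr (1 / (m0 - 1 / 2))) (\<mu>' powr (1 / (l0 + 1 / 2))))"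
      by (simp add: y_def)
    with \<open>0 < y\<close> show False by (simp add: ennreal_top_mult top_unique)
  qed
  then show S2: "S2 \<Phi> V < top" by (simp add: top.not_eq_extremum)
  show "S2 \<Phi> V * ennreal (min (\<nu>' powr (1 / \<kappa>0)) (\<nu>' powr (1 / \<delta>0))) \<le>
      ennreal (max (\<mu>' powr (1 / m0)) (\<mu>' powr (1 / l0)))"
  proof (rule tendsto_le)
    show "at_right (0::real) \<noteq> bot" by simp
    have *: "((\<lambda>e. c powr (1 / (r + s * e))) \<longlongrightarrow> c powr (1 / (r + s * 0))) (at_right 0)" if "0 < c" "1 < r" for c r s :: real
      using that by (intro tendsto_intros) auto
    have *: "((\<lambda>e. c powr (1 / (r - e))) \<longlongrightarrow> c powr (1 / r)) (at_right 0)"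
      "((\<lambda>e. c powr (1 / (r + e))) \<longlongrightarrow> c powr (1 / r)) (at_right 0)" if "0 < c" "1 < r" for c r :: real
      using *[OF that, of "-1"] *[OF that, of 1] by simp_all
    show "((\<lambda>e. S2 \<Phi> V * ennreal (min (\<nu>' powr (1 / (\<kappa>0 - e))) (\<nu>' powr (1 / (\<delta>0 + e))))) \<longlongrightarrow>
        S2 \<Phi> V * ennreal (min (\<nu>' powr (1 / \<kappa>0)) (\<nu>' powr (1 / \<delta>0)))) (at_right 0)"
      by (intro ennreal_tendsto_cmult S2 tendsto_ennrealI tendsto_min * \<nu>(1) gt)
    show "((\<lambda>e. ennreal (max (\<mu>' powr (1 / (m0 - e))) (\<mu>' powr (1 / (l0 + e))))) \<longlongrightarrow>
        ennreal (max (\<mu>' powr (1 / m0)) (\<mu>' powr (1 / l0)))) (at_right 0)"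
      by (intro tendsto_ennrealI tendsto_max * \<mu>'_pos gt)
    show "\<forall>\<^sub>F e in at_right 0. S2 \<Phi> V * ennreal (min (\<nu>' powr (1 / (\<kappa>0 - e))) (\<nu>' powr (1 / (\<delta>0 + e)))) \<le>
        ennreal (max (\<mu>' powr (1 / (m0 - e))) (\<mu>' powr (1 / (l0 + e))))"
      using eventually_at_right_real[OF zero_less_one] by eventually_elim (simp add: step)
  qed
qed

text \<open>Apart from the trivial cases, \<open>\<mu>'\<close> decreases to \<open>\<mu>\<close>
  and \<open>\<nu>'\<close> increases to \<open>\<nu>\<close>. An infinite \<open>\<nu>\<close>
  forces \<open>S2 \<Phi> V = 0\<close>, and then the left-hand side is 0 because
  \<open>0 * \<infinity> = 0\<close> in \<open>ennreal\<close>.\<close>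

lemma concentration_at_infinity:
  assumes us: "\<And>n. us n \<in> W_space \<Phi> V" "\<And>n. W_norm \<Phi> V (us n) \<le> ennreal C" and C: "0 \<le> C"
    and lim: "limit_exponent m m0" "limit_exponent \<kappa> \<kappa>0" "limit_exponent l l0" "limit_exponent \<delta> \<delta>0"
    and \<nu>_def: "\<nu> = mass_at_infinity (\<lambda>n x. ennreal (sobolev_conj \<Phi> x \<bar>us n x\<bar>))"
    and \<mu>_def: "\<mu> = mass_at_infinity (\<lambda>n. energy \<Phi> V (us n))"
  shows "S2 \<Phi> V * min (epowr \<nu> (1 / \<kappa>0)) (epowr \<nu> (1 / \<delta>0)) \<le>
    max (epowr \<mu> (1 / m0)) (epowr \<mu> (1 / l0))"
proof (cases "\<mu> = top \<or> \<nu> = 0")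
  case True
  then show ?thesis by (auto simp: epowr_def)
next
  case False
  obtain \<mu>0 where \<mu>0: "\<mu> = ennreal \<mu>0" "0 \<le> \<mu>0"
    using False by (cases \<mu>) auto
  have pos: "0 < m0" "0 < \<kappa>0" "0 < l0" "0 < \<delta>0"
    using lim by (auto simp: limit_exponent_def)
  define Y where "Y = max (\<mu>0 powr (1 / m0)) (\<mu>0 powr (1 / l0))"
  have rhs: "max (epowr \<mu> (1 / m0)) (epowr \<mu> (1 / l0)) = ennreal Y"
    using \<mu>0 by (simp add: epowr_def max_ennreal Y_def)
  have less: "\<mu> < ennreal \<mu>'" if "\<mu>0 < \<mu>'" for \<mu>'
    using that \<mu>0 by (simp add: ennreal_less_iff)
  have bound: "S2 \<Phi> V * ennreal (min (\<nu>' powr (1 / \<kappa>0)) (\<nu>' powr (1 / \<delta>0))) \<le> ennreal Y"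
    if \<nu>': "0 < \<nu>'" "ennreal \<nu>' < \<nu>" for \<nu>'
  proof (rule tendsto_lowerbound)
    show "((\<lambda>\<mu>'. ennreal (max (\<mu>' powr (1 / m0)) (\<mu>' powr (1 / l0)))) \<longlongrightarrow> ennreal Y) (at_right \<mu>0)"
      unfolding Y_def
    proof (intro tendsto_ennrealI tendsto_max)
      have "\<forall>\<^sub>F x in at_right \<mu>0. 0 \<le> x"
        using eventually_at_right_less[of \<mu>0] by eventually_elim (use \<mu>0 in simp)
      then have "((\<lambda>x. x powr (1 / r)) \<longlongrightarrow> \<mu>0 powr (1 / r)) (at_right \<mu>0)" if "0 < r" for r
        using that by (intro tendsto_powr' tendsto_const tendsto_ident_at) auto
      then show "((\<lambda>x. x powr (1 / m0)) \<longlongrightarrow> \<mu>0 powr (1 / m0)) (at_right \<mu>0)"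
        "((\<lambda>x. x powr (1 / l0)) \<longlongrightarrow> \<mu>0 powr (1 / l0)) (at_right \<mu>0)"
        using pos by auto
    qed
    show "\<forall>\<^sub>F \<mu>' in at_right \<mu>0. S2 \<Phi> V * ennreal (min (\<nu>' powr (1 / \<kappa>0)) (\<nu>' powr (1 / \<delta>0))) \<le>
        ennreal (max (\<mu>' powr (1 / m0)) (\<mu>' powr (1 / l0)))"
      using eventually_at_right_less[of \<mu>0]
    proof eventually_elim
      case (elim \<mu>')
      show ?case
        by (rule concentration_limit_exponents(2)[OF us C lim]) (use \<nu>' less[OF elim] in \<open>auto simp: \<nu>_def \<mu>_def\<close>)
    qed
  qed simp
  have S2: "S2 \<Phi> V < top" if "0 < \<nu>'" "ennreal \<nu>' < \<nu>" for \<nu>'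
    by (rule concentration_limit_exponents(1)[OF us C lim, where \<nu>' = \<nu>' and \<mu>' = "\<mu>0 + 1"])
      (use that less[of "\<mu>0 + 1"] in \<open>auto simp: \<nu>_def \<mu>_def\<close>)
  show ?thesis
  proof (cases \<nu>)
    case (real \<nu>0)
    with False have \<nu>0: "0 < \<nu>0" by auto
    have ev: "\<forall>\<^sub>F x in at_left \<nu>0. 0 < x \<and> x < \<nu>0"
      using eventually_at_left_real[OF \<nu>0] by simp
    have S: "S2 \<Phi> V < top"
      using S2[of "\<nu>0 / 2"] \<nu>0 real by (simp add: ennreal_less_iff)
    have "S2 \<Phi> V * ennreal (min (\<nu>0 powr (1 / \<kappa>0)) (\<nu>0 powr (1 / \<delta>0))) \<le> ennreal Y"
    proof (rule tendsto_upperbound)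
      show "((\<lambda>x. S2 \<Phi> V * ennreal (min (x powr (1 / \<kappa>0)) (x powr (1 / \<delta>0)))) \<longlongrightarrow>
          S2 \<Phi> V * ennreal (min (\<nu>0 powr (1 / \<kappa>0)) (\<nu>0 powr (1 / \<delta>0)))) (at_left \<nu>0)"
        using \<nu>0 by (intro ennreal_tendsto_cmult S tendsto_ennrealI tendsto_min tendsto_powr tendsto_const tendsto_ident_at) auto
      show "\<forall>\<^sub>F x in at_left \<nu>0. S2 \<Phi> V * ennreal (min (x powr (1 / \<kappa>0)) (x powr (1 / \<delta>0))) \<le> ennreal Y"
        using ev by eventually_elim (rule bound; simp add: real ennreal_less_iff)
    qed simp
    then show ?thesis
      unfolding rhs using real by (simp add: epowr_def min_ennreal)
  next
    case top
    have "S2 \<Phi> V = 0"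
    proof (rule ccontr)
      assume "S2 \<Phi> V \<noteq> 0"
      moreover have "S2 \<Phi> V < top" using S2[of 1] top by simp
      ultimately obtain s where s: "S2 \<Phi> V = ennreal s" "0 < s"
        by (cases "S2 \<Phi> V") auto
      \<comment> \<open>This gives \<open>s * M = Y + s\<close>, and \<open>x\<close> is so large
        that both of its roots are at least \<open>M\<close>; the bound at \<open>\<nu>' = x\<close>
        is then violated.\<close>
      define M where "M = Y / s + 1"
      have "0 \<le> Y" by (simp add: Y_def le_max_iff_disj)
      then have M: "1 \<le> M" "Y < s * M" using s by (auto simp: M_def field_simps)
      define x where "x = max (M powr \<kappa>0) (M powr \<delta>0)"
      have "M \<le> x powr (1 / r)" if "0 < r" "M powr r \<le> x" for r
      proof -
        have "M = (M powr r) powr (1 / r)" using that M by (simp add: powr_powr)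
        also have "\<dots> \<le> x powr (1 / r)" using that by (intro powr_mono2) auto
        finally show ?thesis .
      qed
      then have "M \<le> min (x powr (1 / \<kappa>0)) (x powr (1 / \<delta>0))"
        using pos by (simp add: x_def)
      then have "s * M \<le> s * min (x powr (1 / \<kappa>0)) (x powr (1 / \<delta>0))"
        using s by (intro mult_left_mono) auto
      moreover have "0 < x" using M by (simp add: x_def less_max_iff_disj)
      then have "ennreal s * ennreal (min (x powr (1 / \<kappa>0)) (x powr (1 / \<delta>0))) \<le> ennreal Y"
        using bound[of x] s top by simp
      then have "s * min (x powr (1 / \<kappa>0)) (x powr (1 / \<delta>0)) \<le> Y"
        using \<open>0 \<le> Y\<close> s by (subst (asm) ennreal_mult[symmetric]) (auto simp: ennreal_le_iff)
      ultimately show False using M by linarith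
    qed
    then show ?thesis by simp
  qed
qed

end

theorem theorem1p5:
  fixes \<Phi> :: "real^'n \<Rightarrow> real \<Rightarrow> real"
    and m l \<kappa> \<delta> V u :: "real^'n \<Rightarrow> real"
    and us :: "nat \<Rightarrow> real^'n \<Rightarrow> real"
    and \<mu> \<nu> :: "(real^'n) measure"
    and \<mu>inf \<nu>inf :: ennreal
  assumes "generalized_young \<Phi>"
    and "admissible \<Phi> m l"
    and "\<kappa> \<in> C_plus" and "\<delta> \<in> C_plus"
    and "exp_plus l < exp_minus \<kappa>"
    and "AE x in lebesgue. \<kappa> x \<le> \<delta> x"
    and "AE x in lebesgue. \<forall>c\<ge>0. \<forall>t\<ge>0.
           min (c powr \<kappa> x) (c powr \<delta> x) * sobolev_conj \<Phi> x t \<le> sobolev_conj \<Phi> x (c * t) \<and>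
           sobolev_conj \<Phi> x (c * t) \<le> max (c powr \<kappa> x) (c powr \<delta> x) * sobolev_conj \<Phi> x t"
    and "locally_integrable V"
    and "0 < essinf V"
    and "W_bounded \<Phi> V us"
    and "W_weak_conv \<Phi> V us u"
    and "weak_star_conv (\<lambda>n. borel_density (energy \<Phi> V (us n))) \<mu>"
    and "weak_star_conv (\<lambda>n. borel_density (\<lambda>x. ennreal (sobolev_conj \<Phi> x \<bar>us n x\<bar>))) \<nu>"
    and "\<mu>inf = mass_at_infinity (\<lambda>n. energy \<Phi> V (us n))"
    and "\<nu>inf = mass_at_infinity (\<lambda>n x. ennreal (sobolev_conj \<Phi> x \<bar>us n x\<bar>))"
  shows "limsup (\<lambda>n. \<integral>\<^sup>+x. energy \<Phi> V (us n) x \<partial>lebesgue) = emeasure \<mu> UNIV + \<mu>inf \<and>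
    limsup (\<lambda>n. \<integral>\<^sup>+x. ennreal (sobolev_conj \<Phi> x \<bar>us n x\<bar>) \<partial>lebesgue) = emeasure \<nu> UNIV + \<nu>inf \<and>
    (\<forall>m\<^sub>0 \<kappa>\<^sub>0 l\<^sub>0 \<delta>\<^sub>0.
      limit_exponent m m\<^sub>0 \<and> limit_exponent \<kappa> \<kappa>\<^sub>0 \<and> limit_exponent l l\<^sub>0 \<and> limit_exponent \<delta> \<delta>\<^sub>0 \<longrightarrow>
      S2 \<Phi> V * min (epowr \<nu>inf (1 / \<kappa>\<^sub>0)) (epowr \<nu>inf (1 / \<delta>\<^sub>0))
        \<le> max (epowr \<mu>inf (1 / m\<^sub>0)) (epowr \<mu>inf (1 / l\<^sub>0)))"
proof -
  interpret concentration \<Phi> m l \<kappa> \<delta> V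
    using assms(1-4,6-9) by unfold_locales
  have us: "us n \<in> W_space \<Phi> V" for n
    using assms(10) by (simp add: W_bounded_def)
  obtain C where "\<And>n. W_norm \<Phi> V (us n) \<le> ennreal C"
    using assms(10) by (auto simp: W_bounded_def)
  \<comment> \<open>\<open>ennreal\<close> sends negative reals to 0, so the bound may be taken
    nonnegative.\<close>
  then have C: "W_norm \<Phi> V (us n) \<le> ennreal (max 0 C)" for n
    by (rule order_trans) (simp add: ennreal_leI)
  have "limsup (\<lambda>n. \<integral>\<^sup>+x. energy \<Phi> V (us n) x \<partial>lebesgue) = emeasure \<mu> UNIV + \<mu>inf"
    unfolding assms(14)
    using energy_measurable(3)[OF V_measurable W_spaceD(1,2)[OF us]] assms(12)
    by (rule limsup_eq_weak_limit_plus_mass_at_infinity)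
  moreover have "limsup (\<lambda>n. \<integral>\<^sup>+x. ennreal (sobolev_conj \<Phi> x \<bar>us n x\<bar>) \<partial>lebesgue) =
      emeasure \<nu> UNIV + \<nu>inf"
    unfolding assms(15)
    using sobolev_conj_compose_measurable[OF W_spaceD(1)[OF us]] assms(13)
    by (rule limsup_eq_weak_limit_plus_mass_at_infinity)
  moreover have "S2 \<Phi> V * min (epowr \<nu>inf (1 / \<kappa>\<^sub>0)) (epowr \<nu>inf (1 / \<delta>\<^sub>0))
        \<le> max (epowr \<mu>inf (1 / m\<^sub>0)) (epowr \<mu>inf (1 / l\<^sub>0))"
    if "limit_exponent m m\<^sub>0" "limit_exponent \<kappa> \<kappa>\<^sub>0" "limit_exponent l l\<^sub>0" "limit_exponent \<delta> \<delta>\<^sub>0"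
    for m\<^sub>0 \<kappa>\<^sub>0 l\<^sub>0 \<delta>\<^sub>0
    by (rule concentration_at_infinity[OF us C _ that assms(15,14)]) simp
  ultimately show ?thesis by blast
qed

end
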